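(* Let $A$ be a real $n\times n$ matrix, diagonalizable, with non-purely-imaginary eigenvalues $\lambda_1,\dots,\lambda_n$, and consider the system $\dot v=Av+g(v,t)$, $v\in\mathbb{R}^n$, $t\in\mathbb{R}^+=[0,+\infty)$, where $g$ is at least quadratic in $v$, i.e. $\partial_v^\nu g(0,t)\equiv0$ for all $\nu\in\mathbb{N}^n$ with $|\nu|\le1$. In coordinates $x$ diagonalizing $A$ the system reads $$\dot x_l=\lambda_lx_l+\tilde g_l(x,t),\qquad l=1,\dots,n. \qquad (\ast)$$ Set $\Lambda=(\lambda_1,\dots,\lambda_n)$ and $f(x,y,t):=y\cdot\tilde g(x,t)$, and assume that, for some $R\in(0,1/2]$, $f(\cdot,\cdot,t)\in\mathfrak{C}(\mathcal{Q}_R)$ for every $t\in\mathbb{R}^+$, with continuous dependence on $t$. (1) Suppose that there is $M_f\in[1,+\infty)$ such that $\|f(\cdot,\cdot,t)\|_R\le M_f$ for all $t\in\mathbb{R}^+$, and that there exist $\gamma>0$ and $\tau\ge n$ such that $$\max_{l=1,\dots,n}\big|\Re\big((\alpha-e_l)\cdot\Lambda\big)\big|^{-1}\le\gamma|\alpha|^\tau\qquad\text{for all }\alpha\in\mathbb{N}^n\text{ with }|\alpha|\ge2,$$ where $e_l$ is the $l$-th vector of the canonical basis of $\mathbb{R}^n$. Then the system $(\ast)$ is integrable in a suitable neighbourhood of the origin. (2) The same conclusion holds without any non-resonance condition on $\Lambda$, provided that there exist $M_f\in[1,+\infty)$ and $a\in(0,1)$ such that $\|f(\cdot,\cdot,t)\|_R\le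 M_fe^{-at}$ for all $t\in\mathbb{R}^+$.
   Context: $\mathbb{N}=\{0,1,2,\dots\}$, $|\alpha|=\sum_l\alpha_l$ for $\alpha\in\mathbb{N}^n$. $\mathcal{Q}_R=\{(x,y)\in\mathbb{C}^{2n}:|x|,|y|\le R\}$ with $|x|=\max_l|x_l|$; $\mathfrak{C}(\mathcal{Q}_R)$ is the space of functions analytic in the interior of $\mathcal{Q}_R$ and continuous up to the boundary. For $G(x,y,t)=\sum_{\alpha,\beta\in\mathbb{N}^n}g_{\alpha,\beta}(t)x^\alpha y^\beta$, the Taylor norm is $\|G(\cdot,\cdot,t)\|_R=\sum_{\alpha,\beta}|g_{\alpha,\beta}(t)|R^{|\alpha+\beta|}$. "Integrable in a neighbourhood of the origin" means: there are $0<R_*<R_0$ and a family of maps $\mathcal{M}_x(\cdot,t):\tilde{\mathcal{Q}}_{R_*}\to\tilde{\mathcal{Q}}_{R_0}$, $t\in\mathbb{R}^+$, with $\tilde{\mathcal{Q}}_\rho=\{x\in\mathbb{C}^n:|x|\le\rho\}$, each being an analytic change of coordinates $x=\mathcal{M}_x(x^{(\infty)},t)$ from a neighbourhood of the origin onto a neighbourhood of the origin, which conjugates $(\ast)$ to the linear system $\dot x^{(\infty)}_l=\lambda_lx^{(\infty)}_l$; i.e. the solutions of $(\ast)$ are explicitly $x(t)=\mathcal{M}_x\big(e^{\mathcal{A}t}x^{(\infty)}(0),t\big)$ with $\mathcal{A}=\mathrm{diag}(\lambda_1,\dots,\lambda_n)$, as long as $e^{\mathcal{A}t}x^{(\infty)}(0)$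 remains in $\tilde{\mathcal{Q}}_{R_*}$. *)

theory Defs
  imports "HOL-Analysis.Analysis"
begin

section \<open>Power series in several complex variables\<close>

text \<open>Multi-indices over a finite index type are functions into the naturals. Pairs
  \<open>(x, y)\<close> of \<open>n\<close>-vectors are vectors indexed by the sum type \<open>'n + 'n\<close>
  (\<open>Inl\<close> for \<open>x\<close>, \<open>Inr\<close> for \<open>y\<close>), so one set of
  notions serves for functions of \<open>x\<close> and of \<open>(x, y)\<close>.\<close>

definition mi_size :: "('m::finite \<Rightarrow> nat) \<Rightarrow> nat" where
  "mi_size \<alpha> = (\<Sum>l\<in>UNIV. \<alpha> l)"

definition mi_power :: "complex^'m \<Rightarrow> ('m::finite \<Rightarrow> nat) \<Rightarrow> complex" where
  "mi_power z \<alpha> = (\<Prod>l\<in>UNIV. (z $ l) ^ \<alpha> l)"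

definition polydisc :: "real \<Rightarrow> (complex^'m::finite) set" where
  "polydisc \<rho> = {z. \<forall>l. norm (z $ l) \<le> \<rho>}"

definition has_power_series ::
    "(complex^'m::finite \<Rightarrow> complex) \<Rightarrow> (('m \<Rightarrow> nat) \<Rightarrow> complex) \<Rightarrow> complex^'m \<Rightarrow> bool" where
  "has_power_series F c p \<longleftrightarrow>
     (\<exists>r>0. \<forall>z. (\<forall>l. norm (z $ l - p $ l) < r) \<longrightarrow>
        ((\<lambda>\<alpha>. c \<alpha> * mi_power (z - p) \<alpha>) has_sum F z) UNIV)"

definition mv_analytic_on :: "(complex^'m::finite \<Rightarrow> complex) \<Rightarrow> (complex^'m) set \<Rightarrow> bool" where
  "mv_analytic_on F S \<longleftrightarrow> (\<forall>p\<in>S. \<exists>c. has_power_series F c p)"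

definition mv_analytic_map_on ::
    "(complex^'m::finite \<Rightarrow> complex^'k::finite) \<Rightarrow> (complex^'m) set \<Rightarrow> bool" where
  "mv_analytic_map_on F S \<longleftrightarrow> (\<forall>l. mv_analytic_on (\<lambda>z. F z $ l) S)"

definition frakC :: "real \<Rightarrow> (complex^'m::finite \<Rightarrow> complex) set" where
  "frakC \<rho> = {F. mv_analytic_on F (interior (polydisc \<rho>)) \<and> continuous_on (polydisc \<rho>) F}"

text \<open>The Taylor coefficients at the origin; meaningful for functions analytic there.\<close>

definition taylor_coeff :: "(complex^'m::finite \<Rightarrow> complex) \<Rightarrow> ('m \<Rightarrow> nat) \<Rightarrow> complex" where
  "taylor_coeff F = (THE c. has_power_series F c 0)"

text \<open>The sum is taken in \<^typ>\<open>ennreal\<close>, so a divergent series has norm \<open>\<infinity>\<close>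
  and a finite bound on the norm includes convergence.\<close>

definition taylor_norm :: "real \<Rightarrow> (complex^'m::finite \<Rightarrow> complex) \<Rightarrow> ennreal" where
  "taylor_norm \<rho> F =
     (\<Sum>\<^sub>\<infinity>\<alpha>\<in>UNIV. ennreal (norm (taylor_coeff F \<alpha>) * \<rho> ^ mi_size \<alpha>))"

section \<open>The system\<close>

definition complexify_vec :: "real^'n::finite \<Rightarrow> complex^'n" where
  "complexify_vec v = (\<chi> i. complex_of_real (v $ i))"

definition complexify_mat :: "real^'n::finite^'n \<Rightarrow> complex^'n^'n" where
  "complexify_mat A = (\<chi> i j. complex_of_real (A $ i $ j))"

definition diagonalizes :: "complex^'n::finite^'n \<Rightarrow> real^'n^'n \<Rightarrow> complex^'n \<Rightarrow> bool" where
  "diagonalizes P A lam \<longleftrightarrow> invertible P \<and>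
     matrix_inv P ** complexify_mat A ** P = (\<chi> i j. if i = j then lam $ i else 0)"

definition at_least_quadratic :: "(real^'n::finite \<Rightarrow> real \<Rightarrow> real^'n) \<Rightarrow> bool" where
  "at_least_quadratic g \<longleftrightarrow> (\<forall>t\<ge>0. g 0 t = 0 \<and>
     (\<forall>l. ((\<lambda>s. g (s *\<^sub>R axis l 1) t) has_vector_derivative 0) (at 0)))"

text \<open>\<open>gt\<close> is the nonlinearity in the coordinates \<open>x\<close> with \<open>v = P x\<close>,
  extended from the real slice \<open>{x. P x \<in> \<real>\<^sup>n}\<close> to the complex polydisc. An
  extension that is analytic in the interior and continuous on the polydisc is unique, since
  that slice is a maximal totally real subspace.\<close>

definition nonlinearity_in_coords ::
    "complex^'n::finite^'n \<Rightarrow> (real^'n \<Rightarrow> real \<Rightarrow> real^'n) \<Rightarrow> real \<Rightarrow>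
     (complex^'n \<Rightarrow> real \<Rightarrow> complex^'n) \<Rightarrow> bool" where
  "nonlinearity_in_coords P g R gt \<longleftrightarrow>
     (\<forall>t\<ge>0. \<forall>v. matrix_inv P *v complexify_vec v \<in> polydisc R \<longrightarrow>
        gt (matrix_inv P *v complexify_vec v) t = matrix_inv P *v complexify_vec (g v t))"

definition y_dot :: "(complex^'n::finite \<Rightarrow> real \<Rightarrow> complex^'n) \<Rightarrow> complex^('n + 'n) \<Rightarrow> real \<Rightarrow> complex"
  where "y_dot gt z t = (\<Sum>l\<in>UNIV. z $ Inr l * gt (\<chi> k. z $ Inl k) t $ l)"

text \<open>Solutions take values in the polydisc of radius \<open>R\<close>, where the right-hand side
  is defined.\<close>

definition solves_on ::
    "complex^'n::finite \<Rightarrow> (complex^'n \<Rightarrow> real \<Rightarrow> complex^'n) \<Rightarrow> real \<Rightarrow> (real \<Rightarrow> complex^'n) \<Rightarrow>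
     real set \<Rightarrow> bool" where
  "solves_on lam gt R x J \<longleftrightarrow>
     (\<forall>t\<in>J. x t \<in> polydisc R \<and>
        (x has_vector_derivative (\<chi> l. lam $ l * x t $ l + gt (x t) t $ l)) (at t within J))"

definition linear_flow :: "complex^'n::finite \<Rightarrow> real \<Rightarrow> complex^'n \<Rightarrow> complex^'n" where
  "linear_flow lam t \<xi> = (\<chi> l. exp (lam $ l * complex_of_real t) * \<xi> $ l)"

section \<open>Integrability\<close>

text \<open>An analytic change of coordinates on \<open>D\<close> has an analytic inverse, and its image
  is a neighbourhood of the origin. The image need not be open, so the inverse is a function
  \<open>N\<close> that is analytic near each point of the image.\<close>

definition analytic_coord_change_on ::
    "(complex^'n::finite \<Rightarrow> complex^'n) \<Rightarrow> (complex^'n) set \<Rightarrow> bool" where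
  "analytic_coord_change_on F D \<longleftrightarrow>
     mv_analytic_map_on F D \<and> 0 \<in> interior D \<and> 0 \<in> interior (F ` D) \<and>
     (\<exists>N. mv_analytic_map_on N (F ` D) \<and> (\<forall>z\<in>D. N (F z) = z))"

text \<open>The two final clauses say that the curves \<open>M (e\<^sup>A\<^sup>t \<xi>) t\<close> are
  solutions as long as \<open>e\<^sup>A\<^sup>t \<xi>\<close> remains in the domain of \<open>M\<close>, and that
  every solution starting in the image of \<open>M\<close> at time \<open>0\<close> is such a curve.\<close>

definition integrable_near_origin ::
    "complex^'n::finite \<Rightarrow> (complex^'n \<Rightarrow> real \<Rightarrow> complex^'n) \<Rightarrow> real \<Rightarrow> bool" where
  "integrable_near_origin lam gt R \<longleftrightarrow>
     (\<exists>Rs R0. \<exists>M :: complex^'n \<Rightarrow> real \<Rightarrow> complex^'n.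
        0 < Rs \<and> Rs < R0 \<and> R0 \<le> R \<and>
        (\<forall>t\<ge>0. (\<lambda>z. M z t) ` polydisc Rs \<subseteq> polydisc R0 \<and>
                analytic_coord_change_on (\<lambda>z. M z t) (polydisc Rs)) \<and>
        (\<forall>\<xi>. solves_on lam gt R (\<lambda>t. M (linear_flow lam t \<xi>) t)
                {t. 0 \<le> t \<and> linear_flow lam t \<xi> \<in> polydisc Rs}) \<and>
        (\<forall>\<xi> x J. is_interval J \<and> 0 \<in> J \<and>
                J \<subseteq> {t. 0 \<le> t \<and> linear_flow lam t \<xi> \<in> polydisc Rs} \<and>
                solves_on lam gt R x J \<and> x 0 = M \<xi> 0 \<longrightarrow>
                (\<forall>t\<in>J. x t = M (linear_flow lam t \<xi>) t)))"

section \<open>Non-resonance\<close>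

text \<open>A vanishing divisor, whose inverse is to be read as \<open>\<infinity>\<close>, is excluded
  explicitly because \<open>inverse 0 = 0\<close>.\<close>

definition nonresonant :: "complex^'n::finite \<Rightarrow> real \<Rightarrow> real \<Rightarrow> bool" where
  "nonresonant lam \<gamma> \<tau> \<longleftrightarrow>
     (\<forall>\<alpha>. mi_size \<alpha> \<ge> 2 \<longrightarrow> (\<forall>l.
        let d = Re (\<Sum>k\<in>UNIV. (of_nat (\<alpha> k) - (if k = l then 1 else 0)) * lam $ k)
        in d \<noteq> 0 \<and> inverse \<bar>d\<bar> \<le> \<gamma> * real (mi_size \<alpha>) powr \<tau>))"

end

theory Submission
  imports Defs "HOL-Complex_Analysis.Conformal_Mappings"
begin

text \<open>The change of coordinates is sought as \<open>x\<^sub>l = z\<^sub>l + \<Sum>\<^sub>\<alpha> c\<^sub>\<alpha>\<^sub>,\<^sub>l(t) z\<^sup>\<alpha>\<close>. The coefficients solve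
  linear equations \<open>c' = q - d c\<close> with \<open>d = (\<alpha> - e\<^sub>l) \<cdot> \<Lambda>\<close>, where \<open>q\<close> is polynomial in the Taylor
  coefficients of the nonlinearity and in the \<open>c\<close> of lower degree. If \<open>q\<close> is bounded and \<open>Re d \<noteq> 0\<close>
  there is a solution bounded by \<open>sup \<bar>q\<bar> / \<bar>Re d\<bar>\<close>; if \<open>q\<close> decays like \<open>exp (- a t)\<close> there is one bounded
  by a multiple of \<open>1 / a\<close>, whatever \<open>d\<close> is. Expanding the recursion over trees bounds each term of
  degree \<open>n\<close> by \<open>C\<^sup>n\<close>, uniformly in time: the product of the inverse divisors over a tree is controlled by
  Brjuno's counting argument in the first case and trivially in the second. The series therefore
  converges on a polydisc that does not depend on \<open>t\<close>. The inverse of the change of coordinates is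
  given by a tree expansion of the same kind, with \<open>-1\<close> in place of the solution operator.\<close>

section \<open>Taylor coefficients and their dependence on parameters\<close>

text \<open>The obstacle is that inverse divisors are unbounded and a tree may contain many of them.
  What saves the first case is linearity: replacing the leaves below an inner node by the label of
  that node turns the difference of two divisors into a third divisor, so two very small divisors on
  one branch make the third small as well, and its word must then be long. In the second case no
  divisor is inverted. The coefficient at each inner node carries its own factor exp (- a t), so
  every forcing term decays although the subtrees below it are only bounded. A proper tree has fewer
  inner nodes than leaves, hence a fixed cost per node becomes a geometric rate in the degree. Only
  real parts of divisors matter because the estimates see only the modulus of exp (d s). The
  hypotheses speak of y . g, whose value at y = (R/2) e_l returns the component g_l up to the factor
  R/2. Since Taylor coefficients get integrated in time, their continuity in t must be deduced from
  that of the function; the discretised Cauchy integrals serve this purpose and also give uniqueness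
  of the coefficients.\<close>

lemma has_sum_diff:
  fixes f :: "'i \<Rightarrow> 'b::topological_ab_group_add"
  assumes "(f has_sum a) A" "(g has_sum b) A"
  shows "((\<lambda>x. f x - g x) has_sum a - b) A"
  using has_sum_add[OF assms(1), of "\<lambda>x. - g x" "- b"] assms(2) by (simp add: has_sum_uminus)

lemma has_sum_sum:
  fixes f :: "'i \<Rightarrow> 'a \<Rightarrow> 'b::topological_comm_monoid_add"
  assumes "\<And>j. j \<in> J \<Longrightarrow> (f j has_sum S j) A"
  shows "((\<lambda>x. \<Sum>j\<in>J. f j x) has_sum (\<Sum>j\<in>J. S j)) A"
proof (cases "finite J")
  case True
  then show ?thesis using assms by (induction J) (auto intro!: has_sum_add has_sum_0)
qed (simp add: has_sum_0)

lemma norm_mi_power_le: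
  assumes "z \<in> polydisc \<rho>"
  shows "norm (mi_power z \<alpha>) \<le> \<rho> ^ mi_size \<alpha>"
  using assms unfolding mi_power_def mi_size_def polydisc_def
  by (auto simp: prod_norm[symmetric] norm_power power_sum intro!: prod_mono power_mono)

lemma mi_power_scale: "mi_power (\<chi> l. c * x $ l) \<alpha> = c ^ mi_size \<alpha> * mi_power x \<alpha>"
  by (simp add: mi_power_def mi_size_def power_mult_distrib prod.distrib power_sum)

lemma polydisc_nonneg:
  assumes "z \<in> polydisc \<rho>" shows "0 \<le> \<rho>"
  using assms order_trans[OF norm_ge_zero] unfolding polydisc_def by blast

text \<open>\<open>S\<close> is a geometric sum with ratio w = cis (2 pi (b - a) / N). Since w^N = 1
  it vanishes unless w = 1, which would make N divide b - a.\<close>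

lemma root_of_unity_orthogonality:
  fixes N a b :: nat
  assumes "N > 0"
  defines "S \<equiv> (\<Sum>j<N. cis (2 * pi * real j * real b / N) * cis (- (2 * pi * real j * real a / N)))"
  shows "norm S \<le> N" and "a = b \<Longrightarrow> S = of_nat N" and "a \<noteq> b \<Longrightarrow> a < N \<Longrightarrow> b < N \<Longrightarrow> S = 0"
proof -
  show "norm S \<le> N"
    unfolding S_def by (rule order_trans[OF norm_sum]) (simp add: norm_mult)
  show "S = of_nat N" if "a = b"
    using that unfolding S_def by (simp add: cis_mult)
  show "S = 0" if ab: "a \<noteq> b" "a < N" "b < N"
  proof -
    define w where "w = cis (2 * pi * (real b - real a) / N)"
    have "w \<noteq> 1"
    proof
      assume "w = 1"
      then have "cos (2 * pi * (real b - real a) / N) = 1"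
        by (simp add: w_def complex_eq_iff)
      then obtain k :: int where "2 * pi * (real b - real a) / N = real_of_int k * 2 * pi"
        using cos_one_2pi_int by blast
      then have "2 * pi * (real b - real a) = 2 * pi * (real_of_int k * real N)"
        using assms by (simp add: field_simps)
      then have "real b - real a = real_of_int k * real N"
        by (simp only: mult_cancel_left) simp
      then have eq: "int b - int a = k * int N"
        by (metis of_int_diff of_int_eq_iff of_int_mult of_int_of_nat_eq)
      then have "int N dvd int b - int a" by simp
      moreover have "\<bar>int b - int a\<bar> < int N" "int b - int a \<noteq> 0"
        using ab by auto
      ultimately show False
        using dvd_imp_le_int[of "int b - int a" "int N"] by simp
    qed
    moreover have "w ^ N = 1"
    proof -
      have "w ^ N = cis (2 * pi * of_int (int b - int a))"
        using assms by (simp add: w_def Complex.DeMoivre)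
      then show ?thesis
        by (simp only: cis_multiple_2pi[OF Ints_of_int])
    qed
    moreover have "S = (\<Sum>j<N. w ^ j)"
      unfolding S_def w_def Complex.DeMoivre cis_mult
      by (intro sum.cong refl arg_cong[of _ _ cis]) (simp add: field_simps)
    ultimately show ?thesis
      by (simp add: sum_gp_strict)
  qed
qed

text \<open>A discretised Cauchy integral over the torus of radius \<open>\<rho>\<close>.\<close>

definition root_avg :: "nat \<Rightarrow> real \<Rightarrow> (complex^'n::finite \<Rightarrow> complex) \<Rightarrow> ('n \<Rightarrow> nat) \<Rightarrow> complex" where
  "root_avg N \<rho> F \<alpha> =
     (\<Sum>j\<in>PiE UNIV (\<lambda>_. {..<N}). F (\<chi> l. of_real \<rho> * cis (2 * pi * real (j l) / N)) *
        (\<Prod>l\<in>UNIV. cis (- (2 * pi * real (j l) * real (\<alpha> l) / N)))) / of_nat N ^ CARD('n)"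

text \<open>By orthogonality the average annihilates every monomial of degree below N except alpha
  itself. What remains has degree at least N, and passing from radius 2 rho to rho gains 2^-N there.
  The error thus depends on the function only through \<open>M\<close>.\<close>

lemma root_avg_approximates_coeff:
  fixes F :: "complex^'n::finite \<Rightarrow> complex"
  assumes \<rho>: "0 < \<rho>"
    and F: "\<And>z. z \<in> polydisc \<rho> \<Longrightarrow> ((\<lambda>\<alpha>. c \<alpha> * mi_power z \<alpha>) has_sum F z) UNIV"
    and M: "((\<lambda>\<alpha>. norm (c \<alpha>) * (2 * \<rho>) ^ mi_size \<alpha>) has_sum M) UNIV"
    and N: "mi_size \<alpha> < N"
  shows "norm (root_avg N \<rho> F \<alpha> - c \<alpha> * of_real \<rho> ^ mi_size \<alpha>) \<le> M / 2 ^ N"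
proof -
  have N0: "N > 0" using N by simp
  define J where "J = PiE (UNIV :: 'n set) (\<lambda>_. {..<N})"
  define pt where "pt j = (\<chi> l. of_real \<rho> * cis (2 * pi * real (j l) / N))" for j :: "'n \<Rightarrow> nat"
  define e where "e j = (\<Prod>l\<in>UNIV. cis (- (2 * pi * real (j l) * real (\<alpha> l) / N)))" for j :: "'n \<Rightarrow> nat"
  define \<kappa> where "\<kappa> a b = (\<Sum>j<N. cis (2 * pi * real j * real b / N) * cis (- (2 * pi * real j * real a / N)))" for a b :: nat
  \<comment> \<open>The weight with which the monomial beta enters the average: 1 at alpha, 0 at any
    other index of degree below N, and never larger than 1 in modulus.\<close>
  define k where "k \<beta> = (\<Prod>l\<in>UNIV. \<kappa> (\<alpha> l) (\<beta> l)) / of_nat N ^ CARD('n)" for \<beta> :: "'n \<Rightarrow> nat"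
  have pt: "pt j \<in> polydisc \<rho>" for j
    using \<rho> by (simp add: pt_def polydisc_def norm_mult)
  have avg: "root_avg N \<rho> F \<alpha> = (\<Sum>j\<in>J. F (pt j) * e j) / of_nat N ^ CARD('n)"
    by (simp add: root_avg_def J_def pt_def e_def)
  have mp: "mi_power (pt j) \<beta> = of_real \<rho> ^ mi_size \<beta> * (\<Prod>l\<in>UNIV. cis (2 * pi * real (j l) * real (\<beta> l) / N))" for j \<beta>
    unfolding pt_def mi_power_def mi_size_def
    by (simp add: power_mult_distrib prod.distrib power_sum Complex.DeMoivre mult.commute mult.left_commute)
  have ksum: "(\<Sum>j\<in>J. mi_power (pt j) \<beta> * e j) / of_nat N ^ CARD('n) = of_real \<rho> ^ mi_size \<beta> * k \<beta>" for \<beta>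
  proof -
    have "(\<Sum>j\<in>J. mi_power (pt j) \<beta> * e j) = of_real \<rho> ^ mi_size \<beta> *
        (\<Sum>j\<in>J. \<Prod>l\<in>UNIV. cis (2 * pi * real (j l) * real (\<beta> l) / N) * cis (- (2 * pi * real (j l) * real (\<alpha> l) / N)))"
      unfolding sum_distrib_left mp e_def prod.distrib by (simp only: mult.assoc)
    also have "(\<Sum>j\<in>J. \<Prod>l\<in>UNIV. cis (2 * pi * real (j l) * real (\<beta> l) / N) * cis (- (2 * pi * real (j l) * real (\<alpha> l) / N)))
       = (\<Prod>l\<in>UNIV. \<kappa> (\<alpha> l) (\<beta> l))"
      unfolding J_def \<kappa>_def by (subst prod_sum_PiE) auto
    finally show ?thesis by (simp add: k_def)
  qed
  have "((\<lambda>\<beta>. (\<Sum>j\<in>J. (c \<beta> * mi_power (pt j) \<beta>) * e j) / of_nat N ^ CARD('n)) has_sum root_avg N \<rho> F \<alpha>) UNIV"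
    unfolding avg by (intro has_sum_divide_const has_sum_sum has_sum_cmult_left F pt)
  also have "(\<lambda>\<beta>. (\<Sum>j\<in>J. (c \<beta> * mi_power (pt j) \<beta>) * e j) / of_nat N ^ CARD('n)) = (\<lambda>\<beta>. c \<beta> * of_real \<rho> ^ mi_size \<beta> * k \<beta>)"
  proof
    fix \<beta>
    have "(\<Sum>j\<in>J. (c \<beta> * mi_power (pt j) \<beta>) * e j) / of_nat N ^ CARD('n)
      = c \<beta> * ((\<Sum>j\<in>J. mi_power (pt j) \<beta> * e j) / of_nat N ^ CARD('n))"
      by (simp add: sum_distrib_left mult.assoc)
    then show "(\<Sum>j\<in>J. (c \<beta> * mi_power (pt j) \<beta>) * e j) / of_nat N ^ CARD('n) = c \<beta> * of_real \<rho> ^ mi_size \<beta> * k \<beta>"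
      by (simp only: ksum mult.assoc)
  qed
  finally have s1: "((\<lambda>\<beta>. c \<beta> * of_real \<rho> ^ mi_size \<beta> * k \<beta>) has_sum root_avg N \<rho> F \<alpha>) UNIV" .
  have s2: "((\<lambda>\<beta>. if \<beta> = \<alpha> then c \<alpha> * of_real \<rho> ^ mi_size \<alpha> else 0) has_sum (c \<alpha> * of_real \<rho> ^ mi_size \<alpha>)) UNIV"
    by (rule has_sum_finite_neutralI[of "{\<alpha>}"]) auto
  have s3: "((\<lambda>\<beta>. c \<beta> * of_real \<rho> ^ mi_size \<beta> * k \<beta> - (if \<beta> = \<alpha> then c \<alpha> * of_real \<rho> ^ mi_size \<alpha> else 0))
      has_sum (root_avg N \<rho> F \<alpha> - c \<alpha> * of_real \<rho> ^ mi_size \<alpha>)) UNIV"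
    by (rule has_sum_diff[OF s1 s2])
  have s4: "((\<lambda>\<beta>. norm (c \<beta>) * (2 * \<rho>) ^ mi_size \<beta> / 2 ^ N) has_sum (M / 2 ^ N)) UNIV"
    by (intro has_sum_divide_const M)
  have knorm: "norm (k \<beta>) \<le> 1" for \<beta>
  proof -
    have "norm (\<Prod>l\<in>UNIV. \<kappa> (\<alpha> l) (\<beta> l)) \<le> (\<Prod>l\<in>(UNIV::'n set). real N)"
      unfolding prod_norm[symmetric] \<kappa>_def by (intro prod_mono conjI root_of_unity_orthogonality N0) auto
    then show ?thesis using N0 by (simp add: k_def norm_divide norm_power)
  qed
  have k1: "k \<alpha> = 1"
    using root_of_unity_orthogonality(2)[OF N0 refl] N0 by (simp add: k_def \<kappa>_def)
  have k0: "k \<beta> = 0" if "\<beta> \<noteq> \<alpha>" "mi_size \<beta> < N" for \<beta>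
  proof -
    obtain l where l: "\<beta> l \<noteq> \<alpha> l" using \<open>\<beta> \<noteq> \<alpha>\<close> by (meson ext)
    have "\<beta> l \<le> mi_size \<beta>" "\<alpha> l \<le> mi_size \<alpha>"
      unfolding mi_size_def by (auto intro: member_le_sum)
    then have "\<kappa> (\<alpha> l) (\<beta> l) = 0"
      unfolding \<kappa>_def using l that N by (intro root_of_unity_orthogonality(3)) auto
    then have "(\<Prod>l\<in>UNIV. \<kappa> (\<alpha> l) (\<beta> l)) = 0" by (metis UNIV_I finite prod_zero)
    then show ?thesis by (simp add: k_def)
  qed
  have "norm (c \<beta> * of_real \<rho> ^ mi_size \<beta> * k \<beta> - (if \<beta> = \<alpha> then c \<alpha> * of_real \<rho> ^ mi_size \<alpha> else 0))
      \<le> norm (c \<beta>) * (2 * \<rho>) ^ mi_size \<beta> / 2 ^ N" for \<beta>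
  proof (cases "\<beta> = \<alpha> \<or> mi_size \<beta> < N")
    case True
    then show ?thesis using k1 k0[of \<beta>] \<rho> by auto
  next
    case False
    then have "norm (c \<beta> * of_real \<rho> ^ mi_size \<beta> * k \<beta>) \<le> norm (c \<beta>) * \<rho> ^ mi_size \<beta> * 1"
      using \<rho> unfolding norm_mult by (intro mult_mono knorm) (auto simp: norm_power)
    also have "\<dots> \<le> norm (c \<beta>) * \<rho> ^ mi_size \<beta> * (2 ^ mi_size \<beta> / 2 ^ N)"
      using \<rho> False by (intro mult_left_mono) (auto simp: power_increasing)
    finally show ?thesis using False by (simp add: power_mult_distrib mult_ac)
  qed
  then show ?thesis
    by (intro norm_infsum_le[OF s3 s4]) auto
qed

text \<open>At the point whose coordinates all equal the radius, the monomials are powers of that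
  radius. Summability of complex families is absolute, which bounds the coefficients.\<close>

lemma has_power_series_at_0_summable:
  fixes F :: "complex^'n::finite \<Rightarrow> complex"
  assumes "has_power_series F c 0"
  obtains r where "r > 0" "\<And>z. z \<in> polydisc r \<Longrightarrow> ((\<lambda>\<alpha>. c \<alpha> * mi_power z \<alpha>) has_sum F z) UNIV"
    "(\<lambda>\<alpha>. norm (c \<alpha>) * r ^ mi_size \<alpha>) summable_on UNIV"
proof -
  obtain r where r: "r > 0" and F: "\<And>z. (\<forall>l. norm (z $ l) < r) \<Longrightarrow> ((\<lambda>\<alpha>. c \<alpha> * mi_power z \<alpha>) has_sum F z) UNIV"
    using assms unfolding has_power_series_def by auto
  have 1: "((\<lambda>\<alpha>. c \<alpha> * mi_power z \<alpha>) has_sum F z) UNIV" if "z \<in> polydisc (r/2)" for z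
  proof (rule F, rule allI)
    fix l
    have "norm (z $ l) \<le> r/2" using that by (simp add: polydisc_def)
    then show "norm (z $ l) < r" using r by linarith
  qed
  let ?z = "(\<chi> l. of_real (r/2)) :: complex^'n"
  have mp: "mi_power ?z \<alpha> = of_real (r/2) ^ mi_size \<alpha>" for \<alpha>
    using mi_power_scale[of "of_real (r/2)" "\<chi> l. 1" \<alpha>] by (simp add: mi_power_def)
  have "(\<lambda>\<alpha>. c \<alpha> * mi_power ?z \<alpha>) summable_on UNIV"
    using 1[of ?z] r has_sum_imp_summable by (auto simp: polydisc_def)
  then have "(\<lambda>\<alpha>. norm (c \<alpha>) * (r/2) ^ mi_size \<alpha>) summable_on UNIV"
    unfolding summable_on_iff_abs_summable_on_complex mp using r by (simp add: norm_mult norm_power)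
  then show thesis using that[of "r/2"] 1 r by auto
qed

text \<open>The root averages depend on \<open>F\<close> alone and converge to the scaled
  coefficients of either series.\<close>

lemma power_series_coeffs_unique:
  fixes F :: "complex^'n::finite \<Rightarrow> complex"
  assumes "has_power_series F c 0" "has_power_series F c' 0"
  shows "c = c'"
proof
  fix \<alpha>
  obtain r where r: "r > 0" "\<And>z. z \<in> polydisc r \<Longrightarrow> ((\<lambda>\<alpha>. c \<alpha> * mi_power z \<alpha>) has_sum F z) UNIV"
    "(\<lambda>\<alpha>. norm (c \<alpha>) * r ^ mi_size \<alpha>) summable_on UNIV"
    using has_power_series_at_0_summable[OF assms(1)] by blast
  obtain r' where r': "r' > 0" "\<And>z. z \<in> polydisc r' \<Longrightarrow> ((\<lambda>\<alpha>. c' \<alpha> * mi_power z \<alpha>) has_sum F z) UNIV"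
    "(\<lambda>\<alpha>. norm (c' \<alpha>) * r' ^ mi_size \<alpha>) summable_on UNIV"
    using has_power_series_at_0_summable[OF assms(2)] by blast
  \<comment> \<open>Halved because the averages at radius rho need absolute convergence at radius 2
    rho.\<close>
  define \<rho> where "\<rho> = min r r' / 2"
  have \<rho>: "0 < \<rho>" "2 * \<rho> \<le> r" "2 * \<rho> \<le> r'" using r(1) r'(1) by (auto simp: \<rho>_def)
  have sub: "z \<in> polydisc r" "z \<in> polydisc r'" if "z \<in> polydisc \<rho>" for z :: "complex^'n"
    using that \<rho> by (auto simp: polydisc_def intro: order_trans)
  have "(\<lambda>\<alpha>. norm (c \<alpha>) * (2 * \<rho>) ^ mi_size \<alpha>) summable_on UNIV"
    by (rule summable_on_comparison_test[OF r(3)]) (use \<rho> in \<open>(intro mult_left_mono power_mono mult_nonneg_nonneg; simp)+\<close>)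
  then obtain M where M: "((\<lambda>\<alpha>. norm (c \<alpha>) * (2 * \<rho>) ^ mi_size \<alpha>) has_sum M) UNIV"
    by (auto simp: summable_on_def)
  have "(\<lambda>\<alpha>. norm (c' \<alpha>) * (2 * \<rho>) ^ mi_size \<alpha>) summable_on UNIV"
    by (rule summable_on_comparison_test[OF r'(3)]) (use \<rho> in \<open>(intro mult_left_mono power_mono mult_nonneg_nonneg; simp)+\<close>)
  then obtain M' where M': "((\<lambda>\<alpha>. norm (c' \<alpha>) * (2 * \<rho>) ^ mi_size \<alpha>) has_sum M') UNIV"
    by (auto simp: summable_on_def)
  have lim: "(\<lambda>N. root_avg N \<rho> F \<alpha>) \<longlonglongrightarrow> d \<alpha> * of_real \<rho> ^ mi_size \<alpha>"
    if F: "\<And>z. z \<in> polydisc \<rho> \<Longrightarrow> ((\<lambda>\<alpha>. d \<alpha> * mi_power z \<alpha>) has_sum F z) UNIV"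
      and M: "((\<lambda>\<alpha>. norm (d \<alpha>) * (2 * \<rho>) ^ mi_size \<alpha>) has_sum M) UNIV" for d M
  proof (rule LIM_zero_cancel, rule Lim_null_comparison)
    show "\<forall>\<^sub>F N in sequentially. norm (root_avg N \<rho> F \<alpha> - d \<alpha> * of_real \<rho> ^ mi_size \<alpha>) \<le> M / 2 ^ N"
      using eventually_gt_at_top[of "mi_size \<alpha>"]
      by eventually_elim (rule root_avg_approximates_coeff[OF \<rho>(1) F M])
    show "(\<lambda>N. M / 2 ^ N) \<longlonglongrightarrow> 0"
      using LIMSEQ_divide_realpow_zero[of 2 M] by simp
  qed
  have "c \<alpha> * of_real \<rho> ^ mi_size \<alpha> = c' \<alpha> * of_real \<rho> ^ mi_size \<alpha>"
    by (rule LIMSEQ_unique[OF lim[OF r(2) M] lim[OF r'(2) M']]) (use sub in auto)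
  then show "c \<alpha> = c' \<alpha>" using \<rho>(1) by simp
qed

text \<open>Each root average is a finite combination of values of \<open>F\<close>, hence
  continuous in t. The common bound \<open>M\<close> makes their convergence to the coefficient
  uniform in t.\<close>

lemma continuous_coeffs:
  fixes F :: "complex^'n::finite \<Rightarrow> real \<Rightarrow> complex"
  assumes \<rho>: "0 < \<rho>"
    and F: "\<And>z t. z \<in> polydisc \<rho> \<Longrightarrow> t \<in> T \<Longrightarrow> ((\<lambda>\<alpha>. c \<alpha> t * mi_power z \<alpha>) has_sum F z t) UNIV"
    and summ: "\<And>t. t \<in> T \<Longrightarrow> (\<lambda>\<alpha>. norm (c \<alpha> t) * (2 * \<rho>) ^ mi_size \<alpha>) summable_on UNIV"
    and le: "\<And>t. t \<in> T \<Longrightarrow> infsum (\<lambda>\<alpha>. norm (c \<alpha> t) * (2 * \<rho>) ^ mi_size \<alpha>) UNIV \<le> M"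
    and cont: "\<And>z. z \<in> polydisc \<rho> \<Longrightarrow> continuous_on T (F z)"
  shows "continuous_on T (c \<alpha>)"
proof -
  have "uniform_limit T (\<lambda>N t. root_avg N \<rho> (\<lambda>z. F z t) \<alpha>) (\<lambda>t. c \<alpha> t * of_real \<rho> ^ mi_size \<alpha>) sequentially"
  proof (rule uniform_limitI)
    fix e :: real assume e: "e > 0"
    have "(\<lambda>N. \<bar>M\<bar> / 2 ^ N) \<longlonglongrightarrow> 0"
      using LIMSEQ_divide_realpow_zero[of 2 "\<bar>M\<bar>"] by simp
    then have "\<forall>\<^sub>F N in sequentially. \<bar>M\<bar> / 2 ^ N < e"
      using e order_tendstoD(2) by blast
    then show "\<forall>\<^sub>F N in sequentially. \<forall>t\<in>T. dist (root_avg N \<rho> (\<lambda>z. F z t) \<alpha>) (c \<alpha> t * of_real \<rho> ^ mi_size \<alpha>) < e"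
      using eventually_gt_at_top[of "mi_size \<alpha>"]
    proof eventually_elim
      case (elim N)
      show ?case
      proof
        fix t assume t: "t \<in> T"
        have "norm (root_avg N \<rho> (\<lambda>z. F z t) \<alpha> - c \<alpha> t * of_real \<rho> ^ mi_size \<alpha>)
           \<le> infsum (\<lambda>\<alpha>. norm (c \<alpha> t) * (2 * \<rho>) ^ mi_size \<alpha>) UNIV / 2 ^ N"
          using F[OF _ t] summ[OF t] elim(2) \<rho>
          by (intro root_avg_approximates_coeff[where c = "\<lambda>\<alpha>. c \<alpha> t"]) auto
        also have "\<dots> \<le> \<bar>M\<bar> / 2 ^ N"
          using le[OF t] by (intro divide_right_mono) auto
        finally show "dist (root_avg N \<rho> (\<lambda>z. F z t) \<alpha>) (c \<alpha> t * of_real \<rho> ^ mi_size \<alpha>) < e"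
          using elim(1) by (simp add: dist_norm)
      qed
    qed
  qed
  moreover have "continuous_on T (\<lambda>t. root_avg N \<rho> (\<lambda>z. F z t) \<alpha>)" for N
    unfolding root_avg_def divide_inverse
    by (intro continuous_on_mult_right continuous_on_sum cont) (use \<rho> in \<open>simp add: polydisc_def norm_mult\<close>)
  ultimately have "continuous_on T (\<lambda>t. c \<alpha> t * of_real \<rho> ^ mi_size \<alpha>)"
    by (intro uniform_limit_theorem) (auto intro: always_eventually)
  then have "continuous_on T (\<lambda>t. c \<alpha> t * of_real \<rho> ^ mi_size \<alpha> * inverse (of_real \<rho> ^ mi_size \<alpha>))"
    by (rule continuous_on_mult_right)
  then show ?thesis using \<rho> by (simp add: mult.assoc)
qed

section \<open>Convergence on polydiscs and recentring\<close>

lemma holomorphic_infsum_powers: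
  fixes a :: "'i \<Rightarrow> complex"
  assumes "(\<lambda>i. norm (a i) * r ^ m i) summable_on I"
  shows "(\<lambda>s. \<Sum>\<^sub>\<infinity>i\<in>I. a i * s ^ m i) holomorphic_on ball 0 r"
proof -
  have "uniform_limit (cball 0 r) (\<lambda>X s. \<Sum>i\<in>X. a i * s ^ m i) (\<lambda>s. \<Sum>\<^sub>\<infinity>i\<in>I. a i * s ^ m i) (finite_subsets_at_top I)"
    by (rule Weierstrass_m_test_general[OF _ assms])
       (auto simp: norm_mult norm_power intro!: mult_left_mono power_mono)
  then show ?thesis
    by (rule holomorphic_uniform_limit[rotated])
       (auto intro!: always_eventually holomorphic_intros continuous_intros)
qed

text \<open>On a complex line the expansion becomes a power series in s - s0 alone. This opens the
  way to one-variable analytic continuation.\<close>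

lemma analytic_on_line:
  fixes F :: "complex^'m::finite \<Rightarrow> complex"
  assumes "has_power_series F c (\<chi> l. s0 * z $ l)"
  shows "\<exists>e>0. (\<lambda>s. F (\<chi> l. s * z $ l)) holomorphic_on ball s0 e"
proof -
  obtain r where r: "r > 0" and F: "\<And>w. (\<forall>l. norm (w $ l - s0 * z $ l) < r) \<Longrightarrow>
      ((\<lambda>\<alpha>. c \<alpha> * mi_power (w - (\<chi> l. s0 * z $ l)) \<alpha>) has_sum F w) UNIV"
    using assms unfolding has_power_series_def by auto
  define B where "B = 1 + (\<Sum>l\<in>UNIV. norm (z $ l))"
  have B: "norm (z $ l) < B" for l
    unfolding B_def using member_le_sum[of l UNIV "\<lambda>l. norm (z $ l)"] by auto
  then have B0: "B > 0" using le_less_trans[OF norm_ge_zero] by blast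
  define e where "e = r / B"
  have e: "e > 0" using r B0 by (simp add: e_def)
  have *: "((\<lambda>\<alpha>. (c \<alpha> * mi_power z \<alpha>) * (s - s0) ^ mi_size \<alpha>) has_sum F (\<chi> l. s * z $ l)) UNIV"
    if s: "norm (s - s0) \<le> e" for s
  proof -
    have "norm (s * z $ l - s0 * z $ l) < r" for l
    proof -
      have "norm (s * z $ l - s0 * z $ l) = norm (s - s0) * norm (z $ l)"
        by (simp add: norm_mult[symmetric] algebra_simps)
      also have "\<dots> \<le> e * norm (z $ l)" using s by (intro mult_right_mono) auto
      also have "\<dots> < e * B" using e B by (intro mult_strict_left_mono) auto
      finally show ?thesis using B0 by (simp add: e_def)
    qed
    then have "((\<lambda>\<alpha>. c \<alpha> * mi_power ((\<chi> l. s * z $ l) - (\<chi> l. s0 * z $ l)) \<alpha>) has_sum F (\<chi> l. s * z $ l)) UNIV"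
      by (intro F) auto
    moreover have "(\<chi> l. s * z $ l) - (\<chi> l. s0 * z $ l) = (\<chi> l. (s - s0) * z $ l)"
      by (simp add: vec_eq_iff algebra_simps)
    ultimately show ?thesis by (simp only: mi_power_scale) (simp add: mult_ac)
  qed
  have "(\<lambda>\<alpha>. (c \<alpha> * mi_power z \<alpha>) * of_real e ^ mi_size \<alpha>) summable_on UNIV"
    using *[of "s0 + of_real e"] e by (auto intro: has_sum_imp_summable)
  then have "(\<lambda>\<alpha>. norm (c \<alpha> * mi_power z \<alpha>) * e ^ mi_size \<alpha>) summable_on UNIV"
    unfolding summable_on_iff_abs_summable_on_complex using e by (simp add: norm_mult norm_power)
  then have "(\<lambda>s. \<Sum>\<^sub>\<infinity>\<alpha>. (c \<alpha> * mi_power z \<alpha>) * s ^ mi_size \<alpha>) holomorphic_on ball 0 e"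
    by (rule holomorphic_infsum_powers)
  then have "((\<lambda>s. \<Sum>\<^sub>\<infinity>\<alpha>. (c \<alpha> * mi_power z \<alpha>) * s ^ mi_size \<alpha>) \<circ> (\<lambda>s. s - s0)) holomorphic_on ball s0 e"
    by (rule holomorphic_on_compose_gen[rotated])
       (auto intro!: holomorphic_intros simp: dist_norm norm_minus_commute)
  also have "?this \<longleftrightarrow> (\<lambda>s. F (\<chi> l. s * z $ l)) holomorphic_on ball s0 e"
    by (intro holomorphic_cong refl) (auto simp: dist_norm norm_minus_commute intro!: infsumI *)
  finally show ?thesis using e by blast
qed

lemma open_polydisc: "open {z :: complex^'m::finite. \<forall>l. norm (z $ l) < R}"
proof -
  have "{z :: complex^'m. \<forall>l. norm (z $ l) < R} = (\<Inter>l. {z. norm (z $ l) < R})" by auto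
  moreover have "open {z :: complex^'m. norm (z $ l) < R}" for l
    by (intro open_Collect_less continuous_intros)
  ultimately show ?thesis by (simp only:) (intro open_INT ballI; simp)
qed

lemma open_polydisc_subset_interior: "{z :: complex^'m::finite. \<forall>l. norm (z $ l) < R} \<subseteq> interior (polydisc R)"
  by (rule interior_maximal[OF _ open_polydisc]) (auto simp: polydisc_def less_imp_le)

text \<open>Analyticity gives the expansion only near 0. On the complex line through z both sides
  are holomorphic on a disc containing s = 1 and agree near s = 0, so they agree at s = 1.\<close>

lemma power_series_represents:
  fixes F :: "complex^'m::finite \<Rightarrow> complex"
  assumes an: "mv_analytic_on F (interior (polydisc R))" and ps: "has_power_series F c 0"
    and summ: "(\<lambda>\<alpha>. norm (c \<alpha>) * R ^ mi_size \<alpha>) summable_on UNIV"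
    and z: "\<And>l. norm (z $ l) < R"
  shows "((\<lambda>\<alpha>. c \<alpha> * mi_power z \<alpha>) has_sum F z) UNIV"
proof -
  define b where "b = Max (range (\<lambda>l. norm (z $ l)))"
  have b: "norm (z $ l) \<le> b" for l unfolding b_def by (intro Max_ge) auto
  have b0: "0 \<le> b" using order_trans[OF norm_ge_zero b] .
  have bR: "b < R" unfolding b_def using z by (subst Max_less_iff) auto
  \<comment> \<open>The disc of radius q contains s = 1 in its interior, and s z stays inside the
    open polydisc for s in that disc.\<close>
  obtain q where q: "1 < q" "q * b < R"
  proof (cases "b = 0")
    case True then show thesis using that[of 2] bR by simp
  next
    case False
    then obtain y where "b < y" "y < R" using bR dense by blast
    then show thesis using that[of "y / b"] False b0 by (simp add: field_simps)
  qed
  have qz: "(\<chi> l. s * z $ l) \<in> polydisc (q * b)" "(\<chi> l. s * z $ l) \<in> interior (polydisc R)" if "norm s < q" for s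
  proof -
    have *: "norm (s * z $ l) \<le> q * b" for l
      unfolding norm_mult using that b q(1) by (intro mult_mono) auto
    then show "(\<chi> l. s * z $ l) \<in> polydisc (q * b)" by (simp add: polydisc_def)
    have "norm (s * z $ l) < R" for l using * q(2) by (rule le_less_trans)
    then have "(\<chi> l. s * z $ l) \<in> {w. \<forall>l. norm (w $ l) < R}" by simp
    then show "(\<chi> l. s * z $ l) \<in> interior (polydisc R)" using open_polydisc_subset_interior by (rule rev_subsetD)
  qed
  have hF: "(\<lambda>s. F (\<chi> l. s * z $ l)) holomorphic_on ball 0 q"
  proof -
    have "(\<lambda>s. F (\<chi> l. s * z $ l)) field_differentiable at s" if s: "s \<in> ball 0 q" for s
    proof -
      obtain c' where "has_power_series F c' (\<chi> l. s * z $ l)"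
        using an qz(2)[of s] s unfolding mv_analytic_on_def by auto
      then obtain e where "e > 0" "(\<lambda>s. F (\<chi> l. s * z $ l)) holomorphic_on ball s e"
        using analytic_on_line by blast
      then show ?thesis
        using holomorphic_on_imp_differentiable_at[of _ "ball s e" s] by simp
    qed
    then show ?thesis
      by (auto simp: holomorphic_on_def intro: field_differentiable_at_within)
  qed
  have summ': "(\<lambda>\<alpha>. norm (c \<alpha> * mi_power z \<alpha>) * q ^ mi_size \<alpha>) summable_on UNIV"
  proof (rule summable_on_comparison_test[OF summ])
    fix \<alpha>
    have "norm (mi_power z \<alpha>) * q ^ mi_size \<alpha> \<le> b ^ mi_size \<alpha> * q ^ mi_size \<alpha>"
      using b q by (intro mult_right_mono norm_mi_power_le) (auto simp: polydisc_def)
    also have "\<dots> = (q * b) ^ mi_size \<alpha>" by (simp add: power_mult_distrib mult.commute)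
    also have "\<dots> \<le> R ^ mi_size \<alpha>" using b0 q by (intro power_mono mult_nonneg_nonneg) auto
    finally show "norm (c \<alpha> * mi_power z \<alpha>) * q ^ mi_size \<alpha> \<le> norm (c \<alpha>) * R ^ mi_size \<alpha>"
      by (simp add: norm_mult mult.assoc mult_left_mono)
  qed (use q in auto)
  obtain r0 where r0: "r0 > 0" "\<And>w. w \<in> polydisc r0 \<Longrightarrow> ((\<lambda>\<alpha>. c \<alpha> * mi_power w \<alpha>) has_sum F w) UNIV"
    using has_power_series_at_0_summable[OF ps] by blast
  \<comment> \<open>Near s = 0 the point s z lies where the expansion is known; b + 1 avoids a
    division by zero when z = 0.\<close>
  define d where "d = min q (r0 / (b + 1))"
  have d: "d > 0" "d \<le> q" using q r0 b0 by (auto simp: d_def)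
  have eq: "F (\<chi> l. s * z $ l) = (\<Sum>\<^sub>\<infinity>\<alpha>. c \<alpha> * mi_power z \<alpha> * s ^ mi_size \<alpha>)" if "s \<in> ball 0 d" for s
  proof -
    have "norm (s * z $ l) \<le> r0" for l
    proof -
      have "norm s \<le> r0 / (b + 1)" using that by (simp add: d_def)
      then have "norm (s * z $ l) \<le> r0 / (b + 1) * (b + 1)"
        unfolding norm_mult using b[of l] b0 r0(1) by (intro mult_mono) auto
      then show ?thesis using b0 by simp
    qed
    then have "((\<lambda>\<alpha>. c \<alpha> * mi_power (\<chi> l. s * z $ l) \<alpha>) has_sum F (\<chi> l. s * z $ l)) UNIV"
      by (intro r0) (simp add: polydisc_def)
    then show ?thesis unfolding mi_power_scale by (simp add: has_sum_iff mult_ac)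
  qed
  have "F (\<chi> l. 1 * z $ l) = (\<Sum>\<^sub>\<infinity>\<alpha>. c \<alpha> * mi_power z \<alpha> * 1 ^ mi_size \<alpha>)"
  proof (rule analytic_continuation_open[of "ball 0 d" "ball 0 q" "\<lambda>s. F (\<chi> l. s * z $ l)"
        "\<lambda>s. \<Sum>\<^sub>\<infinity>\<alpha>. c \<alpha> * mi_power z \<alpha> * s ^ mi_size \<alpha>" 1])
    show "(\<lambda>s. \<Sum>\<^sub>\<infinity>\<alpha>. c \<alpha> * mi_power z \<alpha> * s ^ mi_size \<alpha>) holomorphic_on ball 0 q"
      by (rule holomorphic_infsum_powers[OF summ'])
    show "ball (0::complex) d \<subseteq> ball 0 q" using d by (intro subset_ball)
  qed (use d q eq hF in auto)
  then have "F z = (\<Sum>\<^sub>\<infinity>\<alpha>. c \<alpha> * mi_power z \<alpha>)" by simp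
  moreover have "(\<lambda>\<alpha>. c \<alpha> * mi_power z \<alpha>) summable_on UNIV"
  proof (rule abs_summable_summable, rule summable_on_comparison_test[OF summ])
    fix \<alpha>
    have "z \<in> polydisc R" using z by (simp add: polydisc_def less_imp_le)
    then show "norm (c \<alpha> * mi_power z \<alpha>) \<le> norm (c \<alpha>) * R ^ mi_size \<alpha>"
      unfolding norm_mult by (intro mult_left_mono norm_mi_power_le) auto
  qed auto
  ultimately show ?thesis by (simp add: has_sum_iff)
qed

lemma multinomial_has_sum:
  fixes u p :: "'n::finite \<Rightarrow> 'a::{real_normed_field}"
  shows "((\<lambda>\<beta>. \<Prod>l\<in>UNIV. of_nat (m l choose \<beta> l) * u l ^ \<beta> l * p l ^ (m l - \<beta> l)) has_sum (\<Prod>l\<in>UNIV. (u l + p l) ^ m l)) UNIV"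
proof (rule has_sum_finite_neutralI)
  show "finite (PiE UNIV (\<lambda>l. {..m l}))" by (intro finite_PiE) auto
  show "(\<Prod>l\<in>UNIV. (u l + p l) ^ m l) =
     (\<Sum>\<beta>\<in>PiE UNIV (\<lambda>l. {..m l}). \<Prod>l\<in>UNIV. of_nat (m l choose \<beta> l) * u l ^ \<beta> l * p l ^ (m l - \<beta> l))"
    unfolding binomial_ring by (subst prod_sum_PiE) auto
  fix \<beta> assume \<beta>: "\<beta> \<in> UNIV - PiE UNIV (\<lambda>l. {..m l})"
  have "\<exists>l. m l < \<beta> l"
  proof (rule ccontr)
    assume "\<nexists>l. m l < \<beta> l"
    then show False using \<beta> by (simp add: not_less PiE_def Pi_def)
  qed
  then obtain l where "m l < \<beta> l" by blast
  then have "of_nat (m l choose \<beta> l) * u l ^ \<beta> l * p l ^ (m l - \<beta> l) = 0" by simp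
  then show "(\<Prod>l\<in>UNIV. of_nat (m l choose \<beta> l) * u l ^ \<beta> l * p l ^ (m l - \<beta> l)) = 0"
    by (metis (no_types, lifting) UNIV_I finite prod_zero)
qed auto

text \<open>Expand each monomial of z = (z - p) + p binomially. The double family is absolutely
  summable as long as |z - p| + |p| stays within rho in each coordinate, so it may be summed over
  \<open>i\<close> first. The index set is arbitrary so that words and trees, which repeat
  monomials, can be used directly.\<close>

lemma has_power_series_recenter:
  fixes a :: "'i \<Rightarrow> complex" and \<mu> :: "'i \<Rightarrow> 'n::finite \<Rightarrow> nat"
  assumes summ: "(\<lambda>i. norm (a i) * \<rho> ^ mi_size (\<mu> i)) summable_on I"
    and F: "\<And>z. z \<in> polydisc \<rho> \<Longrightarrow> ((\<lambda>i. a i * mi_power z (\<mu> i)) has_sum F z) I"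
    and p: "\<And>l. norm (p $ l) < \<rho>"
  shows "\<exists>c. has_power_series F c p"
proof -
  define r where "r = Min (range (\<lambda>l. \<rho> - norm (p $ l)))"
  have r0: "r > 0" unfolding r_def using p by (subst Min_gr_iff) auto
  have rp: "r + norm (p $ l) \<le> \<rho>" for l
  proof -
    have "r \<le> \<rho> - norm (p $ l)" unfolding r_def by (intro Min_le) auto
    then show ?thesis by simp
  qed
  define cf where "cf i \<beta> = a i * (\<Prod>l\<in>UNIV. of_nat (\<mu> i l choose \<beta> l) * (p $ l) ^ (\<mu> i l - \<beta> l))" for i \<beta>
  define c where "c \<beta> = (\<Sum>\<^sub>\<infinity>i\<in>I. cf i \<beta>)" for \<beta>
  have "((\<lambda>\<beta>. c \<beta> * mi_power (z - p) \<beta>) has_sum F z) UNIV" if z: "\<forall>l. norm (z $ l - p $ l) < r" for z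
  proof -
    define t where "t x = (case x of (i, \<beta>) \<Rightarrow> cf i \<beta> * mi_power (z - p) \<beta>)" for x
    have t: "t (i, \<beta>) = a i * (\<Prod>l\<in>UNIV. of_nat (\<mu> i l choose \<beta> l) * ((z - p) $ l) ^ \<beta> l * (p $ l) ^ (\<mu> i l - \<beta> l))" for i \<beta>
      by (simp add: t_def cf_def mi_power_def prod.distrib mult_ac)
    have inner: "((\<lambda>\<beta>. t (i, \<beta>)) has_sum (a i * mi_power z (\<mu> i))) UNIV" for i
      using has_sum_cmult_right[OF multinomial_has_sum[where u = "\<lambda>l. (z - p) $ l" and p = "\<lambda>l. p $ l" and m = "\<mu> i"], of "a i"]
      unfolding t by (simp add: mi_power_def)
    have inner_norm: "((\<lambda>\<beta>. norm (t (i, \<beta>))) has_sum (norm (a i) * (\<Prod>l\<in>UNIV. (norm ((z - p) $ l) + norm (p $ l)) ^ \<mu> i l))) UNIV" for i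
      using has_sum_cmult_right[OF multinomial_has_sum[where u = "\<lambda>l. norm ((z - p) $ l)" and p = "\<lambda>l. norm (p $ l)" and m = "\<mu> i"], of "norm (a i)"]
      unfolding t by (simp add: norm_mult norm_power prod_norm[symmetric])
    have le: "(\<Prod>l\<in>UNIV. (norm ((z - p) $ l) + norm (p $ l)) ^ \<mu> i l) \<le> \<rho> ^ mi_size (\<mu> i)" for i
      unfolding mi_size_def power_sum
    proof (intro prod_mono conjI power_mono)
      fix l
      have "norm ((z - p) $ l) < r" using z by simp
      then show "norm ((z - p) $ l) + norm (p $ l) \<le> \<rho>" using rp[of l] by linarith
    qed auto
    have zin: "z \<in> polydisc \<rho>"
      unfolding polydisc_def
    proof (intro CollectI allI)
      fix l
      have "norm (z $ l) \<le> norm (z $ l - p $ l) + norm (p $ l)" by (metis diff_add_cancel norm_triangle_ineq)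
      moreover have "norm (z $ l - p $ l) < r" using z by simp
      ultimately show "norm (z $ l) \<le> \<rho>" using rp[of l] by linarith
    qed
    have "(\<lambda>x. norm (t x)) summable_on (I \<times> UNIV)"
    proof (rule summable_on_SigmaI[OF inner_norm])
      show "(\<lambda>i. norm (a i) * (\<Prod>l\<in>UNIV. (norm ((z - p) $ l) + norm (p $ l)) ^ \<mu> i l)) summable_on I"
        by (rule summable_on_comparison_test[OF summ])
           (intro mult_left_mono le norm_ge_zero mult_nonneg_nonneg prod_nonneg zero_le_power ballI add_nonneg_nonneg)+
    qed auto
    then have ts: "t summable_on (I \<times> UNIV)" by (rule abs_summable_summable)
    have "(t has_sum F z) (I \<times> UNIV)"
      by (rule has_sum_SigmaI[OF inner F[OF zin] ts])
    then have "((\<lambda>(\<beta>, i). t (i, \<beta>)) has_sum F z) (UNIV \<times> I)"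
      by (subst (asm) has_sum_swap)
    then show ?thesis
    proof (rule has_sum_SigmaD)
      fix \<beta> :: "'n \<Rightarrow> nat"
      have "(\<lambda>(\<beta>, i). t (i, \<beta>)) summable_on (UNIV \<times> I)"
        using ts by (subst (asm) summable_on_swap)
      then have "(\<lambda>i. t (i, \<beta>)) summable_on I"
        by (rule summable_on_SigmaD1) auto
      moreover have "infsum (\<lambda>i. t (i, \<beta>)) I = c \<beta> * mi_power (z - p) \<beta>"
        by (simp add: t_def c_def infsum_cmult_left')
      ultimately show "((\<lambda>i. case (\<beta>, i) of (\<beta>, i) \<Rightarrow> t (i, \<beta>)) has_sum c \<beta> * mi_power (z - p) \<beta>) I"
        by (simp add: has_sum_iff)
    qed
  qed
  then show ?thesis unfolding has_power_series_def using r0 by blast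
qed

section \<open>Sums over lists and trees\<close>

lemma has_sum_times:
  fixes f :: "'a \<Rightarrow> 'c::{real_normed_field, banach}" and g :: "'b \<Rightarrow> 'c"
  assumes f: "(f has_sum s) A" "(\<lambda>x. norm (f x)) summable_on A"
    and g: "(g has_sum t) B" "(\<lambda>x. norm (g x)) summable_on B"
  shows "((\<lambda>(x, y). f x * g y) has_sum s * t) (A \<times> B)"
    and "(\<lambda>(x, y). norm (f x * g y)) summable_on (A \<times> B)"
proof -
  obtain G where G: "((\<lambda>y. norm (g y)) has_sum G) B" using g(2) by (auto simp: summable_on_def)
  show *: "(\<lambda>(x, y). norm (f x * g y)) summable_on (A \<times> B)"
  proof (rule summable_on_SigmaI)
    show "((\<lambda>y. case (x, y) of (x, y) \<Rightarrow> norm (f x * g y)) has_sum norm (f x) * G) B" for x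
      using has_sum_cmult_right[OF G, of "norm (f x)"] by (simp add: norm_mult)
    show "(\<lambda>x. norm (f x) * G) summable_on A" by (intro summable_on_cmult_left f)
  qed auto
  show "((\<lambda>(x, y). f x * g y) has_sum s * t) (A \<times> B)"
  proof (rule has_sum_SigmaI)
    show "((\<lambda>y. case (x, y) of (x, y) \<Rightarrow> f x * g y) has_sum f x * t) B" for x
      using has_sum_cmult_right[OF g(1), of "f x"] by simp
    show "((\<lambda>x. f x * t) has_sum s * t) A" by (intro has_sum_cmult_left f)
    show "(\<lambda>(x, y). f x * g y) summable_on A \<times> B"
      by (rule abs_summable_summable) (use * in \<open>simp add: case_prod_unfold\<close>)
  qed
qed

text \<open>Multiplies out a monomial in the components of a tree sum: position by position, one
  tree is chosen among those whose root carries the letter of \<open>w\<close>.\<close>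

lemma has_sum_prod_list:
  fixes f :: "'a \<Rightarrow> 'c::{real_normed_field, banach}"
  assumes "\<And>k. k \<in> set w \<Longrightarrow> (f has_sum S k) (A k)"
    and "\<And>k. k \<in> set w \<Longrightarrow> (\<lambda>x. norm (f x)) summable_on A k"
  shows "((\<lambda>xs. prod_list (map f xs)) has_sum prod_list (map S w)) {xs. list_all2 (\<lambda>x k. x \<in> A k) xs w}
    \<and> (\<lambda>xs. norm (prod_list (map f xs))) summable_on {xs. list_all2 (\<lambda>x k. x \<in> A k) xs w}"
  using assms
proof (induction w)
  case Nil
  have "{xs. list_all2 (\<lambda>x k. x \<in> A k) xs []} = {[]}" by auto
  then show ?case by (simp add: has_sum_finite_iff)
next
  case (Cons k w)
  let ?L = "{xs. list_all2 (\<lambda>x k. x \<in> A k) xs w}"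
  have eq: "{xs. list_all2 (\<lambda>x k. x \<in> A k) xs (k # w)} = (\<lambda>(x, xs). x # xs) ` (A k \<times> ?L)"
    by (auto simp: list_all2_Cons2)
  have inj: "inj_on (\<lambda>(x, xs). x # xs) (A k \<times> ?L)" by (auto simp: inj_on_def)
  have IH: "((\<lambda>xs. prod_list (map f xs)) has_sum prod_list (map S w)) ?L"
    "(\<lambda>xs. norm (prod_list (map f xs))) summable_on ?L" using Cons by auto
  have fk: "(f has_sum S k) (A k)" "(\<lambda>x. norm (f x)) summable_on A k" using Cons.prems by auto
  show ?case
    unfolding eq has_sum_reindex[OF inj] summable_on_reindex[OF inj] o_def
    using has_sum_times[OF fk IH] by (simp add: case_prod_unfold)
qed

lemma has_sum_geometric_from_2:
  fixes x :: real
  assumes "0 \<le> x" "x < 1"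
  shows "((\<lambda>k. x ^ k) has_sum x\<^sup>2 / (1 - x)) {2..}"
proof -
  have "(\<lambda>k. x\<^sup>2 * x ^ k) sums (x\<^sup>2 * (1 / (1 - x)))"
    using assms by (intro sums_mult geometric_sums) auto
  then have "((\<lambda>k. x ^ (k + 2)) has_sum x\<^sup>2 / (1 - x)) UNIV"
    using assms by (intro sums_nonneg_imp_has_sum) (auto simp: power_add power2_eq_square mult_ac)
  moreover have "bij_betw (\<lambda>k. k + 2) UNIV {2::nat..}"
    by (rule bij_betwI[of _ _ _ "\<lambda>k. k - 2"]) auto
  ultimately show ?thesis
    using has_sum_reindex_bij_betw[of "\<lambda>k. k + 2" UNIV "{2..}" "\<lambda>k. x ^ k"] by simp
qed

definition lists2 :: "'a set \<Rightarrow> 'a list set" where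
  "lists2 A = {xs \<in> lists A. 2 \<le> length xs}"

text \<open>The lists of length k contribute (B S)^k, so the total is the geometric tail x^2 / (1 -
  x) with x = B S, at most 2 x^2 when x is at most 1/2.\<close>

lemma list_series:
  fixes u :: "'a \<Rightarrow> real"
  assumes u: "(u has_sum S) A" "\<And>x. x \<in> A \<Longrightarrow> 0 \<le> u x" and B: "0 \<le> B" "B * S \<le> 1/2"
  shows "(\<lambda>xs. B ^ length xs * prod_list (map u xs)) summable_on lists2 A"
    and "infsum (\<lambda>xs. B ^ length xs * prod_list (map u xs)) (lists2 A) \<le> 2 * (B * S)\<^sup>2"
proof -
  define x where "x = B * S"
  have x: "0 \<le> x" "x < 1" "x \<le> 1/2" using B has_sum_nonneg[OF u] by (auto simp: x_def)
  let ?h = "\<lambda>xs. B ^ length xs * prod_list (map u xs)"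
  let ?L = "\<lambda>k. {xs \<in> lists A. length xs = k}"
  have un: "(\<lambda>x. norm (u x)) summable_on A"
    using has_sum_imp_summable[OF u(1)] by (rule iffD1[OF summable_on_cong, rotated]) (use u(2) in auto)
  have 1: "(?h has_sum x ^ k) (?L k)" for k
  proof -
    \<comment> \<open>A word over \<open>unit\<close> records only its length, so the product rule
      for words also covers lists over a single set.\<close>
    have eq: "{xs. list_all2 (\<lambda>x (k::unit). x \<in> A) xs (replicate k ())} = ?L k"
      by (auto simp: list_all2_conv_all_nth set_conv_nth)
    have "((\<lambda>xs. prod_list (map u xs)) has_sum prod_list (map (\<lambda>_. S) (replicate k ()))) (?L k)"
      using has_sum_prod_list[of "replicate k ()" u "\<lambda>_. A" "\<lambda>_. S"] u(1) un unfolding eq by simp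
    then have "((\<lambda>xs. B ^ k * prod_list (map u xs)) has_sum B ^ k * S ^ k) (?L k)"
      by (intro has_sum_cmult_right) (simp add: map_replicate prod_list_replicate)
    also have "?this \<longleftrightarrow> ?thesis"
      unfolding x_def power_mult_distrib by (intro has_sum_cong) auto
    finally show ?thesis .
  qed
  have nn: "0 \<le> ?h xs" if "xs \<in> lists A" for xs
    using that B(1) u(2) by (intro mult_nonneg_nonneg zero_le_power prod_list_nonneg) auto
  have sm: "(\<lambda>(k, xs). ?h xs) summable_on (Sigma {2..} ?L)"
  proof (rule summable_on_SigmaI)
    show "((\<lambda>y. case (k, y) of (k, xs) \<Rightarrow> ?h xs) has_sum x ^ k) (?L k)" for k
      using 1[of k] by simp
    show "(\<lambda>k. x ^ k) summable_on {2..}"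
      using has_sum_geometric_from_2[OF x(1,2)] by (rule has_sum_imp_summable)
  qed (use nn in auto)
  have 2: "((\<lambda>(k, xs). ?h xs) has_sum x\<^sup>2 / (1 - x)) (Sigma {2..} ?L)"
    by (rule has_sum_SigmaI[OF _ has_sum_geometric_from_2[OF x(1,2)] sm]) (use 1 in simp)
  have bij: "bij_betw snd (Sigma {2..} ?L) (lists2 A)"
    by (rule bij_betwI[of _ _ _ "\<lambda>xs. (length xs, xs)"]) (auto simp: lists2_def)
  have 3: "(?h has_sum x\<^sup>2 / (1 - x)) (lists2 A)"
    using 2 has_sum_reindex_bij_betw[OF bij, of ?h] by (simp add: case_prod_unfold)
  then show "?h summable_on lists2 A" by (rule has_sum_imp_summable)
  have "x\<^sup>2 / (1 - x) \<le> x\<^sup>2 / (1/2)" using x by (intro divide_left_mono) auto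
  then show "infsum ?h (lists2 A) \<le> 2 * (B * S)\<^sup>2"
    using 3 by (simp add: infsumI x_def)
qed

text \<open>The terms of the formal solution are indexed by ordered trees and the monomials by words
  rather than by multi-indices. Substituting a sum over trees into a power series then merely gives
  a sum over lists of trees, and no combinatorial coefficients appear.\<close>

datatype 'n rtree = Leaf 'n | Node 'n "'n rtree list"

fun root_label :: "'n rtree \<Rightarrow> 'n" where
  "root_label (Leaf l) = l"
| "root_label (Node l ts) = l"

fun leaves :: "'n rtree \<Rightarrow> 'n list" where
  "leaves (Leaf l) = [l]"
| "leaves (Node l ts) = concat (map leaves ts)"

text \<open>Two children at least, because the nonlinearity has no linear part. The number of inner
  nodes is then controlled by the number of leaves.\<close>

fun proper :: "'n rtree \<Rightarrow> bool" where
  "proper (Leaf l) \<longleftrightarrow> True"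
| "proper (Node l ts) \<longleftrightarrow> 2 \<le> length ts \<and> (\<forall>T\<in>set ts. proper T)"

text \<open>Exhausts the proper trees by height, so that sums over trees can be bounded by induction
  before their convergence is known.\<close>

fun trees_upto :: "nat \<Rightarrow> 'n rtree set" where
  "trees_upto 0 = {}"
| "trees_upto (Suc h) = range Leaf \<union> (\<lambda>(l, ts). Node l ts) ` (UNIV \<times> lists2 (trees_upto h))"

lemma trees_upto_mono: "h \<le> k \<Longrightarrow> trees_upto h \<subseteq> trees_upto k"
proof (induction h arbitrary: k)
  case (Suc h)
  then obtain k' where "k = Suc k'" "h \<le> k'" by (cases k) auto
  with Suc.IH[of k'] show ?case by (fastforce simp: lists2_def)
qed simp

lemma trees_upto_finite:
  assumes "finite F" "\<And>T. T \<in> F \<Longrightarrow> \<exists>h. T \<in> trees_upto h"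
  shows "\<exists>h. F \<subseteq> trees_upto h"
  using assms
proof (induction F)
  case (insert T F)
  then have "\<exists>h. F \<subseteq> trees_upto h" by blast
  moreover have "\<exists>k. T \<in> trees_upto k" using insert by blast
  ultimately obtain h k where "F \<subseteq> trees_upto h" "T \<in> trees_upto k" by blast
  then have "insert T F \<subseteq> trees_upto (max h k)"
    using trees_upto_mono[of h "max h k"] trees_upto_mono[of k "max h k"] by auto
  then show ?case by blast
qed simp

lemma proper_in_trees_upto: "proper T \<Longrightarrow> \<exists>h. T \<in> trees_upto h"
proof (induction T)
  case (Leaf l)
  have "Leaf l \<in> trees_upto 1" by simp
  then show ?case by blast
next
  case (Node l ts)
  then have "\<exists>h. set ts \<subseteq> trees_upto h" by (intro trees_upto_finite) auto
  then obtain h where "set ts \<subseteq> trees_upto h" by blast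
  then have "Node l ts \<in> trees_upto (Suc h)" using Node.prems by (auto simp: lists2_def)
  then show ?case by blast
qed

lemma prod_list_map_power: "prod_list (map (\<lambda>T. x ^ f T) ts) = (x :: 'a::comm_monoid_mult) ^ sum_list (map f ts)"
  by (induction ts) (auto simp: power_add)

text \<open>With n labels, the sum S of one level leads to at most n x + 2 n S^2 at the next. The
  bound 2 n x reproduces itself since 2 n (2 n x)^2 = (8 n^2 x) n x, which is at most n x; this is
  the origin of the constant 8 n^2.\<close>

lemma tree_series_upto:
  fixes x :: real
  assumes x: "0 \<le> x" "8 * real CARD('n::finite) ^ 2 * x \<le> 1"
  shows "(\<lambda>T :: 'n rtree. x ^ length (leaves T)) summable_on trees_upto h
    \<and> infsum (\<lambda>T :: 'n rtree. x ^ length (leaves T)) (trees_upto h) \<le> 2 * real CARD('n) * x"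
proof (induction h)
  case 0
  then show ?case using x by simp
next
  case (Suc h)
  let ?u = "\<lambda>T :: 'n rtree. x ^ length (leaves T)"
  let ?n = "real CARD('n)"
  define S where "S = infsum ?u (trees_upto h)"
  have S: "(?u has_sum S) (trees_upto h)" "S \<le> 2 * ?n * x" using Suc by (auto simp: S_def)
  have n1: "?n \<ge> 1" by (simp add: Suc_leI)
  have S0: "0 \<le> S" unfolding S_def using x by (intro infsum_nonneg) auto
  have nx: "?n * x \<le> ?n ^ 2 * x"
    using n1 x by (intro mult_right_mono) (auto simp: power2_eq_square)
  then have S12: "1 * S \<le> 1/2" using S(2) x by (simp add: mult.assoc)
  let ?L = "lists2 (trees_upto h) :: 'n rtree list set"
  have sl: "(\<lambda>xs. 1 ^ length xs * prod_list (map ?u xs)) summable_on ?L"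
    "infsum (\<lambda>xs. 1 ^ length xs * prod_list (map ?u xs)) ?L \<le> 2 * (1 * S)\<^sup>2"
    by (rule list_series[OF S(1) _ _ S12]; use x in simp)+
  have uN: "(\<lambda>ts. ?u (Node l ts)) = (\<lambda>xs. 1 ^ length xs * prod_list (map ?u xs))" for l
    by (simp add: prod_list_map_power length_concat o_def)
  define W where "W = infsum (\<lambda>xs. 1 ^ length xs * prod_list (map ?u xs)) ?L"
  have W: "((\<lambda>ts. ?u (Node l ts)) has_sum W) ?L" for l
    unfolding uN W_def using sl(1) by simp
  have W2: "W \<le> 2 * S\<^sup>2" using sl(2) by (simp add: W_def)
  have "((\<lambda>(l, ts). ?u (Node l ts)) has_sum ?n * W) (UNIV \<times> ?L)"
  proof (rule has_sum_SigmaI)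
    show "((\<lambda>ts. case (l, ts) of (l, ts) \<Rightarrow> ?u (Node l ts)) has_sum W) ?L" for l using W[of l] by simp
    show "((\<lambda>l::'n. W) has_sum ?n * W) UNIV" by (intro has_sum_finiteI) auto
    show "(\<lambda>(l::'n, ts). ?u (Node l ts)) summable_on UNIV \<times> ?L"
      by (rule summable_on_SigmaI[where g = "\<lambda>_. W"]) (use W x in auto)
  qed
  then have N: "(?u has_sum ?n * W) ((\<lambda>(l, ts). Node l ts) ` (UNIV \<times> ?L))"
    by (subst has_sum_reindex) (auto simp: inj_on_def o_def case_prod_unfold)
  have L: "(?u has_sum ?n * x) (range Leaf)"
    by (subst has_sum_reindex) (auto simp: inj_on_def o_def intro!: has_sum_finiteI)
  have tot: "(?u has_sum ?n * x + ?n * W) (trees_upto (Suc h))"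
    unfolding trees_upto.simps by (rule has_sum_Un_disjoint[OF L N]) auto
  have "?n * W \<le> ?n * (2 * (2 * ?n * x)\<^sup>2)"
    using W2 S0 S(2) power_mono[of S "2 * ?n * x" 2] n1 by (intro mult_left_mono) auto
  also have "\<dots> = (8 * ?n ^ 2 * x) * (?n * x)" by (simp add: power2_eq_square)
  also have "\<dots> \<le> 1 * (?n * x)" using x by (intro mult_right_mono) auto
  finally show ?case
    using tot by (auto simp: has_sum_iff)
qed

text \<open>Every finite set of proper trees lies in one level, and the bound for the levels is
  independent of the height.\<close>

lemma tree_series:
  fixes x :: real
  assumes x: "0 \<le> x" "8 * real CARD('n::finite) ^ 2 * x \<le> 1"
  shows "(\<lambda>T :: 'n rtree. x ^ length (leaves T)) summable_on {T. proper T}"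
    and "infsum (\<lambda>T :: 'n rtree. x ^ length (leaves T)) {T. proper T} \<le> 2 * real CARD('n) * x"
proof -
  let ?u = "\<lambda>T :: 'n rtree. x ^ length (leaves T)"
  have fin: "sum ?u F \<le> 2 * real CARD('n) * x" if F: "finite F" "F \<subseteq> {T. proper T}" for F
  proof -
    have "\<exists>h. F \<subseteq> trees_upto h"
      using F proper_in_trees_upto by (intro trees_upto_finite) auto
    then obtain h where h: "F \<subseteq> trees_upto h" by blast
    have "sum ?u F \<le> infsum ?u (trees_upto h)"
      using tree_series_upto[OF x, of h] F h x by (intro finite_sum_le_infsum) auto
    then show ?thesis using tree_series_upto[OF x, of h] by simp
  qed
  show *: "?u summable_on {T. proper T}"
    by (rule nonneg_bdd_above_summable_on) (use x fin in \<open>auto intro!: bdd_aboveI2\<close>)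
  show "infsum ?u {T. proper T} \<le> 2 * real CARD('n) * x"
    by (rule infsum_le_finite_sums[OF * fin])
qed

text \<open>Inserting the tree sums \<open>X\<close> into a power series: lists of trees are grouped
  by the word of their root labels, and within a group the sum factors into a product of the
  \<open>X k\<close>. The bound on \<open>B * S\<close> makes everything absolutely
  summable.\<close>

lemma tree_substitution:
  fixes u :: "'n rtree \<Rightarrow> complex" and \<gamma> :: "'n list \<Rightarrow> complex"
  assumes u: "((\<lambda>T. norm (u T)) has_sum S) {T. proper T}"
    and \<gamma>: "\<And>w. norm (\<gamma> w) \<le> B ^ length w"
    and B: "0 \<le> B" "B * S \<le> 1/2"
  defines "X \<equiv> \<lambda>k. infsum u {T. proper T \<and> root_label T = k}"
  obtains W where "((\<lambda>ts. \<gamma> (map root_label ts) * prod_list (map u ts)) has_sum W) (lists2 {T. proper T})"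
    and "((\<lambda>w. \<gamma> w * prod_list (map X w)) has_sum W) (lists2 UNIV)"
proof -
  let ?P = "{T :: 'n rtree. proper T}"
  let ?A = "\<lambda>k. {T. proper T \<and> root_label T = k}"
  let ?f = "\<lambda>ts. \<gamma> (map root_label ts) * prod_list (map u ts)"
  have pn: "norm (prod_list (map u ts)) = prod_list (map (\<lambda>T. norm (u T)) ts)" for ts
    by (induction ts) (auto simp: norm_mult)
  have "(\<lambda>ts. norm (?f ts)) summable_on lists2 ?P"
  proof (rule summable_on_comparison_test)
    show "(\<lambda>ts. B ^ length ts * prod_list (map (\<lambda>T. norm (u T)) ts)) summable_on lists2 ?P"
      by (rule list_series(1)[OF u _ B]) simp
    show "norm (?f ts) \<le> B ^ length ts * prod_list (map (\<lambda>T. norm (u T)) ts)" for ts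
      using \<gamma>[of "map root_label ts"] unfolding norm_mult pn by (intro mult_mono prod_list_nonneg) (auto simp: B)
  qed simp
  then have sm: "?f summable_on lists2 ?P" by (rule abs_summable_summable)
  then obtain W where W: "(?f has_sum W) (lists2 ?P)" by (auto simp: summable_on_def)
  let ?L = "\<lambda>w. {ts. list_all2 (\<lambda>T k. T \<in> ?A k) ts w}"
  have Lw: "map root_label ts = w \<and> set ts \<subseteq> ?P" if "ts \<in> ?L w" for ts w
    using that by (auto simp: list_all2_conv_all_nth in_set_conv_nth intro!: nth_equalityI)
  have lenL: "length ts = length w" if "ts \<in> ?L w" for ts w using that by (auto simp: list_all2_lengthD)
  have bij: "bij_betw snd (Sigma (lists2 UNIV) ?L) (lists2 ?P)"
  proof (rule bij_betwI[of _ _ _ "\<lambda>ts. (map root_label ts, ts)"])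
    show "snd \<in> Sigma (lists2 UNIV) ?L \<rightarrow> lists2 ?P"
    proof
      fix x :: "'n list \<times> 'n rtree list" assume "x \<in> Sigma (lists2 UNIV) ?L"
      then have "2 \<le> length (fst x)" "snd x \<in> ?L (fst x)" by (auto simp: lists2_def)
      then show "snd x \<in> lists2 ?P" using Lw[of "snd x" "fst x"] lenL[of "snd x" "fst x"]
        by (auto simp: lists2_def)
    qed
    show "(\<lambda>ts. (map root_label ts, ts)) \<in> lists2 ?P \<rightarrow> Sigma (lists2 UNIV) ?L"
      by (auto simp: lists2_def list_all2_map2 list_all2_same)
    show "(\<lambda>ts. (map root_label ts, ts)) (snd x) = x" if "x \<in> Sigma (lists2 UNIV) ?L"
      for x :: "'n list \<times> 'n rtree list"
      using that Lw[of "snd x" "fst x"] by (auto simp: prod_eq_iff)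
  qed auto
  have W2: "((\<lambda>(w, ts). ?f ts) has_sum W) (Sigma (lists2 UNIV) ?L)"
    using W has_sum_reindex_bij_betw[OF bij, of ?f] by (simp add: case_prod_unfold)
  have "((\<lambda>w. \<gamma> w * prod_list (map X w)) has_sum W) (lists2 UNIV)"
  proof (rule has_sum_SigmaD[OF W2])
    fix w :: "'n list"
    have un: "(\<lambda>T. norm (u T)) summable_on ?A k" for k
      using has_sum_imp_summable[OF u] by (rule summable_on_subset_banach) auto
    then have "(u has_sum X k) (?A k)" for k
      unfolding X_def using abs_summable_summable[OF un] by simp
    then have "((\<lambda>ts. prod_list (map u ts)) has_sum prod_list (map X w)) (?L w)"
      using has_sum_prod_list[of w u ?A X] un by blast
    then have "((\<lambda>ts. \<gamma> w * prod_list (map u ts)) has_sum \<gamma> w * prod_list (map X w)) (?L w)"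
      by (rule has_sum_cmult_right)
    also have "?this \<longleftrightarrow> ((\<lambda>y. case (w, y) of (w, ts) \<Rightarrow> ?f ts) has_sum \<gamma> w * prod_list (map X w)) (?L w)"
      by (intro has_sum_cong) (use Lw in auto)
    finally show "((\<lambda>y. case (w, y) of (w, ts) \<Rightarrow> ?f ts) has_sum \<gamma> w * prod_list (map X w)) (?L w)" .
  qed
  with W that show thesis by blast
qed

section \<open>Products of small divisors\<close>

fun subtrees :: "'n rtree \<Rightarrow> 'n rtree set" where
  "subtrees (Leaf l) = {Leaf l}"
| "subtrees (Node l ts) = insert (Node l ts) (\<Union>T\<in>set ts. subtrees T)"

text \<open>The leaves of a subtree are consecutive, so they can be exchanged for a single letter
  when two divisors are compared.\<close>

lemma leaves_subtree:
  "S \<in> subtrees T \<Longrightarrow> \<exists>us vs. leaves T = us @ leaves S @ vs"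
proof (induction T)
  case (Leaf l)
  then have "leaves (Leaf l) = [] @ leaves S @ []" by simp
  then show ?case by blast
next
  case (Node l ts)
  show ?case
  proof (cases "S = Node l ts")
    case True
    then have "leaves (Node l ts) = [] @ leaves S @ []" by simp
    then show ?thesis by blast
  next
    case False
    then obtain T where T: "T \<in> set ts" "S \<in> subtrees T" using Node.prems by auto
    obtain us vs where 1: "leaves T = us @ leaves S @ vs" using Node.IH[OF T] by blast
    obtain as bs where 2: "ts = as @ T # bs" using split_list[OF T(1)] by blast
    have "leaves (Node l ts) = (concat (map leaves as) @ us) @ leaves S @ (vs @ concat (map leaves bs))"
      by (simp add: 1 2)
    then show ?thesis by blast
  qed
qed

lemma leaves_nonempty: "proper T \<Longrightarrow> 1 \<le> length (leaves T)"
proof (induction T)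
  case (Node l ts)
  then obtain T where "T \<in> set ts" by (cases ts) auto
  then have "1 \<le> length (leaves T)" using Node by auto
  also have "\<dots> \<le> sum_list (map length (map leaves ts))"
    using \<open>T \<in> set ts\<close> by (intro member_le_sum_list) auto
  finally show ?case unfolding leaves.simps length_concat .
qed simp

lemma length_leaves_Node: "length (leaves (Node l ts)) = sum_list (map (\<lambda>T. length (leaves T)) ts)"
  by (simp add: length_concat o_def)

lemma length_le_leaves:
  assumes "\<And>T. T \<in> set ts \<Longrightarrow> proper T"
  shows "length ts \<le> sum_list (map (\<lambda>T. length (leaves T)) ts)"
  using assms by (induction ts) (use leaves_nonempty in fastforce)+

text \<open>A proper node has another child besides \<open>T\<close>, and that child contributes at
  least one leaf.\<close>

lemma length_leaves_child:
  assumes "proper (Node l ts)" "T \<in> set ts"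
  shows "length (leaves T) < length (leaves (Node l ts))"
proof -
  obtain as bs where ts: "ts = as @ T # bs" using split_list[OF assms(2)] by blast
  have "1 \<le> length as + length bs" using assms(1) by (simp add: ts)
  then have "1 \<le> sum_list (map (\<lambda>T. length (leaves T)) as) + sum_list (map (\<lambda>T. length (leaves T)) bs)"
    using length_le_leaves[of as] length_le_leaves[of bs] assms(1) by (auto simp: ts)
  then show ?thesis
    unfolding length_leaves_Node ts map_append sum_list.append list.map sum_list.Cons by linarith
qed

lemma length_leaves_ge_2: "proper (Node l ts) \<Longrightarrow> 2 \<le> length (leaves (Node l ts))"
  using length_le_leaves[of ts] unfolding length_leaves_Node by simp

fun count_nodes :: "('n rtree \<Rightarrow> bool) \<Rightarrow> 'n rtree \<Rightarrow> nat" where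
  "count_nodes bad (Leaf l) = 0"
| "count_nodes bad (Node l ts) = (if bad (Node l ts) then 1 else 0) + sum_list (map (count_nodes bad) ts)"

text \<open>\<open>f\<close> counts bad nodes and \<open>g\<close> counts leaves in the children of
  a node. Children with at most q leaves contribute nothing; each larger one leaves a surplus of q.
  Two large children yield the surplus 2 q of the last alternative, and a single one passes its
  count on unchanged.\<close>

lemma sum_list_trichotomy:
  fixes f g :: "'a \<Rightarrow> nat"
  assumes "\<And>x. x \<in> set xs \<Longrightarrow> (g x \<le> q \<longrightarrow> f x = 0) \<and> (q < g x \<longrightarrow> f x * q + q \<le> 2 * g x)"
  shows "sum_list (map f xs) = 0 \<or> (\<exists>x\<in>set xs. sum_list (map f xs) = f x \<and> q < g x) \<or>
    sum_list (map f xs) * q + 2 * q \<le> 2 * sum_list (map g xs)"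
  using assms
proof (induction xs)
  case (Cons x xs)
  let ?S = "sum_list (map f xs)" and ?G = "sum_list (map g xs)"
  have IH: "?S = 0 \<or> (\<exists>x\<in>set xs. ?S = f x \<and> q < g x) \<or> ?S * q + 2 * q \<le> 2 * ?G"
    using Cons by auto
  show ?case
  proof (cases "q < g x")
    case False
    then have "f x = 0" using Cons.prems[of x] by auto
    then show ?thesis using IH by auto
  next
    case True
    then have fx: "f x * q + q \<le> 2 * g x" using Cons.prems[of x] by auto
    consider "?S = 0" | y where "y \<in> set xs" "?S = f y" "q < g y" | "?S * q + 2 * q \<le> 2 * ?G"
      using IH by metis
    then show ?thesis
    proof cases
      case 1
      then show ?thesis using True by auto
    next
      case 2
      then have "f y * q + q \<le> 2 * g y" using Cons.prems[of y] by auto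
      moreover have "g y \<le> ?G" using 2 by (intro member_le_sum_list) auto
      ultimately have "(f x + ?S) * q + 2 * q \<le> 2 * (g x + ?G)"
        using fx 2 by (simp add: algebra_simps)
      then show ?thesis by simp
    next
      case 3
      then have "(f x + ?S) * q + 2 * q \<le> 2 * (g x + ?G)"
        using fx by (simp add: algebra_simps)
      then show ?thesis by simp
    qed
  qed
qed simp

text \<open>Brjuno's counting argument: small divisors on a branch of the tree are at least \<open>q\<close> leaves
  apart, so the tree cannot contain many of them. The last conclusion is the strengthening needed
  for the induction; it concerns trees lying below a small divisor with \<open>s\<close> leaves.\<close>

lemma count_nodes_bound:
  assumes large: "\<And>T. proper T \<Longrightarrow> bad T \<Longrightarrow> q < length (leaves T)"
    and apart: "\<And>l ts T S. proper (Node l ts) \<Longrightarrow> T \<in> set ts \<Longrightarrow> S \<in> subtrees T \<Longrightarrow>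
      bad (Node l ts) \<Longrightarrow> bad S \<Longrightarrow> length (leaves S) + q \<le> length (leaves (Node l ts))"
  shows "proper T \<Longrightarrow> (length (leaves T) \<le> q \<longrightarrow> count_nodes bad T = 0) \<and>
    (q < length (leaves T) \<longrightarrow> count_nodes bad T * q + q \<le> 2 * length (leaves T)) \<and>
    (\<forall>s. length (leaves T) \<le> s \<and> q \<le> s \<and> (\<forall>U\<in>subtrees T. bad U \<longrightarrow> length (leaves U) + q \<le> s) \<longrightarrow>
      count_nodes bad T * q + 2 * q \<le> 2 * s)"
proof (induction T)
  case (Node l ts)
  let ?T = "Node l ts"
  let ?g = "\<lambda>T. length (leaves T)"
  define c where "c = sum_list (map (count_nodes bad) ts)"
  have cT: "count_nodes bad ?T = (if bad ?T then 1 else 0) + c" by (simp add: c_def)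
  have IH1: "(?g S \<le> q \<longrightarrow> count_nodes bad S = 0) \<and> (q < ?g S \<longrightarrow> count_nodes bad S * q + q \<le> 2 * ?g S)"
    if "S \<in> set ts" for S using Node.IH[OF that] Node.prems that by auto
  have IH2: "count_nodes bad S * q + 2 * q \<le> 2 * s"
    if "S \<in> set ts" "?g S \<le> s" "q \<le> s" "\<And>U. U \<in> subtrees S \<Longrightarrow> bad U \<Longrightarrow> ?g U + q \<le> s" for S s
    using Node.IH[OF that(1)] Node.prems that by auto
  have tri: "c = 0 \<or> (\<exists>S\<in>set ts. c = count_nodes bad S \<and> q < ?g S) \<or> c * q + 2 * q \<le> 2 * ?g ?T"
    using sum_list_trichotomy[of ts ?g q "count_nodes bad"] IH1 unfolding length_leaves_Node c_def by blast
  have child: "?g S < ?g ?T" if "S \<in> set ts" for S by (rule length_leaves_child[OF Node.prems that])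
  have A: "count_nodes bad ?T = 0" if "?g ?T \<le> q"
  proof -
    have "\<not> bad ?T" using large[OF Node.prems] that by auto
    moreover have "\<forall>S\<in>set ts. count_nodes bad S = 0"
    proof
      fix S assume "S \<in> set ts"
      then show "count_nodes bad S = 0" using IH1[of S] child[of S] that by linarith
    qed
    ultimately show ?thesis by simp
  qed
  have B: "count_nodes bad ?T * q + q \<le> 2 * ?g ?T" if q: "q < ?g ?T"
  proof (cases "bad ?T")
    case True
    from tri show ?thesis
    proof (elim disjE bexE conjE)
      fix S assume S: "S \<in> set ts" "c = count_nodes bad S" "q < ?g S"
      \<comment> \<open>The strengthened hypothesis with the leaves of the whole tree as
        \<open>s\<close>: all bad nodes of \<open>S\<close> are at least q leaves below the bad
        root. Of the surplus 2 q, one q pays for the root and the other one remains.\<close>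
      have "count_nodes bad S * q + 2 * q \<le> 2 * ?g ?T"
        by (rule IH2[OF S(1)]) (use child[OF S(1)] q apart[OF Node.prems S(1) _ True] in auto)
      then show ?thesis unfolding cT using True S by simp
    qed (use True q in \<open>simp_all add: cT del: count_nodes.simps leaves.simps\<close>)
  next
    case False
    from tri show ?thesis
    proof (elim disjE bexE conjE)
      fix S assume S: "S \<in> set ts" "c = count_nodes bad S" "q < ?g S"
      then have "count_nodes bad S * q + q \<le> 2 * ?g S" using IH1[of S] by blast
      then show ?thesis unfolding cT using False S child[OF S(1)] by simp
    qed (use False q in \<open>simp_all add: cT del: count_nodes.simps leaves.simps\<close>)
  qed
  have C: "count_nodes bad ?T * q + 2 * q \<le> 2 * s"
    if s: "?g ?T \<le> s" "q \<le> s" and U: "\<forall>U\<in>subtrees ?T. bad U \<longrightarrow> ?g U + q \<le> s" for s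
  proof (cases "bad ?T")
    case True
    then have "?g ?T + q \<le> s" using U by simp
    \<comment> \<open>The tree itself has at least q leaves fewer than \<open>s\<close>, and
      doubling this gives the missing q with one more to spare.\<close>
    then show ?thesis using B[OF large[OF Node.prems True]] by linarith
  next
    case False
    from tri show ?thesis
    proof (elim disjE bexE conjE)
      fix S assume S: "S \<in> set ts" "c = count_nodes bad S" "q < ?g S"
      have "count_nodes bad S * q + 2 * q \<le> 2 * s"
        by (rule IH2[OF S(1)]) (use child[OF S(1)] s U S(1) in auto)
      then show ?thesis unfolding cT using False S by simp
    qed (use False s in \<open>simp_all add: cT del: count_nodes.simps leaves.simps\<close>)
  qed
  show ?case using A B C by blast
qed auto

lemma count_nodes_le:
  assumes large: "\<And>T. proper T \<Longrightarrow> bad T \<Longrightarrow> q < length (leaves T)"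
    and apart: "\<And>l ts T S. proper (Node l ts) \<Longrightarrow> T \<in> set ts \<Longrightarrow> S \<in> subtrees T \<Longrightarrow>
      bad (Node l ts) \<Longrightarrow> bad S \<Longrightarrow> length (leaves S) + q \<le> length (leaves (Node l ts))"
    and T: "proper T"
  shows "count_nodes bad T * q \<le> 2 * length (leaves T)"
proof (cases "length (leaves T) \<le> q")
  case True
  have "count_nodes bad T = 0"
    by (rule count_nodes_bound[of bad q T, THEN conjunct1, THEN mp]) (use large apart T True in blast)+
  then show ?thesis by simp
next
  case False
  have "count_nodes bad T * q + q \<le> 2 * length (leaves T)"
    by (rule count_nodes_bound[of bad q T, THEN conjunct2, THEN conjunct1, THEN mp])
       (use large apart T False in \<open>blast | simp\<close>)+
  then show ?thesis by simp
qed

lemma powr_less_imp_less: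
  fixes x y :: real
  assumes "0 < a" "0 \<le> y" "x powr a < y powr a"
  shows "x < y"
  using powr_mono2[of a y x] assms by (cases "x < y") auto

text \<open>\<open>K l u\<close> stands for the norm of the solution operator at an inner node with
  label \<open>l\<close> and leaf word \<open>u\<close>; the product is the total cost of evaluating
  a tree.\<close>

fun kprod :: "('n \<Rightarrow> 'n list \<Rightarrow> real) \<Rightarrow> 'n rtree \<Rightarrow> real" where
  "kprod K (Leaf l) = 1"
| "kprod K (Node l ts) = K l (leaves (Node l ts)) * prod_list (map (kprod K) ts)"

lemma prod_list_mono_nonneg:
  fixes f g :: "'a \<Rightarrow> real"
  assumes "\<And>x. x \<in> set xs \<Longrightarrow> 0 \<le> f x" "\<And>x. x \<in> set xs \<Longrightarrow> f x \<le> g x"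
  shows "prod_list (map f xs) \<le> prod_list (map g xs)"
  using assms
proof (induction xs)
  case (Cons x xs)
  then show ?case
    by (auto intro!: mult_mono prod_list_nonneg intro: order_trans[of 0 "f x" "g x"])
qed simp

lemma prod_list_map_mult:
  "prod_list (map (\<lambda>x. c * f x) xs) = (c :: 'a::comm_monoid_mult) ^ length xs * prod_list (map f xs)"
  by (induction xs) (auto simp: mult_ac)

lemma kprod_nonneg:
  assumes "\<And>l u. 0 \<le> K l u"
  shows "0 \<le> kprod K T"
  by (induction T) (auto intro!: mult_nonneg_nonneg prod_list_nonneg assms)

text \<open>There are fewer inner nodes than leaves. The spare factor \<open>C\<close> on the left
  carries this through the induction: a node adds one factor, together with the spare one this makes
  C^2, and its two or more children supply at least as many.\<close>

lemma kprod_bound_const: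
  assumes K: "\<And>l u. 0 \<le> K l u" "\<And>l u. K l u \<le> C" and C: "1 \<le> C"
  shows "proper T \<Longrightarrow> kprod K T * C \<le> C ^ length (leaves T)"
proof (induction T)
  case (Node l ts)
  have "kprod K (Node l ts) * C \<le> (C * prod_list (map (kprod K) ts)) * C"
    using K C by (auto intro!: mult_right_mono prod_list_nonneg kprod_nonneg)
  also have "\<dots> = C ^ 2 * prod_list (map (kprod K) ts)" by (simp add: power2_eq_square mult_ac)
  also have "\<dots> \<le> C ^ length ts * prod_list (map (kprod K) ts)"
    using C Node.prems by (intro mult_right_mono power_increasing prod_list_nonneg) (auto intro: kprod_nonneg K)
  also have "\<dots> = prod_list (map (\<lambda>T. kprod K T * C) ts)"
    by (subst prod_list_map_mult[symmetric]) (simp add: mult.commute)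
  also have "\<dots> \<le> prod_list (map (\<lambda>T. C ^ length (leaves T)) ts)"
    using Node C K by (intro prod_list_mono_nonneg mult_nonneg_nonneg kprod_nonneg) auto
  also have "\<dots> = C ^ length (leaves (Node l ts))"
    unfolding prod_list_map_power length_leaves_Node ..
  finally show ?case .
qed simp

section \<open>Counting small divisors scale by scale\<close>

context
  fixes D :: "'n \<Rightarrow> 'n list \<Rightarrow> real" and \<gamma> \<tau> :: real
  assumes diff: "\<And>l k us u vs. D l (us @ u @ vs) - D k u = D l (us @ [k] @ vs)"
    and dioph: "\<And>l u. 2 \<le> length u \<Longrightarrow> D l u \<noteq> 0 \<and> inverse \<bar>D l u\<bar> \<le> \<gamma> * real (length u) powr \<tau>"
    and \<gamma>: "1 \<le> \<gamma>" and \<tau>: "0 < \<tau>"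
begin

text \<open>Dyadic scales: at scale m the threshold is twice the Diophantine bound for words of
  length 2^m. The factor 2 is spent on the difference of two small divisors.\<close>

definition small_divisor :: "nat \<Rightarrow> 'n rtree \<Rightarrow> bool" where
  "small_divisor m T \<longleftrightarrow> (\<exists>l ts. T = Node l ts) \<and>
     2 * \<gamma> * (2 powr \<tau>) ^ m < inverse \<bar>D (root_label T) (leaves T)\<bar>"

lemma two_powr_power: "(2 powr \<tau>) ^ m = real (2 ^ m) powr \<tau>"
  by (simp add: powr_powr powr_realpow[symmetric] mult.commute flip: powr_realpow)

lemma small_divisor_large:
  assumes "proper T" "small_divisor m T"
  shows "2 ^ m < length (leaves T)"
proof -
  obtain l ts where T: "T = Node l ts" using assms(2) by (auto simp: small_divisor_def)
  have "2 * \<gamma> * real (2 ^ m) powr \<tau> < \<gamma> * real (length (leaves T)) powr \<tau>"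
    using assms dioph[of "leaves T" "root_label T"] length_leaves_ge_2[of l ts]
    unfolding small_divisor_def two_powr_power T by simp
  then have "\<gamma> * (2 * real (2 ^ m) powr \<tau>) < \<gamma> * (real (length (leaves T)) powr \<tau>)"
    by (simp only: mult_ac)
  then have "2 * real (2 ^ m) powr \<tau> < real (length (leaves T)) powr \<tau>"
    using \<gamma> by (simp only: mult_less_cancel_left_pos)
  then have "real (2 ^ m) powr \<tau> < real (length (leaves T)) powr \<tau>"
    by (smt (verit) powr_ge_zero)
  then have "real (2 ^ m) < real (length (leaves T))"
    by (rule powr_less_imp_less[OF \<tau> of_nat_0_le_iff])
  then show ?thesis by (simp only: of_nat_less_iff)
qed

text \<open>Contracting the leaves of \<open>S\<close> to the label of its root gives a word
  \<open>w\<close> whose divisor is the difference of the two small ones. It is less than twice the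
  inverse threshold, so the Diophantine bound forces \<open>w\<close> to have more than 2^m
  letters.\<close>

lemma small_divisors_apart:
  assumes "proper (Node l ts)" "T \<in> set ts" "S \<in> subtrees T" "small_divisor m (Node l ts)" "small_divisor m S"
  shows "length (leaves S) + 2 ^ m \<le> length (leaves (Node l ts))"
proof -
  define \<theta> where "\<theta> = 2 * \<gamma> * real (2 ^ m) powr \<tau>"
  have \<theta>: "\<theta> > 0" using \<gamma> by (simp add: \<theta>_def)
  obtain us vs where uv: "leaves T = us @ leaves S @ vs" using leaves_subtree[OF assms(3)] by blast
  obtain as bs where ts: "ts = as @ T # bs" using split_list[OF assms(2)] by blast
  define us' vs' where "us' = concat (map leaves as) @ us" and "vs' = vs @ concat (map leaves bs)"
  have eq: "leaves (Node l ts) = us' @ leaves S @ vs'" by (simp add: us'_def vs'_def ts uv)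
  have lt: "length (leaves S) < length (leaves (Node l ts))"
    using length_leaves_child[OF assms(1,2)] uv by simp
  define w where "w = us' @ [root_label S] @ vs'"
  have lw: "length w = length us' + length vs' + 1" by (simp add: w_def)
  \<comment> \<open>The Diophantine bound covers words of length at least 2 only. Since
    \<open>S\<close> lies below a child of the node, some leaf remains outside
    \<open>S\<close>.\<close>
  have w2: "2 \<le> length w" using lt unfolding eq lw length_append by linarith
  let ?a = "D l (leaves (Node l ts))" and ?b = "D (root_label S) (leaves S)"
  have small: "\<bar>x\<bar> < inverse \<theta>" if "\<theta> < inverse \<bar>x\<bar>" for x :: real
    using that \<theta> by (metis inverse_inverse_eq less_imp_inverse_less)
  have "\<bar>?a\<bar> < inverse \<theta>" "\<bar>?b\<bar> < inverse \<theta>"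
    using assms(4,5) unfolding small_divisor_def two_powr_power \<theta>_def[symmetric] by (auto intro!: small)
  then have "\<bar>?a - ?b\<bar> < 2 * inverse \<theta>" by linarith
  also have "?a - ?b = D l w" unfolding eq w_def by (rule diff)
  also have "2 * inverse \<theta> = inverse (\<theta> / 2)" by (simp add: inverse_eq_divide)
  finally have 1: "\<bar>D l w\<bar> < inverse (\<theta> / 2)" .
  have nz: "D l w \<noteq> 0" and 2: "inverse \<bar>D l w\<bar> \<le> \<gamma> * real (length w) powr \<tau>" using dioph[OF w2] by auto
  have "\<theta> / 2 < inverse \<bar>D l w\<bar>"
    using less_imp_inverse_less[OF 1] nz by simp
  then have "\<gamma> * real (2 ^ m) powr \<tau> < \<gamma> * real (length w) powr \<tau>"
    using 2 by (simp add: \<theta>_def)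
  then have "real (2 ^ m) powr \<tau> < real (length w) powr \<tau>"
    using \<gamma> by (simp only: mult_less_cancel_left_pos)
  then have "real (2 ^ m) < real (length w)"
    by (rule powr_less_imp_less[OF \<tau> of_nat_0_le_iff])
  then have "2 ^ m < length w" by (simp only: of_nat_less_iff)
  \<comment> \<open>One letter of \<open>w\<close> stands for \<open>S\<close>; the strict
    inequality compensates for it and leaves at least 2^m leaves outside \<open>S\<close>.\<close>
  then show ?thesis unfolding eq lw length_append by linarith
qed

text \<open>Being small at a scale implies being small at all lower ones. If the bound failed with c
  the number of small scales below \<open>L\<close>, then the c + 1 scales from 0 to c would all be
  small, and c < \<open>L\<close> because 2^c is less than the number of leaves.\<close>

lemma inverse_divisor_bound:
  assumes T: "proper T" "T = Node l ts" and L: "length (leaves T) \<le> L"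
  shows "inverse \<bar>D l (leaves T)\<bar> \<le> 2 * \<gamma> * (2 powr \<tau>) ^ card {m. m < L \<and> small_divisor m T}"
proof (rule ccontr)
  define c where "c = card {m. m < L \<and> small_divisor m T}"
  assume "\<not> ?thesis"
  then have big: "2 * \<gamma> * (2 powr \<tau>) ^ c < inverse \<bar>D (root_label T) (leaves T)\<bar>"
    using T by (simp add: c_def)
  have "small_divisor m T" if "m \<le> c" for m
  proof -
    have "(2 powr \<tau>) ^ m \<le> (2 powr \<tau>) ^ c" using that \<tau> by (intro power_increasing) (auto simp: ge_one_powr_ge_zero)
    then have "2 * \<gamma> * (2 powr \<tau>) ^ m \<le> 2 * \<gamma> * (2 powr \<tau>) ^ c" using \<gamma> by (intro mult_left_mono) auto
    then show ?thesis using big T(2) unfolding small_divisor_def by auto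
  qed
  moreover have "c < L"
  proof -
    have "2 ^ c < length (leaves T)" using small_divisor_large[OF T(1)] calculation by blast
    then show ?thesis using L less_exp[of c] by linarith
  qed
  ultimately have "{..c} \<subseteq> {m. m < L \<and> small_divisor m T}" by auto
  then have "card {..c} \<le> c" unfolding c_def by (intro card_mono) auto
  then show False by simp
qed

text \<open>Each inner node costs a factor 2 gamma, absorbed by the leaves as in
  \<open>kprod_bound_const\<close>, and a factor 2^tau for every scale at which it is small.
  Collecting the latter over the tree gives the sum of the counts.\<close>

lemma kprod_count_bound:
  "proper T \<Longrightarrow> length (leaves T) \<le> L \<Longrightarrow> kprod (\<lambda>l u. inverse \<bar>D l u\<bar>) T * (2 * \<gamma>)
    \<le> (2 * \<gamma>) ^ length (leaves T) * (2 powr \<tau>) ^ (\<Sum>m<L. count_nodes (small_divisor m) T)"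
proof (induction T)
  case (Node l ts)
  let ?K = "\<lambda>l u. inverse \<bar>D l u\<bar>" and ?C = "2 * \<gamma>" and ?b = "2 powr \<tau>"
  let ?B = "{m. m < L \<and> small_divisor m (Node l ts)}"
  let ?N = "\<lambda>T. \<Sum>m<L. count_nodes (small_divisor m) T"
  have C: "1 \<le> ?C" using \<gamma> by simp
  have pn: "0 \<le> prod_list (map (kprod ?K) ts)" by (intro prod_list_nonneg) (auto intro: kprod_nonneg)
  have "kprod ?K (Node l ts) * ?C \<le> ((?C * ?b ^ card ?B) * prod_list (map (kprod ?K) ts)) * ?C"
    using inverse_divisor_bound[OF Node.prems(1) refl Node.prems(2)] C pn
    by (simp only: kprod.simps) (intro mult_right_mono; simp)
  also have "\<dots> = ?b ^ card ?B * (?C ^ 2 * prod_list (map (kprod ?K) ts))" by (simp add: power2_eq_square)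
  also have "\<dots> \<le> ?b ^ card ?B * (?C ^ length ts * prod_list (map (kprod ?K) ts))"
    using C Node.prems pn by (intro mult_left_mono mult_right_mono power_increasing) auto
  also have "?C ^ length ts * prod_list (map (kprod ?K) ts) = prod_list (map (\<lambda>T. kprod ?K T * ?C) ts)"
    by (subst prod_list_map_mult[symmetric]) (simp add: mult.commute)
  also have "\<dots> \<le> prod_list (map (\<lambda>T. ?C ^ length (leaves T) * ?b ^ ?N T) ts)"
  proof (intro prod_list_mono_nonneg)
    fix T assume T: "T \<in> set ts"
    then have "length (leaves T) \<le> L" using length_leaves_child[OF Node.prems(1) T] Node.prems(2) by linarith
    then show "kprod ?K T * ?C \<le> ?C ^ length (leaves T) * ?b ^ ?N T"
      using Node.IH[OF T] Node.prems(1) T by simp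
    show "0 \<le> kprod ?K T * ?C" using C by (intro mult_nonneg_nonneg kprod_nonneg) auto
  qed
  also have "\<dots> = ?C ^ length (leaves (Node l ts)) * ?b ^ sum_list (map ?N ts)"
    unfolding length_leaves_Node
    by (induction ts) (simp_all add: power_add)
  also have "?b ^ card ?B * (?C ^ length (leaves (Node l ts)) * ?b ^ sum_list (map ?N ts))
     = ?C ^ length (leaves (Node l ts)) * ?b ^ (card ?B + sum_list (map ?N ts))"
    by (simp add: power_add)
  also have "card ?B + sum_list (map ?N ts) = ?N (Node l ts)"
  proof -
    have "card ?B = (\<Sum>m<L. if small_divisor m (Node l ts) then 1 else 0)"
      by (subst sum.If_cases) (auto intro: arg_cong[of _ _ card])
    moreover have "sum_list (map ?N ts) = (\<Sum>m<L. sum_list (map (count_nodes (small_divisor m)) ts))"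
      by (induction ts) (simp_all add: sum.distrib)
    ultimately show ?thesis by (simp add: sum.distrib)
  qed
  finally show ?case by (simp add: mult_left_mono)
qed simp

text \<open>The counting argument with q = 2^m allows at most 2 g / 2^m small nodes at scale m,
  where g is the number of leaves. The geometric series in m makes the total independent of the
  number of scales.\<close>

lemma small_divisor_count_bound:
  assumes "proper T"
  shows "(\<Sum>m<L. count_nodes (small_divisor m) T) \<le> 4 * length (leaves T)"
proof -
  let ?g = "real (length (leaves T))"
  have "real (count_nodes (small_divisor m) T) \<le> 2 * ?g * (1/2) ^ m" for m
  proof -
    have "count_nodes (small_divisor m) T * 2 ^ m \<le> 2 * length (leaves T)"
    proof (rule count_nodes_le[OF _ _ assms])
      show "2 ^ m < length (leaves T)" if "proper T" "small_divisor m T" for T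
        using that by (rule small_divisor_large)
      show "length (leaves S) + 2 ^ m \<le> length (leaves (Node l ts))"
        if "proper (Node l ts)" "T \<in> set ts" "S \<in> subtrees T" "small_divisor m (Node l ts)" "small_divisor m S"
        for l ts T S using that by (rule small_divisors_apart)
    qed
    then have "real (count_nodes (small_divisor m) T * 2 ^ m) \<le> real (2 * length (leaves T))"
      by (simp only: of_nat_le_iff)
    then show ?thesis by (simp add: field_simps)
  qed
  then have "real (\<Sum>m<L. count_nodes (small_divisor m) T) \<le> (\<Sum>m<L. 2 * ?g * (1/2) ^ m)"
    by (simp only: of_nat_sum) (intro sum_mono)
  also have "\<dots> = 2 * ?g * (\<Sum>m<L. (1/2) ^ m)" by (simp add: sum_distrib_left)
  also have "\<dots> \<le> 2 * ?g * 2"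
    by (intro mult_left_mono) (auto simp: sum_gp_strict)
  finally show ?thesis by linarith
qed

lemma brjuno_bound:
  obtains C where "1 \<le> C" "\<And>T. proper T \<Longrightarrow> kprod (\<lambda>l u. inverse \<bar>D l u\<bar>) T \<le> C ^ length (leaves T)"
proof
  define C where "C = 2 * \<gamma> * (2 powr \<tau>) ^ 4"
  have b: "1 \<le> 2 powr \<tau>" using \<tau> by (simp add: ge_one_powr_ge_zero)
  show "1 \<le> C" unfolding C_def using \<gamma> one_le_power[OF b, of 4] mult_mono[of 1 "2 * \<gamma>" 1 "(2 powr \<tau>) ^ 4"] by simp
  fix T :: "'n rtree" assume T: "proper T"
  let ?K = "\<lambda>l u. inverse \<bar>D l u\<bar>" and ?g = "length (leaves T)"
  have "kprod ?K T * 1 \<le> kprod ?K T * (2 * \<gamma>)" using \<gamma> by (intro mult_left_mono kprod_nonneg) auto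
  also have "\<dots> \<le> (2 * \<gamma>) ^ ?g * (2 powr \<tau>) ^ (\<Sum>m<?g. count_nodes (small_divisor m) T)"
    by (rule kprod_count_bound[OF T order_refl])
  also have "\<dots> \<le> (2 * \<gamma>) ^ ?g * (2 powr \<tau>) ^ (4 * ?g)"
    using \<gamma> b small_divisor_count_bound[OF T] by (intro mult_left_mono power_increasing) auto
  also have "\<dots> = C ^ ?g" by (simp add: C_def power_mult_distrib power_mult)
  finally show "kprod ?K T \<le> C ^ ?g" by simp
qed

end

section \<open>Bounded solutions of linear equations\<close>

text \<open>The solution of \<open>c' = q - d c\<close> that stays bounded when \<open>q\<close> does: it starts at \<open>0\<close>
  if \<open>Re d \<ge> 0\<close>, and it is determined by its behaviour at infinity otherwise.\<close>

definition lin_solve :: "complex \<Rightarrow> (real \<Rightarrow> complex) \<Rightarrow> real \<Rightarrow> complex" where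
  "lin_solve d q t = exp (- d * of_real t) * (integral {0..t} (\<lambda>s. exp (d * of_real s) * q s) -
     (if 0 \<le> Re d then 0 else lim (\<lambda>n. integral {0..real n} (\<lambda>s. exp (d * of_real s) * q s))))"

context
  fixes d :: complex and q :: "real \<Rightarrow> complex"
  assumes q: "continuous_on {0..} q"
begin

abbreviation Phi :: "real \<Rightarrow> complex" where
  "Phi t \<equiv> integral {0..t} (\<lambda>s. exp (d * of_real s) * q s)"

lemma exp_integral_has_derivative:
  assumes "t \<ge> 0"
  shows "(Phi has_vector_derivative
    exp (d * of_real t) * q t) (at t within {0..})"
proof -
  have "continuous_on {0..t+1} (\<lambda>s. exp (d * of_real s) * q s)"
    by (intro continuous_intros continuous_on_subset[OF q]) auto
  then have "(Phi has_vector_derivative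
    exp (d * of_real t) * q t) (at t within {0..t+1})"
    using assms by (intro integral_has_vector_derivative) auto
  moreover have "at t within {0..t+1} = at t within {0..}"
    by (rule at_within_nhd[of t "{..<t+1}"]) auto
  ultimately show ?thesis by simp
qed

text \<open>The mean value inequality against a primitive of the majorant, so that each estimate
  below needs only a differentiation.\<close>

lemma exp_integral_diff_bound:
  assumes ab: "0 \<le> a" "a \<le> b"
    and \<psi>: "\<And>s. a \<le> s \<Longrightarrow> s \<le> b \<Longrightarrow> (\<Psi> has_real_derivative \<psi> s) (at s)"
    and bound: "\<And>s. a \<le> s \<Longrightarrow> s \<le> b \<Longrightarrow> norm (exp (d * of_real s) * q s) \<le> \<psi> s"
  shows "norm (Phi b - Phi a) \<le> \<Psi> b - \<Psi> a"
proof (cases "a = b")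
  case False
  have der: "(Phi has_vector_derivative
    exp (d * of_real t) * q t) (at t)" if "a < t" for t
    using exp_integral_has_derivative[of t] that ab(1) at_within_interior[of t "{0..}"] by simp
  show ?thesis
  proof (rule differentiable_bound_general)
    show "a < b" using False ab by simp
    show "continuous_on {a..b} Phi"
    proof (rule continuous_on_subset)
      show "continuous_on {0..} Phi"
        unfolding continuous_on_eq_continuous_within
        using has_vector_derivative_continuous[OF exp_integral_has_derivative] by simp
    qed (use ab in auto)
    show "continuous_on {a..b} \<Psi>"
      using \<psi> by (blast intro: DERIV_atLeastAtMost_imp_continuous_on)
    fix s assume s: "a < s" "s < b"
    show "(Phi has_vector_derivative exp (d * of_real s) * q s) (at s)"
      by (rule der[OF s(1)])
    show "(\<Psi> has_vector_derivative \<psi> s) (at s)"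
      using \<psi>[of s] s by (simp add: has_real_derivative_iff_has_vector_derivative)
    show "norm (exp (d * of_real s) * q s) \<le> \<psi> s" using bound[of s] s by simp
  qed
qed simp

text \<open>The integral over [a, b] is at most Q / k * exp (- k a), so the values at integers form
  a Cauchy sequence; letting the right end tend to infinity bounds the tail from t on.\<close>

lemma exp_integral_convergent:
  assumes k: "k > 0" and Q: "\<And>s. s \<ge> 0 \<Longrightarrow> norm (exp (d * of_real s) * q s) \<le> Q * exp (- k * s)"
    and t: "t \<ge> 0"
  shows "norm (Phi t - lim (\<lambda>n. Phi (real n))) \<le> Q / k * exp (- k * t)"
proof -
  have Q0: "0 \<le> Q" using Q[of 0] order_trans[OF norm_ge_zero, of _ Q] by simp
  have bd: "norm (Phi b - Phi a) \<le> Q / k * exp (- k * a)" if "0 \<le> a" "a \<le> b" for a b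
  proof -
    have "norm (Phi b - Phi a) \<le> - (Q / k * exp (- k * b)) - - (Q / k * exp (- k * a))"
    proof (rule exp_integral_diff_bound)
      show "((\<lambda>s. - (Q / k * exp (- k * s))) has_real_derivative Q * exp (- k * s)) (at s)" for s
        using k by (auto intro!: derivative_eq_intros)
    qed (use that Q in auto)
    also have "\<dots> \<le> Q / k * exp (- k * a)" using Q0 k by simp
    finally show ?thesis .
  qed
  have "(\<lambda>n. exp (- k * real n)) \<longlonglongrightarrow> 0"
    using LIMSEQ_realpow_zero[of "exp (- k)"] k by (simp add: exp_of_nat_mult[symmetric] mult.commute)
  then have lim0: "(\<lambda>n. Q / k * exp (- k * real n)) \<longlonglongrightarrow> 0"
    by (rule tendsto_mult_right_zero)
  have "Cauchy (\<lambda>n. Phi (real n))"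
  proof (rule CauchyI')
    fix e :: real assume "0 < e"
    then obtain M where M: "\<And>n. n \<ge> M \<Longrightarrow> Q / k * exp (- k * real n) < e"
      using order_tendstoD(2)[OF lim0] by (auto simp: eventually_sequentially)
    have "norm (Phi (real m) - Phi (real n)) < e" if "m \<ge> M" "n > m" for m n
      using bd[of "real m" "real n"] M[OF that(1)] that by (simp add: norm_minus_commute)
    then show "\<exists>M. \<forall>m\<ge>M. \<forall>n>m. dist (Phi (real m)) (Phi (real n)) < e" unfolding dist_norm by blast
  qed
  then have L: "(\<lambda>n. Phi (real n)) \<longlonglongrightarrow> lim (\<lambda>n. Phi (real n))"
    using Cauchy_convergent convergent_LIMSEQ_iff by blast
  obtain N where N: "real N \<ge> t" using real_arch_simple by blast
  have "(\<lambda>n. norm (Phi t - Phi (real n))) \<longlonglongrightarrow> norm (Phi t - lim (\<lambda>n. Phi (real n)))"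
    by (intro tendsto_intros L)
  moreover have "\<forall>\<^sub>F n in sequentially. norm (Phi t - Phi (real n)) \<le> Q / k * exp (- k * t)"
    using eventually_ge_at_top[of N]
  proof eventually_elim
    case (elim n)
    then show ?case using bd[of t "real n"] t N by (simp add: norm_minus_commute)
  qed
  ultimately show ?thesis by (rule tendsto_upperbound) simp
qed

text \<open>Variation of constants. Any constant in place of \<open>L\<close> gives a solution; the
  choice made affects only its growth.\<close>

lemma lin_solve_has_derivative:
  assumes "t \<ge> 0"
  shows "(lin_solve d q has_vector_derivative q t - d * lin_solve d q t) (at t within {0..})"
proof -
  define L where "L = (if 0 \<le> Re d then 0 else lim (\<lambda>n. Phi (real n)))"
  have "((\<lambda>t. exp (- d * of_real t)) has_vector_derivative - d * exp (- d * of_real t)) (at t within {0..})"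
  proof -
    have "((\<lambda>z. exp (- d * z)) has_field_derivative - d * exp (- d * of_real t)) (at (of_real t))"
      by (auto intro!: derivative_eq_intros)
    then show ?thesis
      by (rule has_vector_derivative_at_within[OF has_vector_derivative_real_field])
  qed
  from has_vector_derivative_mult[OF this has_vector_derivative_diff[OF exp_integral_has_derivative[OF assms] has_vector_derivative_const[of L]]]
  have "((\<lambda>t. exp (- d * of_real t) * (Phi t - L)) has_vector_derivative
     exp (- d * of_real t) * (exp (d * of_real t) * q t - 0) + - d * exp (- d * of_real t) * (Phi t - L)) (at t within {0..})" .
  moreover have "exp (- d * of_real t) * (exp (d * of_real t) * q t - 0) + - d * exp (- d * of_real t) * X = q t - d * (exp (- d * of_real t) * X)" for X
    by (simp add: exp_minus field_simps)
  moreover have eq: "lin_solve d q = (\<lambda>t. exp (- d * of_real t) * (Phi t - L))"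
    by (simp add: lin_solve_def[abs_def] L_def)
  ultimately show ?thesis
    unfolding eq by (simp only:)
qed

text \<open>For Re d > 0 the integral from 0 to t grows no faster than exp (Re d t) / Re d; for Re d
  < 0 the integral from t to infinity decays like exp (Re d t) / |Re d|. The prefactor exp (- d t)
  cancels the exponential in both cases.\<close>

lemma lin_solve_bounded:
  assumes Q: "\<And>t. t \<ge> 0 \<Longrightarrow> norm (q t) \<le> Q" and d: "Re d \<noteq> 0" and t: "t \<ge> 0"
  shows "norm (lin_solve d q t) \<le> inverse \<bar>Re d\<bar> * Q"
proof (cases "Re d > 0")
  case True
  have "norm (Phi t - Phi 0)
    \<le> Q / Re d * exp (Re d * t) - Q / Re d * exp (Re d * 0)"
  proof (rule exp_integral_diff_bound)
    show "((\<lambda>s. Q / Re d * exp (Re d * s)) has_real_derivative Q * exp (Re d * s)) (at s)" for s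
      using True by (auto intro!: derivative_eq_intros)
    show "norm (exp (d * of_real s) * q s) \<le> Q * exp (Re d * s)" if "0 \<le> s" for s
      using Q[OF that] by (simp add: norm_mult mult.commute)
  qed (use t in auto)
  moreover have "0 \<le> Q / Re d" using Q[of 0] order_trans[OF norm_ge_zero, of "q 0" Q] True by simp
  ultimately have "norm (Phi t) \<le> Q / Re d * exp (Re d * t)"
    by simp
  then have "exp (- (Re d * t)) * norm (Phi t) \<le> exp (- (Re d * t)) * (Q / Re d * exp (Re d * t))"
    by (intro mult_left_mono) auto
  also have "\<dots> = Q / Re d" by (simp add: exp_minus)
  finally show ?thesis using True by (simp add: lin_solve_def norm_mult field_simps)
next
  case False
  then have neg: "Re d < 0" using d by simp
  have "norm (Phi t - lim (\<lambda>n. Phi (real n)))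
     \<le> Q / (- Re d) * exp (- (- Re d) * t)"
  proof (rule exp_integral_convergent)
    show "norm (exp (d * of_real s) * q s) \<le> Q * exp (- (- Re d) * s)" if "0 \<le> s" for s
      using Q[OF that] by (simp add: norm_mult mult.commute)
  qed (use neg t in auto)
  then have "exp (- (Re d * t)) * norm (Phi t - lim (\<lambda>n. Phi (real n)))
     \<le> exp (- (Re d * t)) * (Q / (- Re d) * exp (- (- Re d) * t))"
    by (intro mult_left_mono) auto
  also have "\<dots> = inverse \<bar>Re d\<bar> * Q" using neg by (simp add: exp_minus field_simps)
  finally show ?thesis using neg by (simp add: lin_solve_def norm_mult)
qed

text \<open>Integrating from 0 when Re d is nonnegative and from infinity otherwise keeps the kernel
  exp (d (s - t)) at modulus at most 1. What is left is the integral of exp (- a s), hence 1 / a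
  with no divisor.\<close>

lemma lin_solve_bounded_of_decay:
  assumes a: "a > 0" and Q: "\<And>t. t \<ge> 0 \<Longrightarrow> norm (q t) \<le> Q * exp (- a * t)" and t: "t \<ge> 0"
  shows "norm (lin_solve d q t) \<le> inverse a * Q"
proof (cases "Re d \<ge> 0")
  case True
  have Q0: "0 \<le> Q" using Q[of 0] order_trans[OF norm_ge_zero, of _ Q] by simp
  let ?C = "exp (Re d * t) * Q"
  have "norm (Phi t - Phi 0)
    \<le> - (?C / a * exp (- a * t)) - - (?C / a * exp (- a * 0))"
  proof (rule exp_integral_diff_bound)
    show "((\<lambda>s. - (?C / a * exp (- a * s))) has_real_derivative ?C * exp (- a * s)) (at s)" for s
      using a by (auto intro!: derivative_eq_intros)
    show "norm (exp (d * of_real s) * q s) \<le> ?C * exp (- a * s)" if "0 \<le> s" "s \<le> t" for s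
    proof -
      have "exp (Re d * s) * norm (q s) \<le> exp (Re d * t) * (Q * exp (- a * s))"
        using that True Q by (intro mult_mono) (auto intro!: mult_left_mono)
      then show ?thesis by (simp add: norm_mult mult.assoc)
    qed
  qed (use t in auto)
  also have "\<dots> \<le> ?C / a" using Q0 a by simp
  finally have "exp (- (Re d * t)) * norm (Phi t) \<le> exp (- (Re d * t)) * (?C / a)"
    by (intro mult_left_mono) auto
  also have "\<dots> = Q / a" by (simp add: exp_minus)
  finally show ?thesis using True by (simp add: lin_solve_def norm_mult field_simps)
next
  case False
  have Q0: "0 \<le> Q" using Q[of 0] order_trans[OF norm_ge_zero, of _ Q] by simp
  \<comment> \<open>The total decay rate of the integrand; it exceeds a because Re d is negative
    here.\<close>
  define k where "k = a - Re d"
  have k: "k > 0" "a \<le> k" using False a by (auto simp: k_def)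
  have "norm (Phi t - lim (\<lambda>n. Phi (real n)))
     \<le> Q / k * exp (- k * t)"
  proof (rule exp_integral_convergent[OF k(1)])
    show "norm (exp (d * of_real s) * q s) \<le> Q * exp (- k * s)" if "0 \<le> s" for s
    proof -
      have "exp (Re d * s) * norm (q s) \<le> exp (Re d * s) * (Q * exp (- a * s))"
        using Q[OF that] by (intro mult_left_mono) auto
      also have "\<dots> = Q * exp (Re d * s + - a * s)" by (simp only: exp_add mult_ac)
      also have "Re d * s + - a * s = - k * s" by (simp add: k_def algebra_simps)
      finally show ?thesis by (simp add: norm_mult)
    qed
  qed (use t in auto)
  then have "exp (- (Re d * t)) * norm (Phi t - lim (\<lambda>n. Phi (real n)))
     \<le> exp (- (Re d * t)) * (Q / k * exp (- k * t))"
    by (intro mult_left_mono) auto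
  also have "\<dots> = Q / k * exp (- (Re d * t) + - k * t)" by (simp only: exp_add mult_ac)
  also have "- (Re d * t) + - k * t = - a * t" by (simp add: k_def algebra_simps)
  also have "Q / k * exp (- a * t) \<le> Q / a * 1"
    using Q0 a k t by (intro mult_mono divide_left_mono) auto
  finally show ?thesis using False by (simp add: lin_solve_def norm_mult divide_inverse_commute)
qed

end

section \<open>Termwise differentiation of series\<close>

lemma onorm_scaleR_le:
  fixes v :: "'a::real_normed_vector"
  assumes "norm v \<le> b"
  shows "onorm (\<lambda>h. h *\<^sub>R v) \<le> b"
  using assms order_trans[OF norm_ge_zero assms]
  by (intro onorm_bound) (auto simp: mult.commute[of b] intro: mult_left_mono)

text \<open>A finite part \<open>G\<close> is differentiated directly. On the rest the mean value
  inequality bounds the increments by |y - t| times the tail of \<open>b\<close>, and the same tail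
  bounds the missing part of \<open>D\<close>.\<close>

lemma has_vector_derivative_infsum:
  fixes f f' :: "'i \<Rightarrow> real \<Rightarrow> 'b::banach"
  assumes J: "convex J" "t \<in> J"
    and der: "\<And>i s. i \<in> I \<Longrightarrow> s \<in> J \<Longrightarrow> (f i has_vector_derivative f' i s) (at s within J)"
    and bound: "\<And>i s. i \<in> I \<Longrightarrow> s \<in> J \<Longrightarrow> norm (f' i s) \<le> b i"
    and b: "b summable_on I"
    and F: "\<And>s. s \<in> J \<Longrightarrow> ((\<lambda>i. f i s) has_sum F s) I"
    and D: "((\<lambda>i. f' i t) has_sum D) I"
  shows "(F has_vector_derivative D) (at t within J)"
  unfolding has_vector_derivative_def has_derivative_within_alt
proof (intro conjI allI impI)
  show "bounded_linear (\<lambda>x. x *\<^sub>R D)" by (rule bounded_linear_scaleR_left)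
  fix e :: real assume e: "e > 0"
  \<comment> \<open>The tail enters twice, through the increments and through \<open>D\<close>;
    together with e / 2 for the finite part this makes e.\<close>
  obtain G where G: "finite G" "G \<subseteq> I" "dist (sum b G) (infsum b I) \<le> e / 4"
    using infsum_finite_approximation[OF b, of "e / 4"] e by auto
  have bI: "(b has_sum infsum b I) I" using b by simp
  note sub = has_sum_Diff[OF _ has_sum_finite[OF G(1)] G(2)]
  define B where "B = infsum b I - sum b G"
  have B: "(b has_sum B) (I - G)" "B \<le> e / 4"
    using sub[OF bI] order_trans[OF abs_ge_minus_self G(3)[unfolded dist_real_def]] by (auto simp: B_def)
  have "((\<lambda>s. \<Sum>i\<in>G. f i s) has_vector_derivative (\<Sum>i\<in>G. f' i t)) (at t within J)"
    using G J by (intro has_vector_derivative_sum der) auto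
  then obtain \<delta> where \<delta>: "\<delta> > 0" "\<And>y. y \<in> J \<Longrightarrow> norm (y - t) < \<delta> \<Longrightarrow>
      norm ((\<Sum>i\<in>G. f i y) - (\<Sum>i\<in>G. f i t) - (y - t) *\<^sub>R (\<Sum>i\<in>G. f' i t)) \<le> e / 2 * norm (y - t)"
    unfolding has_vector_derivative_def has_derivative_within_alt using half_gt_zero[OF e] by blast
  show "\<exists>d>0. \<forall>y\<in>J. norm (y - t) < d \<longrightarrow> norm (F y - F t - (y - t) *\<^sub>R D) \<le> e * norm (y - t)"
  proof (intro exI[of _ \<delta>] conjI ballI impI \<delta>(1))
    fix y assume y: "y \<in> J" "norm (y - t) < \<delta>"
    have 1: "norm ((F y - F t) - ((\<Sum>i\<in>G. f i y) - (\<Sum>i\<in>G. f i t))) \<le> norm (y - t) * B"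
    proof (rule norm_infsum_le)
      show "((\<lambda>i. f i y - f i t) has_sum (F y - F t) - ((\<Sum>i\<in>G. f i y) - (\<Sum>i\<in>G. f i t))) (I - G)"
        using sub[OF has_sum_diff[OF F[OF y(1)] F[OF J(2)]]] by (simp add: sum_subtractf)
      show "((\<lambda>i. norm (y - t) * b i) has_sum norm (y - t) * B) (I - G)"
        by (intro has_sum_cmult_right B)
      fix i assume i: "i \<in> I - G"
      have "norm (f i y - f i t) \<le> b i * norm (y - t)"
      proof (rule differentiable_bound[OF J(1)])
        show "(f i has_derivative (\<lambda>h. h *\<^sub>R f' i s)) (at s within J)" if "s \<in> J" for s
          using der[of i s] i that by (simp add: has_vector_derivative_def)
        show "onorm (\<lambda>h. h *\<^sub>R f' i s) \<le> b i" if "s \<in> J" for s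
          using bound[of i s] i that by (intro onorm_scaleR_le) auto
      qed (use y J in auto)
      then show "norm (f i y - f i t) \<le> norm (y - t) * b i" by (simp add: mult.commute)
    qed
    have 2: "norm (D - (\<Sum>i\<in>G. f' i t)) \<le> B"
      by (rule norm_infsum_le[OF sub[OF D] B(1)]) (use bound J in auto)
    let ?x = "(F y - F t) - ((\<Sum>i\<in>G. f i y) - (\<Sum>i\<in>G. f i t))"
    let ?z = "(\<Sum>i\<in>G. f i y) - (\<Sum>i\<in>G. f i t) - (y - t) *\<^sub>R (\<Sum>i\<in>G. f' i t)"
    let ?w = "(y - t) *\<^sub>R (D - (\<Sum>i\<in>G. f' i t))"
    have "F y - F t - (y - t) *\<^sub>R D = ?x + ?z - ?w" by (simp add: algebra_simps)
    then have "norm (F y - F t - (y - t) *\<^sub>R D) \<le> norm ?x + norm ?z + norm ?w"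
      by (simp only:) (rule order_trans[OF norm_triangle_ineq4 add_right_mono[OF norm_triangle_ineq]])
    also have "\<dots> \<le> norm (y - t) * B + e / 2 * norm (y - t) + norm (y - t) * B"
      using 1 2 \<delta>(2)[OF y] by (intro add_mono) (auto intro: mult_left_mono)
    also have "\<dots> \<le> norm (y - t) * (e / 4) + e / 2 * norm (y - t) + norm (y - t) * (e / 4)"
      using B(2) e by (intro add_mono mult_left_mono) auto
    finally show "norm (F y - F t - (y - t) *\<^sub>R D) \<le> e * norm (y - t)" by (simp add: algebra_simps)
  qed
qed

section \<open>Near-identity maps and their inverses\<close>

definition word_monomial :: "complex^'n \<Rightarrow> 'n list \<Rightarrow> complex" where
  "word_monomial z w = prod_list (map (\<lambda>k. z $ k) w)"

lemma word_monomial_eq_mi_power: "word_monomial z w = mi_power z (count_list w)"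
proof (induction w)
  case (Cons k w)
  have "mi_power z (count_list (k # w)) = (\<Prod>l\<in>UNIV. (if l = k then z $ l else 1) * (z $ l) ^ count_list w l)"
    unfolding mi_power_def by (intro prod.cong) auto
  also have "\<dots> = z $ k * mi_power z (count_list w)"
    by (simp add: prod.distrib mi_power_def)
  finally show ?case using Cons by (simp add: word_monomial_def del: count_list.simps)
qed (simp add: word_monomial_def mi_power_def)

lemma mi_size_count_list: "mi_size (count_list w) = length w"
proof (induction w)
  case (Cons k w)
  have "mi_size (count_list (k # w)) = (\<Sum>l\<in>UNIV. (if l = k then 1 else 0) + count_list w l)"
    unfolding mi_size_def by (intro sum.cong) auto
  also have "\<dots> = 1 + mi_size (count_list w)" by (simp add: sum.distrib mi_size_def)
  finally show ?case using Cons by (simp del: count_list.simps)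
qed (simp add: mi_size_def)

lemma norm_word_monomial_le: "z \<in> polydisc r \<Longrightarrow> norm (word_monomial z w) \<le> r ^ length w"
  using norm_mi_power_le[of z r "count_list w"] by (simp add: word_monomial_eq_mi_power mi_size_count_list)

lemma word_monomial_concat: "word_monomial z (concat (map leaves ts)) = prod_list (map (\<lambda>T. word_monomial z (leaves T)) ts)"
  by (induction ts) (auto simp: word_monomial_def)

lemma prod_list_map_times: "prod_list (map (\<lambda>x. f x * g x) xs) = prod_list (map f xs) * (prod_list (map g xs) :: 'a::comm_monoid_mult)"
  by (induction xs) (auto simp: mult_ac)

lemma norm_prod_list: "norm (prod_list (map f xs)) = prod_list (map (\<lambda>x. norm (f x :: 'a::real_normed_field)) xs)"
  by (induction xs) (auto simp: norm_mult)

definition word_series :: "('n list \<Rightarrow> complex) \<Rightarrow> complex^'n \<Rightarrow> complex" where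
  "word_series \<eta> z = infsum (\<lambda>w. \<eta> w * word_monomial z w) (lists2 UNIV)"

lemma word_series_majorant:
  fixes \<eta> :: "'n::finite list \<Rightarrow> complex"
  assumes B: "0 \<le> B" and r: "0 \<le> r" "real CARD('n) * B * r \<le> 1/2"
  shows "(\<lambda>w::'n list. (B * r) ^ length w) summable_on lists2 UNIV"
    and "infsum (\<lambda>w::'n list. (B * r) ^ length w) (lists2 UNIV) \<le> 2 * (real CARD('n) * B * r)\<^sup>2"
proof -
  have S: "((\<lambda>_::'n. r) has_sum (real CARD('n) * r)) UNIV" by (intro has_sum_finiteI) auto
  have eq: "(\<lambda>w::'n list. B ^ length w * prod_list (map (\<lambda>_. r) w)) = (\<lambda>w. (B * r) ^ length w)"
    by (simp add: map_replicate_const prod_list_replicate power_mult_distrib)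
  have "B * (real CARD('n) * r) \<le> 1/2" using r(2) by (simp add: mult_ac)
  from list_series[OF S r(1) B this] show
    "(\<lambda>w::'n list. (B * r) ^ length w) summable_on lists2 UNIV"
    "infsum (\<lambda>w::'n list. (B * r) ^ length w) (lists2 UNIV) \<le> 2 * (real CARD('n) * B * r)\<^sup>2"
    unfolding eq by (simp_all add: mult_ac)
qed

context
  fixes \<eta> :: "'n::finite list \<Rightarrow> complex" and B r :: real
  assumes B: "0 \<le> B" and \<eta>: "\<And>w. 2 \<le> length w \<Longrightarrow> norm (\<eta> w) \<le> B ^ length w"
begin

lemma norm_word_series_term:
  assumes "z \<in> polydisc r" "w \<in> lists2 UNIV"
  shows "norm (\<eta> w * word_monomial z w) \<le> (B * r) ^ length w"
  unfolding norm_mult power_mult_distrib using B \<eta>[of w] norm_word_monomial_le[OF assms(1)] assms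
  by (intro mult_mono) (auto simp: lists2_def)

lemma word_series_has_sum:
  assumes "z \<in> polydisc r" "real CARD('n) * B * r \<le> 1/2"
  shows "((\<lambda>w. \<eta> w * word_monomial z w) has_sum word_series \<eta> z) (lists2 UNIV)"
proof -
  have "(\<lambda>w. \<eta> w * word_monomial z w) summable_on lists2 UNIV"
    by (rule abs_summable_summable, rule summable_on_comparison_test
        [OF word_series_majorant(1)[OF B polydisc_nonneg[OF assms(1)] assms(2)]])
       (use norm_word_series_term assms in auto)
  then show ?thesis by (simp add: word_series_def)
qed

lemma norm_word_series_le:
  assumes "z \<in> polydisc r" "real CARD('n) * B * r \<le> 1/2"
  shows "norm (word_series \<eta> z) \<le> 2 * (real CARD('n) * B * r)\<^sup>2"
proof -
  note m = word_series_majorant[OF B polydisc_nonneg[OF assms(1)] assms(2)]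
  have "norm (word_series \<eta> z) \<le> infsum (\<lambda>w::'n list. (B * r) ^ length w) (lists2 UNIV)"
    by (rule norm_infsum_le[OF word_series_has_sum[OF assms] has_sum_infsum[OF m(1)]])
       (use norm_word_series_term assms in auto)
  then show ?thesis using m(2) by linarith
qed

text \<open>The factor r on the left replaces the exponent \<open>length w - 1\<close> on the right,
  so the empty word needs no exception.\<close>

lemma word_monomial_lipschitz:
  assumes "z \<in> polydisc r" "y \<in> polydisc r" "\<And>l. norm (z $ l - y $ l) \<le> \<delta>"
  shows "norm (word_monomial z w - word_monomial y w) * r \<le> real (length w) * r ^ length w * \<delta>"
proof (induction w)
  case (Cons k w)
  have r: "0 \<le> r" using polydisc_nonneg[OF assms(1)] .
  have d: "0 \<le> \<delta>" using order_trans[OF norm_ge_zero assms(3)] .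
  have "word_monomial z (k # w) - word_monomial y (k # w)
    = z $ k * (word_monomial z w - word_monomial y w) + (z $ k - y $ k) * word_monomial y w"
    by (simp add: word_monomial_def algebra_simps)
  then have "norm (word_monomial z (k # w) - word_monomial y (k # w))
    \<le> norm (z $ k) * norm (word_monomial z w - word_monomial y w) + norm (z $ k - y $ k) * norm (word_monomial y w)"
    using norm_triangle_ineq by (metis norm_mult)
  also have "\<dots> \<le> r * norm (word_monomial z w - word_monomial y w) + \<delta> * r ^ length w"
    using assms r d norm_word_monomial_le[OF assms(2)]
    by (intro add_mono mult_mono mult_right_mono) (auto simp: polydisc_def)
  finally have "norm (word_monomial z (k # w) - word_monomial y (k # w)) * r
    \<le> (r * norm (word_monomial z w - word_monomial y w) + \<delta> * r ^ length w) * r"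
    using r by (intro mult_right_mono)
  also have "\<dots> = r * (norm (word_monomial z w - word_monomial y w) * r) + \<delta> * r ^ length (k # w)"
    by (simp add: algebra_simps)
  also have "\<dots> \<le> r * (real (length w) * r ^ length w * \<delta>) + \<delta> * r ^ length (k # w)"
    using Cons r d by (intro add_mono mult_left_mono) auto
  also have "\<dots> = real (length (k # w)) * r ^ length (k # w) * \<delta>" by (simp add: algebra_simps)
  finally show ?case .
qed (simp add: word_monomial_def)

text \<open>The factor \<open>length w\<close> is at most 2^length w, which doubles the radius in
  the majorant. Hence the hypothesis with 4 instead of 2, and the constant 2 (2 n B r)^2 / r with n
  the number of letters.\<close>

lemma word_series_lipschitz:
  assumes z: "z \<in> polydisc r" "y \<in> polydisc r" "\<And>l. norm (z $ l - y $ l) \<le> \<delta>"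
    and r: "0 < r" "4 * real CARD('n) * B * r \<le> 1"
  shows "norm (word_series \<eta> z - word_series \<eta> y) \<le> 8 * (real CARD('n) * B)\<^sup>2 * r * \<delta>"
proof -
  have d: "0 \<le> \<delta>" using order_trans[OF norm_ge_zero z(3)] .
  have h: "real CARD('n) * B * r \<le> 1/2" "real CARD('n) * B * (2 * r) \<le> 1/2" using r B by (auto simp: mult_ac)
  have r2: "0 \<le> 2 * r" using r by simp
  note m = word_series_majorant[OF B r2 h(2)]
  have "norm (word_series \<eta> z - word_series \<eta> y) \<le> infsum (\<lambda>w::'n list. (B * (2 * r)) ^ length w) (lists2 UNIV) * (\<delta> / r)"
  proof (rule norm_infsum_le)
    show "((\<lambda>w. \<eta> w * word_monomial z w - \<eta> w * word_monomial y w) has_sum word_series \<eta> z - word_series \<eta> y) (lists2 UNIV)"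
      by (rule has_sum_diff[OF word_series_has_sum[OF z(1) h(1)] word_series_has_sum[OF z(2) h(1)]])
    show "((\<lambda>w::'n list. (B * (2 * r)) ^ length w * (\<delta> / r)) has_sum infsum (\<lambda>w::'n list. (B * (2 * r)) ^ length w) (lists2 UNIV) * (\<delta> / r)) (lists2 UNIV)"
      by (rule has_sum_cmult_left[OF has_sum_infsum[OF m(1)]])
    fix w :: "'n list" assume w: "w \<in> lists2 UNIV"
    have "norm (\<eta> w * word_monomial z w - \<eta> w * word_monomial y w) = norm (\<eta> w) * norm (word_monomial z w - word_monomial y w)"
      by (simp add: norm_mult[symmetric] algebra_simps)
    also have "\<dots> \<le> B ^ length w * (real (length w) * r ^ length w * \<delta> / r)"
      using word_monomial_lipschitz[OF z, of w] \<eta>[of w] w r B by (intro mult_mono) (auto simp: lists2_def field_simps)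
    also have "\<dots> \<le> B ^ length w * (2 ^ length w * r ^ length w * \<delta> / r)"
      using B r d of_nat_less_two_power[of "length w", where 'a = real]
      by (intro mult_left_mono divide_right_mono mult_right_mono) auto
    also have "\<dots> = (B * (2 * r)) ^ length w * (\<delta> / r)" by (simp add: power_mult_distrib)
    finally show "norm (\<eta> w * word_monomial z w - \<eta> w * word_monomial y w) \<le> (B * (2 * r)) ^ length w * (\<delta> / r)" .
  qed
  also have "\<dots> \<le> 2 * (real CARD('n) * B * (2 * r))\<^sup>2 * (\<delta> / r)"
    using m(2) r d by (intro mult_right_mono) auto
  also have "\<dots> = 8 * (real CARD('n) * B)\<^sup>2 * r * \<delta>"
    using r by (simp add: power2_eq_square field_simps)
  finally show ?thesis .
qed

lemma linear_plus_word_series_analytic: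
  assumes p: "\<And>k. norm (p $ k) < r" and r: "real CARD('n) * B * r \<le> 1/2"
  shows "\<exists>c. has_power_series (\<lambda>z. z $ l + word_series \<eta> z) c p"
proof (rule has_power_series_recenter)
  have r0: "0 \<le> r" using le_less_trans[OF norm_ge_zero p] by (simp add: less_imp_le)
  \<comment> \<open>The linear term joins the series as the one-letter word \<open>[l]\<close>,
    which \<open>lists2 UNIV\<close> does not contain.\<close>
  let ?a = "\<lambda>w. if w = [l] then 1 else \<eta> w"
  have nl: "[l] \<notin> lists2 UNIV" by (simp add: lists2_def)
  have "(\<lambda>w. norm (?a w) * r ^ mi_size (count_list w)) summable_on (lists2 UNIV)"
  proof (rule summable_on_comparison_test[OF word_series_majorant(1)[OF B r0 r]])
    fix w assume "w \<in> lists2 (UNIV :: 'n set)"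
    then show "norm (?a w) * r ^ mi_size (count_list w) \<le> (B * r) ^ length w"
      using \<eta>[of w] r0 unfolding power_mult_distrib
      by (auto simp: lists2_def mi_size_count_list intro!: mult_right_mono)
  qed (use r0 in auto)
  then show "(\<lambda>w. norm (?a w) * r ^ mi_size (count_list w)) summable_on (insert [l] (lists2 UNIV))"
    by (simp add: summable_on_insert_iff)
  show "((\<lambda>w. ?a w * mi_power z (count_list w)) has_sum z $ l + word_series \<eta> z) (insert [l] (lists2 UNIV))"
    if z: "z \<in> polydisc r" for z
  proof -
    have "((\<lambda>w. ?a w * mi_power z (count_list w)) has_sum word_series \<eta> z) (lists2 UNIV)"
      using word_series_has_sum[OF z r] nl
      by (subst has_sum_cong[of _ _ "\<lambda>w. \<eta> w * word_monomial z w"]) (auto simp: word_monomial_eq_mi_power)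
    from has_sum_insert[OF nl this] show ?thesis
      by (simp add: word_monomial_eq_mi_power[symmetric] word_monomial_def del: count_list.simps)
  qed
qed (rule p)

end

section \<open>Inversion by a sum over trees\<close>

lemma tree_unfold:
  fixes u :: "'n rtree \<Rightarrow> 'b::{topological_ab_group_add, t2_space}"
  assumes "((\<lambda>ts. u (Node l ts)) has_sum W) (lists2 {T. proper T})"
  shows "(u has_sum u (Leaf l) + W) {T. proper T \<and> root_label T = l}"
proof -
  have eq: "{T. proper T \<and> root_label T = l} = insert (Leaf l) (Node l ` lists2 {T. proper T})" (is "?A = ?B")
  proof (intro set_eqI iffI)
    fix T assume "T \<in> ?A"
    then show "T \<in> ?B" by (cases T) (auto simp: lists2_def)
  qed (auto simp: lists2_def)
  have "(u has_sum W) (Node l ` lists2 {T. proper T})"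
    using assms by (subst has_sum_reindex) (auto simp: inj_on_def o_def)
  then show ?thesis unfolding eq by (intro has_sum_insert) auto
qed

fun inverse_value :: "('n \<Rightarrow> 'n list \<Rightarrow> complex) \<Rightarrow> 'n rtree \<Rightarrow> complex" where
  "inverse_value \<eta> (Leaf l) = 1"
| "inverse_value \<eta> (Node l ts) = - \<eta> l (map root_label ts) * prod_list (map (inverse_value \<eta>) ts)"

text \<open>Explains the shape of the bound used in both tree inductions. A coefficient at a node
  with k children costs B^k, and the divisors B^2 of the children give back B^(2k). What remains is
  B^(-k), at most B^(-2) as k is at least 2.\<close>

lemma square_power_bound:
  fixes B :: real
  assumes "1 \<le> B" "2 \<le> length ts"
  shows "B ^ length ts * prod_list (map (\<lambda>T. (B\<^sup>2) ^ length (leaves T) / B\<^sup>2) ts)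
    \<le> (B\<^sup>2) ^ length (leaves (Node l ts)) / B\<^sup>2"
proof -
  have eq: "prod_list (map (\<lambda>T. (B\<^sup>2) ^ length (leaves T) / B\<^sup>2) ts) = (B\<^sup>2) ^ length (leaves (Node l ts)) / (B\<^sup>2) ^ length ts"
    by (induction ts) (simp_all add: power_add)
  have "B ^ length ts * B\<^sup>2 \<le> (B\<^sup>2) ^ length ts"
    unfolding power_mult[symmetric] power_add[symmetric] using assms by (intro power_increasing) auto
  then have "B ^ length ts / (B\<^sup>2) ^ length ts \<le> 1 / B\<^sup>2" using assms by (simp add: field_simps)
  then have "(B\<^sup>2) ^ length (leaves (Node l ts)) * (B ^ length ts / (B\<^sup>2) ^ length ts) \<le> (B\<^sup>2) ^ length (leaves (Node l ts)) * (1 / B\<^sup>2)"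
    using assms by (intro mult_left_mono) auto
  then show ?thesis unfolding eq by (simp add: mult_ac)
qed


lemma norm_inverse_value:
  assumes B: "1 \<le> B" and \<eta>: "\<And>l w. 2 \<le> length w \<Longrightarrow> norm (\<eta> l w) \<le> B ^ length w"
  shows "proper T \<Longrightarrow> norm (inverse_value \<eta> T) \<le> (B\<^sup>2) ^ length (leaves T) / B\<^sup>2"
proof (induction T)
  case (Node l ts)
  have "norm (inverse_value \<eta> (Node l ts)) = norm (\<eta> l (map root_label ts)) * prod_list (map (\<lambda>T. norm (inverse_value \<eta> T)) ts)"
    by (simp add: norm_mult norm_prod_list)
  also have "\<dots> \<le> B ^ length ts * prod_list (map (\<lambda>T. (B\<^sup>2) ^ length (leaves T) / B\<^sup>2) ts)"
    using \<eta>[of "map root_label ts" l] Node B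
    by (intro mult_mono prod_list_mono_nonneg prod_list_nonneg) auto
  also have "\<dots> \<le> (B\<^sup>2) ^ length (leaves (Node l ts)) / B\<^sup>2"
    using B Node.prems by (intro square_power_bound) auto
  finally show ?case .
qed (use B in simp)

definition near_identity :: "('n \<Rightarrow> 'n list \<Rightarrow> complex) \<Rightarrow> complex^'n \<Rightarrow> complex^'n" where
  "near_identity \<eta> z = (\<chi> l. z $ l + word_series (\<eta> l) z)"

definition near_identity_inv :: "('n \<Rightarrow> 'n list \<Rightarrow> complex) \<Rightarrow> complex^'n \<Rightarrow> complex^'n" where
  "near_identity_inv \<eta> w = (\<chi> l. infsum (\<lambda>T. inverse_value \<eta> T * word_monomial w (leaves T)) {T. proper T \<and> root_label T = l})"

context
  fixes \<eta> :: "'n::finite \<Rightarrow> 'n list \<Rightarrow> complex" and B :: real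
  assumes B: "1 \<le> B" and \<eta>: "\<And>l w. 2 \<le> length w \<Longrightarrow> norm (\<eta> l w) \<le> B ^ length w"
begin

lemma norm_inverse_term:
  assumes "w \<in> polydisc r" "proper T"
  shows "norm (inverse_value \<eta> T * word_monomial w (leaves T)) \<le> (B\<^sup>2 * r) ^ length (leaves T)"
proof -
  have "(B\<^sup>2) ^ length (leaves T) / B\<^sup>2 \<le> (B\<^sup>2) ^ length (leaves T)"
    using B by (simp add: divide_le_eq mult_le_cancel_left1)
  then have "norm (inverse_value \<eta> T) \<le> (B\<^sup>2) ^ length (leaves T)"
    using norm_inverse_value[where \<eta> = \<eta>, OF B \<eta> assms(2)] by (rule order_trans[rotated])
  then show ?thesis
    unfolding norm_mult power_mult_distrib using norm_word_monomial_le[OF assms(1)]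
    by (intro mult_mono) (use B in auto)
qed

lemma inverse_summable:
  assumes w: "w \<in> polydisc r" and r: "8 * real CARD('n) ^ 2 * (B\<^sup>2 * r) \<le> 1"
  shows "(\<lambda>T. norm (inverse_value \<eta> T * word_monomial w (leaves T))) summable_on {T. proper T}"
    and "infsum (\<lambda>T. norm (inverse_value \<eta> T * word_monomial w (leaves T))) {T. proper T} \<le> 2 * real CARD('n) * (B\<^sup>2 * r)"
proof -
  have x: "0 \<le> B\<^sup>2 * r" using polydisc_nonneg[OF w] by simp
  note ts = tree_series[where 'n = 'n, OF x r]
  show 1: "(\<lambda>T. norm (inverse_value \<eta> T * word_monomial w (leaves T))) summable_on {T. proper T}"
    by (rule summable_on_comparison_test[OF ts(1)]) (use norm_inverse_term[OF w] in auto)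
  show "infsum (\<lambda>T. norm (inverse_value \<eta> T * word_monomial w (leaves T))) {T. proper T} \<le> 2 * real CARD('n) * (B\<^sup>2 * r)"
    by (rule order_trans[OF infsum_mono[OF 1 ts(1)] ts(2)]) (use norm_inverse_term[OF w] in auto)
qed

lemma near_identity_inv_bound:
  assumes w: "w \<in> polydisc r" and r: "8 * real CARD('n) ^ 2 * (B\<^sup>2 * r) \<le> 1"
  shows "near_identity_inv \<eta> w \<in> polydisc (2 * real CARD('n) * (B\<^sup>2 * r))"
  unfolding polydisc_def
proof (intro CollectI allI)
  fix l
  note s = inverse_summable[OF w r]
  have s': "(\<lambda>T. norm (inverse_value \<eta> T * word_monomial w (leaves T))) summable_on {T. proper T \<and> root_label T = l}"
    using s(1) by (rule summable_on_subset_banach) auto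
  have "norm (near_identity_inv \<eta> w $ l) \<le> infsum (\<lambda>T. norm (inverse_value \<eta> T * word_monomial w (leaves T))) {T. proper T \<and> root_label T = l}"
    unfolding near_identity_inv_def vec_lambda_beta by (rule norm_infsum_bound[OF s'])
  also have "\<dots> \<le> infsum (\<lambda>T. norm (inverse_value \<eta> T * word_monomial w (leaves T))) {T. proper T}"
    by (rule infsum_mono2[OF s' s(1)]) auto
  finally show "norm (near_identity_inv \<eta> w $ l) \<le> 2 * real CARD('n) * (B\<^sup>2 * r)" using s(2) by linarith
qed

text \<open>The second condition on \<open>r\<close> brings \<open>B * S\<close> below 1/2, so the
  series may be evaluated at the tree sum z by \<open>tree_substitution\<close>. Its value W is
  minus the contribution of the inner nodes, that is, z = w - W.\<close>

lemma near_identity_inv_right: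
  assumes w: "w \<in> polydisc r" and r: "8 * real CARD('n) ^ 2 * (B\<^sup>2 * r) \<le> 1" "4 * real CARD('n) * B ^ 3 * r \<le> 1"
  shows "near_identity \<eta> (near_identity_inv \<eta> w) = w"
proof -
  let ?u = "\<lambda>T. inverse_value \<eta> T * word_monomial w (leaves T)"
  note s = inverse_summable[OF w r(1)]
  define S where "S = infsum (\<lambda>T. norm (?u T)) {T. proper T}"
  have S: "((\<lambda>T. norm (?u T)) has_sum S) {T. proper T}" using s(1) by (simp add: S_def)
  have "B * S \<le> B * (2 * real CARD('n) * (B\<^sup>2 * r))" using s(2) B by (intro mult_left_mono) (auto simp: S_def)
  also have "\<dots> = (4 * real CARD('n) * B ^ 3 * r) / 2" by (simp add: power2_eq_square power3_eq_cube)
  also have "\<dots> \<le> 1/2" using r(2) by (rule divide_right_mono) simp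
  finally have BS: "B * S \<le> 1/2" .
  have "near_identity_inv \<eta> w $ l + word_series (\<eta> l) (near_identity_inv \<eta> w) = w $ l" for l
  proof -
    \<comment> \<open>\<open>tree_substitution\<close> wants a bound for all words, while \<eta> is
      bounded only on those of length at least 2, the ones that occur in the sums.\<close>
    define \<eta>' where "\<eta>' v = (if 2 \<le> length v then \<eta> l v else 0)" for v
    have \<eta>': "norm (\<eta>' v) \<le> B ^ length v" for v using \<eta> B by (simp add: \<eta>'_def)
    obtain W where W: "((\<lambda>ts. \<eta>' (map root_label ts) * prod_list (map ?u ts)) has_sum W) (lists2 {T. proper T})"
      "((\<lambda>v. \<eta>' v * prod_list (map (\<lambda>k. infsum ?u {T. proper T \<and> root_label T = k}) v)) has_sum W) (lists2 UNIV)"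
      by (rule tree_substitution[OF S \<eta>' _ BS]) (use B in auto)
    have "((\<lambda>ts. ?u (Node l ts)) has_sum - W) (lists2 {T. proper T})"
    proof -
      have "((\<lambda>ts. - (\<eta>' (map root_label ts) * prod_list (map ?u ts))) has_sum - W) (lists2 {T. proper T})"
        using W(1) by (simp add: has_sum_uminus)
      then show ?thesis
        by (rule has_sum_cong[THEN iffD1, rotated])
           (auto simp: \<eta>'_def lists2_def prod_list_map_times word_monomial_concat)
    qed
    \<comment> \<open>A tree with root \<open>l\<close> is the leaf, worth the coordinate of
      \<open>w\<close>, or an inner node over a list of trees.\<close>
    from tree_unfold[OF this] have "near_identity_inv \<eta> w $ l = w $ l - W"
      by (simp add: near_identity_inv_def infsumI word_monomial_def)
    moreover have "word_series (\<eta> l) (near_identity_inv \<eta> w) = W"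
    proof -
      have "((\<lambda>v. \<eta> l v * word_monomial (near_identity_inv \<eta> w) v) has_sum W) (lists2 UNIV)"
        using W(2) by (rule has_sum_cong[THEN iffD1, rotated])
          (auto simp: \<eta>'_def lists2_def word_monomial_def near_identity_inv_def)
      then show ?thesis by (simp add: word_series_def infsumI)
    qed
    ultimately show ?thesis by simp
  qed
  then show ?thesis by (simp add: near_identity_def vec_eq_iff)
qed

lemma near_identity_inv_analytic:
  assumes p: "\<And>k. norm (p $ k) < r" and r: "8 * real CARD('n) ^ 2 * (B\<^sup>2 * r) \<le> 1"
  shows "\<exists>c. has_power_series (\<lambda>w. near_identity_inv \<eta> w $ l) c p"
proof (rule has_power_series_recenter)
  have r0: "0 \<le> r" using le_less_trans[OF norm_ge_zero p] by (simp add: less_imp_le)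
  let ?one = "(\<chi> k. of_real r) :: complex^'n"
  have one: "?one \<in> polydisc r" using r0 by (simp add: polydisc_def)
  have "norm (word_monomial ?one w) = r ^ length w" for w
    using r0 by (induction w) (auto simp: word_monomial_def norm_mult)
  then have "(\<lambda>T. norm (inverse_value \<eta> T) * r ^ mi_size (count_list (leaves T))) summable_on {T. proper T}"
    using inverse_summable(1)[OF one r] by (simp add: norm_mult mi_size_count_list)
  then show "(\<lambda>T. norm (inverse_value \<eta> T) * r ^ mi_size (count_list (leaves T))) summable_on {T. proper T \<and> root_label T = l}"
    by (rule summable_on_subset_banach) auto
  show "((\<lambda>T. inverse_value \<eta> T * mi_power w (count_list (leaves T))) has_sum near_identity_inv \<eta> w $ l) {T. proper T \<and> root_label T = l}"
    if w: "w \<in> polydisc r" for w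
  proof -
    have "(\<lambda>T. inverse_value \<eta> T * word_monomial w (leaves T)) summable_on {T. proper T \<and> root_label T = l}"
      by (rule summable_on_subset_banach[OF abs_summable_summable[OF inverse_summable(1)[OF w r]]]) auto
    then show ?thesis by (simp add: near_identity_inv_def word_monomial_eq_mi_power)
  qed
qed (rule p)

text \<open>On this polydisc the nonlinear part has Lipschitz constant at most 1/2 in the maximum
  norm, so the largest coordinate difference is at most half of itself.\<close>

lemma near_identity_inj:
  assumes z: "z \<in> polydisc r" "y \<in> polydisc r" and eq: "near_identity \<eta> z = near_identity \<eta> y"
    and r: "0 < r" "16 * (real CARD('n) * B)\<^sup>2 * r \<le> 1"
  shows "z = y"
proof -
  have nB: "1 \<le> real CARD('n) * B" using B by (simp add: mult_ge1_I Suc_leI)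
  have r4: "4 * real CARD('n) * B * r \<le> 1"
  proof -
    have "real CARD('n) * B \<le> (real CARD('n) * B)\<^sup>2" by (rule self_le_power[OF nB]) simp
    then have "4 * (real CARD('n) * B) \<le> 16 * (real CARD('n) * B)\<^sup>2" using nB by linarith
    then have "4 * (real CARD('n) * B) * r \<le> 16 * (real CARD('n) * B)\<^sup>2 * r" using r(1) by (intro mult_right_mono) auto
    also have "\<dots> \<le> 1" by (rule r(2))
    finally show ?thesis by (simp only: mult.assoc)
  qed
  define \<delta> where "\<delta> = Max (range (\<lambda>l. norm (z $ l - y $ l)))"
  have \<delta>: "norm (z $ l - y $ l) \<le> \<delta>" for l unfolding \<delta>_def by (intro Max_ge) auto
  have \<delta>0: "0 \<le> \<delta>" using order_trans[OF norm_ge_zero \<delta>] .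
  have "norm (z $ l - y $ l) \<le> \<delta> / 2" for l
  proof -
    have "z $ l + word_series (\<eta> l) z = y $ l + word_series (\<eta> l) y"
      using eq by (simp add: near_identity_def vec_eq_iff)
    then have "z $ l - y $ l = - (word_series (\<eta> l) z - word_series (\<eta> l) y)" by (simp add: algebra_simps)
    then have "norm (z $ l - y $ l) = norm (word_series (\<eta> l) z - word_series (\<eta> l) y)" by (simp only: norm_minus_cancel)
    also have "\<dots> \<le> 8 * (real CARD('n) * B)\<^sup>2 * r * \<delta>"
      by (rule word_series_lipschitz[OF _ \<eta> z \<delta> r(1) r4]) (use B in auto)
    also have "\<dots> = (16 * (real CARD('n) * B)\<^sup>2 * r) * (\<delta> / 2)" by simp
    also have "\<dots> \<le> 1 * (\<delta> / 2)" using r(2) \<delta>0 by (intro mult_right_mono) auto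
    finally show ?thesis by simp
  qed
  then have "\<delta> \<le> \<delta> / 2" unfolding \<delta>_def by (subst Max_le_iff) auto
  then have "norm (z $ l - y $ l) \<le> 0" for l using \<delta>[of l] by linarith
  then show ?thesis by (simp add: vec_eq_iff)
qed

text \<open>The tree sum is a right inverse; it is a left inverse as well because F (N (F z)) = F z
  and F is injective on a polydisc containing both z and N (F z). Injectivity on radius r1 = 4 n B^2
  Rs, with n the dimension, requires 16 (n B)^2 r1 to be at most 1, which is the condition imposed
  on Rs.\<close>

lemma near_identity_coord_change:
  assumes Rs: "0 < Rs" "64 * real CARD('n) ^ 3 * B ^ 4 * Rs \<le> 1"
  shows "near_identity \<eta> ` polydisc Rs \<subseteq> polydisc (2 * Rs)"
    and "analytic_coord_change_on (near_identity \<eta>) (polydisc Rs)"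
proof -
  let ?n = "real CARD('n)"
  have n: "1 \<le> ?n" by (simp add: Suc_leI)
  \<comment> \<open>All weaker smallness conditions follow from the single one, n and
    \<open>B\<close> being at least 1.\<close>
  have mono: "c * ?n ^ i * B ^ j * Rs \<le> c / 64" if "i \<le> 3" "j \<le> 4" "0 \<le> c" for i j c
  proof -
    have "?n ^ i * B ^ j \<le> ?n ^ 3 * B ^ 4" using n B that by (intro mult_mono power_increasing) auto
    then have "c * (?n ^ i * B ^ j) * Rs \<le> c * (?n ^ 3 * B ^ 4) * Rs"
      using Rs that by (intro mult_right_mono mult_left_mono) auto
    also have "\<dots> = c / 64 * (64 * ?n ^ 3 * B ^ 4 * Rs)" by simp
    also have "\<dots> \<le> c / 64 * 1" using Rs that by (intro mult_left_mono) auto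
    finally show ?thesis by (simp add: mult.assoc)
  qed
  note [simp] = power2_eq_square power3_eq_cube
  \<comment> \<open>Analyticity is claimed up to the boundary of closed polydiscs, so convergence is
    secured at twice the radius: 2 Rs for the map, 4 Rs for its inverse on the image.\<close>
  have a1: "?n * B * (2 * Rs) \<le> 1/2" using mono[of 1 1 2] by (simp add: mult_ac)
  have a1': "?n * B * Rs \<le> 1/2" using mono[of 1 1 1] by (simp add: mult_ac)
  have a2: "8 * ?n ^ 2 * (B\<^sup>2 * (4 * Rs)) \<le> 1" using mono[of 2 2 32] by (simp add: mult_ac)
  have a2': "8 * ?n ^ 2 * (B\<^sup>2 * (2 * Rs)) \<le> 1" using mono[of 2 2 16] by (simp add: mult_ac)
  have a3: "4 * ?n * B ^ 3 * (2 * Rs) \<le> 1" using mono[of 1 3 8] by (simp add: mult_ac)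
  define r1 where "r1 = 2 * ?n * (B\<^sup>2 * (2 * Rs))"
  have "1 * 1 \<le> ?n * B\<^sup>2" using n B by (intro mult_mono one_le_power) auto
  then have "Rs * 1 \<le> Rs * (4 * (?n * B\<^sup>2))" using Rs by (intro mult_left_mono) auto
  then have r1: "Rs \<le> r1" "0 < r1" using Rs n B by (auto simp: r1_def mult_ac)
  have a4: "16 * (?n * B)\<^sup>2 * r1 \<le> 1"
    using Rs(2) by (simp add: r1_def mult_ac power4_eq_xxxx)
  have sub: "polydisc s \<subseteq> (polydisc s' :: (complex^'n) set)" if "s \<le> s'" for s s'
    using that by (auto simp: polydisc_def intro: order_trans)
  show im: "near_identity \<eta> ` polydisc Rs \<subseteq> polydisc (2 * Rs)"
  proof (rule image_subsetI)
    fix z :: "complex^'n" assume z: "z \<in> polydisc Rs"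
    have "norm (near_identity \<eta> z $ l) \<le> 2 * Rs" for l
    proof -
      have "norm (near_identity \<eta> z $ l) \<le> norm (z $ l) + norm (word_series (\<eta> l) z)"
        by (simp add: near_identity_def norm_triangle_ineq)
      also have "norm (word_series (\<eta> l) z) \<le> 2 * (?n * B * Rs)\<^sup>2"
        by (rule norm_word_series_le[OF _ \<eta> z a1']) (use B in auto)
      also have "2 * (?n * B * Rs)\<^sup>2 = (2 * ?n ^ 2 * B ^ 2 * Rs) * Rs" by simp
      also have "\<dots> \<le> 1 * Rs" using mono[of 2 2 2] Rs by (intro mult_right_mono) auto
      finally show ?thesis using z by (auto simp: polydisc_def intro: order_trans add_mono)
    qed
    then show "near_identity \<eta> z \<in> polydisc (2 * Rs)" by (simp add: polydisc_def)
  qed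
  show "analytic_coord_change_on (near_identity \<eta>) (polydisc Rs)"
    unfolding analytic_coord_change_on_def
  proof (intro conjI exI[of _ "near_identity_inv \<eta>"] ballI)
    show "mv_analytic_map_on (near_identity \<eta>) (polydisc Rs)"
      unfolding mv_analytic_map_on_def mv_analytic_on_def
    proof (intro allI ballI)
      fix l and p :: "complex^'n" assume p: "p \<in> polydisc Rs"
      have "\<exists>c. has_power_series (\<lambda>z. z $ l + word_series (\<eta> l) z) c p"
        by (rule linear_plus_word_series_analytic[OF _ \<eta> _ a1])
           (use B p Rs in \<open>auto simp: polydisc_def intro: le_less_trans[of _ Rs]\<close>)
      then show "\<exists>c. has_power_series (\<lambda>z. near_identity \<eta> z $ l) c p" by (simp add: near_identity_def)
    qed
    have int: "0 \<in> interior (polydisc s :: (complex^'n) set)" if "0 < s" for s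
      using open_polydisc_subset_interior[of s] that by auto
    show "0 \<in> interior (polydisc Rs :: (complex^'n) set)" by (rule int[OF Rs(1)])
    \<comment> \<open>The radius for which the bound on the inverse is exactly Rs, so that every
      point of \<open>polydisc r2\<close> has a preimage in \<open>polydisc Rs\<close>.\<close>
    define r2 where "r2 = Rs / (2 * ?n * B\<^sup>2)"
    have "1 * 1 \<le> ?n * B\<^sup>2" using n B by (intro mult_mono one_le_power) auto
    then have "1 \<le> 2 * ?n * B\<^sup>2" by linarith
    then have r2: "0 < r2" "r2 \<le> Rs" "2 * ?n * (B\<^sup>2 * r2) = Rs"
      using Rs by (auto simp: r2_def field_simps)
    have "polydisc r2 \<subseteq> near_identity \<eta> ` polydisc Rs"
    proof
      fix w :: "complex^'n" assume w: "w \<in> polydisc r2"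
      have "8 * ?n ^ 2 * (B\<^sup>2 * r2) \<le> 8 * ?n ^ 2 * (B\<^sup>2 * (2 * Rs))" "4 * ?n * B ^ 3 * r2 \<le> 4 * ?n * B ^ 3 * (2 * Rs)"
        using r2 Rs B by (auto intro!: mult_left_mono)
      then have c: "8 * ?n ^ 2 * (B\<^sup>2 * r2) \<le> 1" "4 * ?n * B ^ 3 * r2 \<le> 1" using a2' a3 by linarith+
      have "near_identity_inv \<eta> w \<in> polydisc Rs" using near_identity_inv_bound[OF w c(1)] r2(3) by simp
      then show "w \<in> near_identity \<eta> ` polydisc Rs" using near_identity_inv_right[OF w c] by (metis image_eqI)
    qed
    then show "0 \<in> interior (near_identity \<eta> ` polydisc Rs)" using int[OF r2(1)] interior_mono by blast
    show "mv_analytic_map_on (near_identity_inv \<eta>) (near_identity \<eta> ` polydisc Rs)"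
      unfolding mv_analytic_map_on_def mv_analytic_on_def
    proof (intro allI ballI)
      fix l p assume "p \<in> near_identity \<eta> ` polydisc Rs"
      then have p: "p \<in> polydisc (2 * Rs)" using im by blast
      show "\<exists>c. has_power_series (\<lambda>w. near_identity_inv \<eta> w $ l) c p"
        by (rule near_identity_inv_analytic[OF _ a2])
           (use p Rs in \<open>auto simp: polydisc_def intro: le_less_trans[of _ "2 * Rs"]\<close>)
    qed
    fix z :: "complex^'n" assume z: "z \<in> polydisc Rs"
    then have Fz: "near_identity \<eta> z \<in> polydisc (2 * Rs)" using im by blast
    show "near_identity_inv \<eta> (near_identity \<eta> z) = z"
    proof (rule near_identity_inj[OF _ _ _ r1(2) a4])
      show "near_identity_inv \<eta> (near_identity \<eta> z) \<in> polydisc r1"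
        using near_identity_inv_bound[OF Fz a2'] by (simp only: r1_def)
      show "z \<in> polydisc r1" using z sub[OF r1(1)] by blast
      show "near_identity \<eta> (near_identity_inv \<eta> (near_identity \<eta> z)) = near_identity \<eta> z"
        by (rule near_identity_inv_right[OF Fz a2' a3])
    qed
  qed
qed

end

section \<open>The formal linearization\<close>

text \<open>For a word spelling the multi-index \<alpha> this is (\<alpha> - e_l) . \<Lambda>; see
  \<open>divisor_eq_sum\<close>.\<close>

definition divisor :: "complex^'n \<Rightarrow> 'n \<Rightarrow> 'n list \<Rightarrow> complex" where
  "divisor lam l u = sum_list (map (\<lambda>k. lam $ k) u) - lam $ l"

fun tree_value :: "complex^'n \<Rightarrow> ('n \<Rightarrow> 'n list \<Rightarrow> real \<Rightarrow> complex) \<Rightarrow> 'n rtree \<Rightarrow> real \<Rightarrow> complex" where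
  "tree_value lam \<gamma> (Leaf l) = (\<lambda>t. 1)"
| "tree_value lam \<gamma> (Node l ts) = lin_solve (divisor lam l (leaves (Node l ts)))
     (\<lambda>t. \<gamma> l (map root_label ts) t * prod_list (map (\<lambda>T. tree_value lam \<gamma> T t) ts))"

definition linearization_coeff :: "complex^'n \<Rightarrow> ('n \<Rightarrow> 'n list \<Rightarrow> real \<Rightarrow> complex) \<Rightarrow> real \<Rightarrow> 'n \<Rightarrow> 'n list \<Rightarrow> complex" where
  "linearization_coeff lam \<gamma> t l w = infsum (\<lambda>T. tree_value lam \<gamma> T t) {T. proper T \<and> root_label T = l \<and> leaves T = w}"

lemma continuous_on_prod_list:
  fixes f :: "'a \<Rightarrow> 'b::topological_space \<Rightarrow> 'c::real_normed_field"
  assumes "\<And>x. x \<in> set xs \<Longrightarrow> continuous_on A (f x)"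
  shows "continuous_on A (\<lambda>t. prod_list (map (\<lambda>x. f x t) xs))"
  using assms by (induction xs) (auto intro!: continuous_intros)

lemma word_monomial_linear_flow:
  "word_monomial (linear_flow lam t \<xi>) w = exp (sum_list (map (\<lambda>k. lam $ k) w) * of_real t) * word_monomial \<xi> w"
  by (induction w) (auto simp: word_monomial_def linear_flow_def exp_add algebra_simps)

text \<open>The modulus of each coordinate is a multiple of exp (Re lam_l t), hence monotone, and
  between two times it is at most the larger of its end values.\<close>

lemma linear_flow_polydisc_convex:
  "convex {t. 0 \<le> t \<and> linear_flow lam t \<xi> \<in> polydisc r}"
proof -
  have "x \<in> {t. 0 \<le> t \<and> linear_flow lam t \<xi> \<in> polydisc r}"
    if "a \<in> {t. 0 \<le> t \<and> linear_flow lam t \<xi> \<in> polydisc r}" "b \<in> {t. 0 \<le> t \<and> linear_flow lam t \<xi> \<in> polydisc r}"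
      "a \<le> x" "x \<le> b" for a b x
  proof -
    have "norm (linear_flow lam x \<xi> $ l) \<le> r" for l
    proof -
      have *: "norm (linear_flow lam s \<xi> $ l) = exp (Re (lam $ l) * s) * norm (\<xi> $ l)" for s
        by (simp add: linear_flow_def norm_mult)
      have "Re (lam $ l) * x \<le> max (Re (lam $ l) * a) (Re (lam $ l) * b)"
        using that(3,4) by (cases "0 \<le> Re (lam $ l)") (auto simp: le_max_iff_disj intro: mult_left_mono mult_left_mono_neg)
      then have "norm (linear_flow lam x \<xi> $ l) \<le> max (norm (linear_flow lam a \<xi> $ l)) (norm (linear_flow lam b \<xi> $ l))"
        unfolding * by (auto simp: le_max_iff_disj intro: mult_right_mono)
      then show ?thesis using that(1,2) by (auto simp: polydisc_def intro: order_trans)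
    qed
    then show ?thesis using that by (auto simp: polydisc_def)
  qed
  then show ?thesis unfolding is_interval_convex_1[symmetric] is_interval_1 by blast
qed

text \<open>Common frame of both cases: \<open>\<omega>\<close> is the decay of the nonlinearity and
  \<open>K\<close> the cost of solving one linear equation. They are 1 and the inverse of |Re d| in
  the first case, exp (- a t) and 1 / a in the second.\<close>

locale linearizable_system =
  fixes lam :: "complex^'n::finite" and \<gamma> :: "'n \<Rightarrow> 'n list \<Rightarrow> real \<Rightarrow> complex" and \<omega> :: "real \<Rightarrow> real"
    and K :: "'n \<Rightarrow> 'n list \<Rightarrow> real" and B C :: real
  assumes \<gamma>_cont: "\<And>l w. continuous_on {0..} (\<gamma> l w)"
    and \<gamma>_bound: "\<And>l w t. 2 \<le> length w \<Longrightarrow> 0 \<le> t \<Longrightarrow> norm (\<gamma> l w t) \<le> B ^ length w * \<omega> t"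
    and \<omega>: "\<And>t. 0 \<le> t \<Longrightarrow> 0 \<le> \<omega> t \<and> \<omega> t \<le> 1"
    and K0: "\<And>l u. 0 \<le> K l u"
    and solve: "\<And>l u q Q t. 2 \<le> length u \<Longrightarrow> continuous_on {0..} q \<Longrightarrow>
      (\<And>t. 0 \<le> t \<Longrightarrow> norm (q t) \<le> Q * \<omega> t) \<Longrightarrow> 0 \<le> t \<Longrightarrow>
      norm (lin_solve (divisor lam l u) q t) \<le> K l u * Q"
    and kprod_le: "\<And>T. proper T \<Longrightarrow> kprod K T \<le> C ^ length (leaves T)"
    and B: "1 \<le> B" and C: "1 \<le> C"
begin

abbreviation forcing :: "'n \<Rightarrow> 'n rtree list \<Rightarrow> real \<Rightarrow> complex" where
  "forcing l ts t \<equiv> \<gamma> l (map root_label ts) t * prod_list (map (\<lambda>T. tree_value lam \<gamma> T t) ts)"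

abbreviation weight :: "'n rtree \<Rightarrow> real" where
  "weight T \<equiv> (B\<^sup>2) ^ length (leaves T) / B\<^sup>2"

text \<open>The factor \<open>\<omega> t\<close> is supplied by the coefficient at the root of the
  node alone. The subtrees need only be bounded, and the solution at the node need not decay
  again.\<close>

lemma forcing_bound_aux:
  assumes ts: "2 \<le> length ts" "\<And>T. T \<in> set ts \<Longrightarrow> norm (tree_value lam \<gamma> T t) \<le> kprod K T * weight T" and t: "0 \<le> t"
  shows "norm (forcing l ts t) \<le> (prod_list (map (kprod K) ts) * weight (Node l ts)) * \<omega> t"
proof -
  have "norm (forcing l ts t) = norm (\<gamma> l (map root_label ts) t) * prod_list (map (\<lambda>T. norm (tree_value lam \<gamma> T t)) ts)"
    by (simp add: norm_mult norm_prod_list)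
  also have "\<dots> \<le> (B ^ length ts * \<omega> t) * prod_list (map (\<lambda>T. kprod K T * weight T) ts)"
    using \<gamma>_bound[of "map root_label ts" t l] ts t \<omega>[OF t] B
    by (intro mult_mono prod_list_mono_nonneg prod_list_nonneg) auto
  also have "\<dots> = prod_list (map (kprod K) ts) * (B ^ length ts * prod_list (map weight ts)) * \<omega> t"
    unfolding prod_list_map_times by (simp only: mult_ac)
  also have "\<dots> \<le> prod_list (map (kprod K) ts) * weight (Node l ts) * \<omega> t"
    using \<omega>[OF t] square_power_bound[OF B ts(1), of l]
    by (intro mult_right_mono mult_left_mono prod_list_nonneg) (auto intro: kprod_nonneg K0)
  finally show ?thesis .
qed

text \<open>Continuity is part of the induction because solving the equation at a node requires a
  continuous forcing term.\<close>

lemma tree_value_bound_aux: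
  "proper T \<Longrightarrow> continuous_on {0..} (tree_value lam \<gamma> T) \<and>
    (\<forall>t\<ge>0. norm (tree_value lam \<gamma> T t) \<le> kprod K T * weight T)"
proof (induction T)
  case (Node l ts)
  have ts: "2 \<le> length ts" using Node.prems by simp
  have IH: "continuous_on {0..} (tree_value lam \<gamma> T)" "\<And>t. 0 \<le> t \<Longrightarrow> norm (tree_value lam \<gamma> T t) \<le> kprod K T * weight T"
    if "T \<in> set ts" for T using Node.IH[OF that] Node.prems that by auto
  have cont: "continuous_on {0..} (forcing l ts)"
    by (intro continuous_on_mult \<gamma>_cont continuous_on_prod_list IH)
  have "norm (tree_value lam \<gamma> (Node l ts) t) \<le> K l (leaves (Node l ts)) * (prod_list (map (kprod K) ts) * weight (Node l ts))"
    if "0 \<le> t" for t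
    unfolding tree_value.simps
    by (rule solve[OF length_leaves_ge_2[OF Node.prems] cont _ that]) (intro forcing_bound_aux ts IH)
  moreover have "continuous_on {0..} (tree_value lam \<gamma> (Node l ts))"
    unfolding tree_value.simps continuous_on_eq_continuous_within
    using has_vector_derivative_continuous[OF lin_solve_has_derivative[OF cont]] by simp
  ultimately show ?case by (simp only: kprod.simps mult.assoc) simp
qed (use B in auto)

abbreviation rate :: real where "rate \<equiv> C * B\<^sup>2"

lemma weight_le: "weight T \<le> (B\<^sup>2) ^ length (leaves T)"
  using B by (simp add: divide_le_eq mult_le_cancel_left1)

lemma tree_value_bound:
  assumes "proper T" "0 \<le> t"
  shows "norm (tree_value lam \<gamma> T t) \<le> rate ^ length (leaves T)"
proof -
  have "norm (tree_value lam \<gamma> T t) \<le> kprod K T * weight T" using tree_value_bound_aux[OF assms(1)] assms(2) by blast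
  also have "\<dots> \<le> C ^ length (leaves T) * (B\<^sup>2) ^ length (leaves T)"
    using kprod_le[OF assms(1)] weight_le C by (intro mult_mono) auto
  finally show ?thesis by (simp add: power_mult_distrib)
qed

lemma forcing_bound:
  assumes "proper (Node l ts)" "0 \<le> t"
  shows "norm (forcing l ts t) \<le> rate ^ length (leaves (Node l ts))"
proof -
  have "norm (forcing l ts t) \<le> (prod_list (map (kprod K) ts) * weight (Node l ts)) * \<omega> t"
    using assms tree_value_bound_aux by (intro forcing_bound_aux) auto
  also have "\<dots> \<le> prod_list (map (kprod K) ts) * weight (Node l ts) * 1"
    using \<omega>[OF assms(2)] by (intro mult_left_mono mult_nonneg_nonneg prod_list_nonneg) (auto intro: kprod_nonneg K0)
  also have "\<dots> \<le> C ^ length (leaves (Node l ts)) * (B\<^sup>2) ^ length (leaves (Node l ts)) * 1"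
  proof (intro mult_right_mono mult_mono weight_le)
    have "prod_list (map (kprod K) ts) \<le> prod_list (map (\<lambda>T. C ^ length (leaves T)) ts)"
      using assms by (intro prod_list_mono_nonneg kprod_le kprod_nonneg K0) auto
    then show "prod_list (map (kprod K) ts) \<le> C ^ length (leaves (Node l ts))"
      unfolding prod_list_map_power length_leaves_Node .
  qed (use C in auto)
  finally show ?thesis by (simp add: power_mult_distrib)
qed

lemma tree_value_has_derivative:
  assumes "proper (Node l ts)" "0 \<le> t"
  shows "(tree_value lam \<gamma> (Node l ts) has_vector_derivative
    forcing l ts t - divisor lam l (leaves (Node l ts)) * tree_value lam \<gamma> (Node l ts) t) (at t within {0..})"
proof -
  have "continuous_on {0..} (forcing l ts)"
    using assms tree_value_bound_aux by (intro continuous_on_mult \<gamma>_cont continuous_on_prod_list) auto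
  from lin_solve_has_derivative[OF this assms(2)] show ?thesis by simp
qed

lemma rate_ge_1: "1 \<le> rate" using mult_mono[of 1 C 1 "B\<^sup>2"] B C by simp

lemma tree_term_bound:
  assumes "proper T" "0 \<le> t" "z \<in> polydisc r"
  shows "norm (tree_value lam \<gamma> T t * word_monomial z (leaves T)) \<le> (rate * r) ^ length (leaves T)"
  unfolding norm_mult power_mult_distrib[of rate]
  using tree_value_bound[OF assms(1,2)] norm_word_monomial_le[OF assms(3)] rate_ge_1 by (intro mult_mono) auto

lemma tree_terms_summable:
  assumes z: "z \<in> polydisc r" and r: "8 * real CARD('n) ^ 2 * (rate * r) \<le> 1" and t: "0 \<le> t"
  shows "(\<lambda>T. norm (tree_value lam \<gamma> T t * word_monomial z (leaves T))) summable_on {T. proper T}"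
    and "infsum (\<lambda>T. norm (tree_value lam \<gamma> T t * word_monomial z (leaves T))) {T. proper T} \<le> 2 * real CARD('n) * (rate * r)"
proof -
  have x: "0 \<le> rate * r" using polydisc_nonneg[OF z] rate_ge_1 by simp
  note ts = tree_series[where 'n = 'n, OF x r]
  show 1: "(\<lambda>T. norm (tree_value lam \<gamma> T t * word_monomial z (leaves T))) summable_on {T. proper T}"
    by (rule summable_on_comparison_test[OF ts(1)]) (use tree_term_bound[OF _ t z] in auto)
  show "infsum (\<lambda>T. norm (tree_value lam \<gamma> T t * word_monomial z (leaves T))) {T. proper T} \<le> 2 * real CARD('n) * (rate * r)"
    by (rule order_trans[OF infsum_mono[OF 1 ts(1)] ts(2)]) (use tree_term_bound[OF _ t z] in auto)
qed

text \<open>Evaluating the tree series at the largest admissible x bounds x^(length w) times the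
  number of trees with leaf word \<open>w\<close>, without enumerating them.\<close>

lemma linearization_coeff_bound:
  assumes "0 \<le> t"
  shows "(\<lambda>T. tree_value lam \<gamma> T t) summable_on {T. proper T \<and> root_label T = l \<and> leaves T = w}"
    and "norm (linearization_coeff lam \<gamma> t l w) \<le> (8 * real CARD('n) ^ 2 * rate) ^ length w"
proof -
  let ?n = "real CARD('n)"
  define x where "x = 1 / (8 * ?n ^ 2)"
  have n: "1 \<le> ?n" by (simp add: Suc_leI)
  have x: "0 < x" "8 * ?n ^ 2 * x \<le> 1" using n by (auto simp: x_def)
  let ?A = "{T. proper T \<and> root_label T = l \<and> leaves T = w}"
  note ts = tree_series[where 'n = 'n, OF less_imp_le[OF x(1)] x(2)]
  define S where "S = infsum (\<lambda>T. x ^ length (leaves T)) ?A"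
  have sA: "(\<lambda>T. x ^ length (leaves T)) summable_on ?A" by (rule summable_on_subset_banach[OF ts(1)]) auto
  have "S \<le> infsum (\<lambda>T :: 'n rtree. x ^ length (leaves T)) {T. proper T}"
    unfolding S_def by (rule infsum_mono2[OF sA ts(1)]) (use x in auto)
  also have "\<dots> \<le> 2 * ?n * x" by (rule ts(2))
  also have "2 * ?n * x = 1 / (4 * ?n)" by (simp add: x_def power2_eq_square)
  also have "\<dots> \<le> 1" using n by (simp only: divide_le_eq_1) linarith
  finally have S: "S \<le> 1" .
  have bd: "norm (tree_value lam \<gamma> T t) \<le> (rate / x) ^ length w * x ^ length (leaves T)" if "T \<in> ?A" for T
    using tree_value_bound[of T t] that assms x by (auto simp: power_divide)
  have hs: "((\<lambda>T. (rate / x) ^ length w * x ^ length (leaves T)) has_sum (rate / x) ^ length w * S) ?A"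
    unfolding S_def by (intro has_sum_cmult_right has_sum_infsum sA)
  show 1: "(\<lambda>T. tree_value lam \<gamma> T t) summable_on ?A"
    by (rule abs_summable_summable, rule summable_on_comparison_test[OF has_sum_imp_summable[OF hs] bd]) auto
  have "norm (linearization_coeff lam \<gamma> t l w) \<le> (rate / x) ^ length w * S"
    unfolding linearization_coeff_def by (rule norm_infsum_le[OF has_sum_infsum[OF 1] hs bd])
  also have "\<dots> \<le> (rate / x) ^ length w * 1" using S rate_ge_1 x by (intro mult_left_mono zero_le_power) auto
  finally show "norm (linearization_coeff lam \<gamma> t l w) \<le> (8 * ?n ^ 2 * rate) ^ length w" by (simp add: x_def mult_ac)
qed

text \<open>Links two views of one series: by words it is a near-identity map, to which inversion
  applies; by trees it can be differentiated term by term.\<close>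

lemma linearization_has_sum:
  assumes z: "z \<in> polydisc r" and r: "8 * real CARD('n) ^ 2 * (rate * r) \<le> 1" and t: "0 \<le> t"
  shows "((\<lambda>T. tree_value lam \<gamma> T t * word_monomial z (leaves T)) has_sum
    near_identity (linearization_coeff lam \<gamma> t) z $ l) {T. proper T \<and> root_label T = l}"
proof -
  let ?u = "\<lambda>T. tree_value lam \<gamma> T t * word_monomial z (leaves T)"
  let ?A = "\<lambda>w. {T. proper T \<and> root_label T = l \<and> leaves T = w}"
  let ?N = "{T. proper T \<and> root_label T = l \<and> 2 \<le> length (leaves T)}"
  have eq: "{T. proper T \<and> root_label T = l} = insert (Leaf l) ?N" (is "?L = ?R")
  proof (intro set_eqI iffI)
    fix T assume "T \<in> ?L"
    then show "T \<in> ?R" using length_leaves_ge_2 by (cases T) auto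
  qed auto
  have bij: "bij_betw snd (Sigma (lists2 UNIV) ?A) ?N"
    by (rule bij_betwI[of _ _ _ "\<lambda>T. (leaves T, T)"]) (auto simp: lists2_def)
  have sN: "?u summable_on ?N"
    by (rule summable_on_subset_banach[OF abs_summable_summable[OF tree_terms_summable(1)[OF z r t]]]) auto
  then have "(?u has_sum infsum ?u ?N) ?N" by simp
  then have "((\<lambda>(w, T). ?u T) has_sum infsum ?u ?N) (Sigma (lists2 UNIV) ?A)"
    using has_sum_reindex_bij_betw[OF bij, of ?u] by (simp add: case_prod_unfold)
  then have "((\<lambda>w. linearization_coeff lam \<gamma> t l w * word_monomial z w) has_sum infsum ?u ?N) (lists2 UNIV)"
  proof (rule has_sum_SigmaD)
    fix w
    have "((\<lambda>T. tree_value lam \<gamma> T t * word_monomial z w) has_sum linearization_coeff lam \<gamma> t l w * word_monomial z w) (?A w)"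
      unfolding linearization_coeff_def
      by (intro has_sum_cmult_left has_sum_infsum linearization_coeff_bound(1) t)
    also have "?this \<longleftrightarrow> ((\<lambda>y. case (w, y) of (w, T) \<Rightarrow> ?u T) has_sum linearization_coeff lam \<gamma> t l w * word_monomial z w) (?A w)"
      by (intro has_sum_cong) auto
    finally show "((\<lambda>y. case (w, y) of (w, T) \<Rightarrow> ?u T) has_sum linearization_coeff lam \<gamma> t l w * word_monomial z w) (?A w)" .
  qed
  then have "word_series (linearization_coeff lam \<gamma> t l) z = infsum ?u ?N"
    by (simp add: word_series_def infsumI)
  moreover have "(?u has_sum ?u (Leaf l) + infsum ?u ?N) (insert (Leaf l) ?N)"
    by (intro has_sum_insert has_sum_infsum sN) auto
  ultimately show ?thesis unfolding eq by (simp add: near_identity_def word_monomial_def)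
qed

text \<open>Along the linear flow a monomial has derivative \<Lambda>_w times itself, \<Lambda>_w
  being the sum of the eigenvalues of its letters, and the equation for its coefficient contributes
  minus the divisor. Their sum is lam_l, so every tree yields lam_l times its term plus its forcing;
  the forcings add up to the nonlinearity at x by \<open>tree_substitution\<close>.\<close>

lemma linearization_solves:
  fixes \<xi> :: "complex^'n"
  assumes r: "0 < r" "8 * real CARD('n) ^ 2 * (rate * r) \<le> 1" "4 * real CARD('n) * B * (rate * r) \<le> 1"
  defines "J \<equiv> {t. 0 \<le> t \<and> linear_flow lam t \<xi> \<in> polydisc r}"
    and "x \<equiv> \<lambda>t. near_identity (linearization_coeff lam \<gamma> t) (linear_flow lam t \<xi>)"
  assumes t: "t \<in> J"
  shows "((\<lambda>t. x t $ l) has_vector_derivative lam $ l * x t $ l + word_series (\<lambda>w. \<gamma> l w t) (x t)) (at t within J)"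
proof (rule has_vector_derivative_infsum)
  let ?I = "{T. proper T \<and> root_label T = l}"
  let ?m = "\<lambda>T s. word_monomial (linear_flow lam s \<xi>) (leaves T)"
  let ?u = "\<lambda>T s. tree_value lam \<gamma> T s * ?m T s"
  \<comment> \<open>Leaves have a constant coefficient and no forcing.\<close>
  define q where "q T s = (case T of Leaf l \<Rightarrow> 0 | Node l ts \<Rightarrow> forcing l ts s)" for T s
  let ?f' = "\<lambda>T s. lam $ l * ?u T s + q T s * ?m T s"
  let ?b = "\<lambda>T. (norm (lam $ l) + 1) * (rate * r) ^ length (leaves T)"
  have J: "0 \<le> s" "linear_flow lam s \<xi> \<in> polydisc r" if "s \<in> J" for s using that by (auto simp: J_def)
  show "convex J" unfolding J_def by (rule linear_flow_polydisc_convex)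
  show "t \<in> J" by (rule t)
  have Er: "0 \<le> rate * r" using rate_ge_1 r by simp
  show "?b summable_on ?I"
    by (intro summable_on_cmult_right summable_on_subset_banach[OF tree_series(1)[OF Er r(2)]]) auto
  show "((\<lambda>T. ?u T s) has_sum x s $ l) ?I" if "s \<in> J" for s
    unfolding x_def by (rule linearization_has_sum[OF J(2)[OF that] r(2) J(1)[OF that]])
  show "norm (?f' T s) \<le> ?b T" if T: "T \<in> ?I" and s: "s \<in> J" for T s
  proof -
    have "norm (q T s) \<le> rate ^ length (leaves T)"
      using T forcing_bound[OF _ J(1)[OF s]] rate_ge_1 by (cases T) (auto simp: q_def)
    then have "norm (q T s * ?m T s) \<le> (rate * r) ^ length (leaves T)"
      unfolding norm_mult power_mult_distrib[of rate] using norm_word_monomial_le[OF J(2)[OF s]] rate_ge_1 by (intro mult_mono) auto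
    moreover have "norm (lam $ l * ?u T s) \<le> norm (lam $ l) * (rate * r) ^ length (leaves T)"
      unfolding norm_mult[of "lam $ l"] using tree_term_bound[OF _ J(1,2)[OF s]] T by (intro mult_left_mono) auto
    ultimately show ?thesis using norm_triangle_ineq[of "lam $ l * ?u T s" "q T s * ?m T s"] by (simp add: algebra_simps)
  qed
  show "(?u T has_vector_derivative ?f' T s) (at s within J)" if T: "T \<in> ?I" and s: "s \<in> J" for T s
  proof -
    let ?\<Lambda> = "sum_list (map (\<lambda>k. lam $ k) (leaves T))"
    have m: "(?m T has_vector_derivative ?\<Lambda> * ?m T s) (at s within J)"
    proof -
      have "((\<lambda>z. exp (?\<Lambda> * z) * word_monomial \<xi> (leaves T)) has_field_derivative
          ?\<Lambda> * (exp (?\<Lambda> * of_real s) * word_monomial \<xi> (leaves T))) (at (of_real s))"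
        by (auto intro!: derivative_eq_intros)
      then show ?thesis
        unfolding word_monomial_linear_flow by (rule has_vector_derivative_at_within[OF has_vector_derivative_real_field])
    qed
    show ?thesis
    proof (cases T)
      case (Leaf k)
      then show ?thesis using m T by (simp add: q_def)
    next
      case (Node k ts)
      then have k: "k = l" "proper (Node l ts)" using T by auto
      have "(tree_value lam \<gamma> T has_vector_derivative forcing l ts s - divisor lam l (leaves T) * tree_value lam \<gamma> T s) (at s within J)"
        unfolding Node k using tree_value_has_derivative[OF k(2) J(1)[OF s]]
        by (rule has_vector_derivative_within_subset) (auto simp: J_def)
      from has_vector_derivative_mult[OF this m] show ?thesis
        by (rule has_vector_derivative_eq_rhs)
           (simp add: Node k q_def divisor_def algebra_simps)
    qed
  qed
  show "((\<lambda>T. ?f' T t) has_sum lam $ l * x t $ l + word_series (\<lambda>w. \<gamma> l w t) (x t)) ?I"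
  proof (intro has_sum_add has_sum_cmult_right)
    show hs: "((\<lambda>T. ?u T t) has_sum x t $ k) {T. proper T \<and> root_label T = k}" for k
      unfolding x_def by (rule linearization_has_sum[OF J(2)[OF t] r(2) J(1)[OF t]])
    note sm = tree_terms_summable[OF J(2)[OF t] r(2) J(1)[OF t]]
    define S where "S = infsum (\<lambda>T. norm (?u T t)) {T. proper T}"
    have S: "((\<lambda>T. norm (?u T t)) has_sum S) {T. proper T}" using sm(1) by (simp add: S_def)
    have "B * S \<le> B * (2 * real CARD('n) * (rate * r))" using sm(2) B by (intro mult_left_mono) (auto simp: S_def)
    also have "\<dots> = (4 * real CARD('n) * B * (rate * r)) / 2" by simp
    also have "\<dots> \<le> 1 / 2" using r(3) by (rule divide_right_mono) simp
    finally have BS: "B * S \<le> 1/2" .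
    define \<gamma>' where "\<gamma>' v = (if 2 \<le> length v then \<gamma> l v t else 0)" for v
    have \<gamma>': "norm (\<gamma>' v) \<le> B ^ length v" for v
    proof (cases "2 \<le> length v")
      case True
      have "norm (\<gamma> l v t) \<le> B ^ length v * \<omega> t" by (rule \<gamma>_bound[OF True J(1)[OF t]])
      also have "\<dots> \<le> B ^ length v * 1" using \<omega>[OF J(1)[OF t]] B by (intro mult_left_mono) auto
      finally show ?thesis using True by (simp add: \<gamma>'_def)
    qed (use B in \<open>simp add: \<gamma>'_def\<close>)
    obtain W where W: "((\<lambda>ts. \<gamma>' (map root_label ts) * prod_list (map (\<lambda>T. ?u T t) ts)) has_sum W) (lists2 {T. proper T})"
      "((\<lambda>v. \<gamma>' v * prod_list (map (\<lambda>k. infsum (\<lambda>T. ?u T t) {T. proper T \<and> root_label T = k}) v)) has_sum W) (lists2 UNIV)"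
      by (rule tree_substitution[OF S \<gamma>' _ BS]) (use B in auto)
    have "((\<lambda>ts. q (Node l ts) t * ?m (Node l ts) t) has_sum W) (lists2 {T. proper T})"
      using W(1) by (rule has_sum_cong[THEN iffD1, rotated])
        (auto simp: \<gamma>'_def q_def lists2_def prod_list_map_times word_monomial_concat)
    from tree_unfold[OF this] have "((\<lambda>T. q T t * ?m T t) has_sum W) ?I" by (simp add: q_def)
    moreover have "word_series (\<lambda>w. \<gamma> l w t) (x t) = W"
    proof -
      have "((\<lambda>v. \<gamma> l v t * word_monomial (x t) v) has_sum W) (lists2 UNIV)"
        using W(2) by (rule has_sum_cong[THEN iffD1, rotated])
          (auto simp: \<gamma>'_def lists2_def word_monomial_def[of "x t"] infsumI[OF hs])
      then show ?thesis by (simp add: word_series_def infsumI)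
    qed
    ultimately show "((\<lambda>T. q T t * ?m T t) has_sum word_series (\<lambda>w. \<gamma> l w t) (x t)) ?I" by simp
  qed
qed

end

section \<open>Taylor series of the nonlinearity\<close>

lemma taylor_coeff_power_series:
  fixes F :: "complex^'m::finite \<Rightarrow> complex"
  assumes "mv_analytic_on F (interior (polydisc R))" "0 < R"
  shows "has_power_series F (taylor_coeff F) 0"
proof -
  have "0 \<in> interior (polydisc R :: (complex^'m) set)"
    using open_polydisc_subset_interior[of R] assms(2) by auto
  then obtain c where c: "has_power_series F c 0" using assms(1) by (auto simp: mv_analytic_on_def)
  show ?thesis
    unfolding taylor_coeff_def by (rule theI[where a = c]) (use c power_series_coeffs_unique in blast)+
qed

lemma taylor_norm_bound:
  fixes F :: "complex^'m::finite \<Rightarrow> complex"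
  assumes "taylor_norm R F \<le> ennreal M" "0 \<le> M" "0 < R"
  shows "(\<lambda>\<alpha>. norm (taylor_coeff F \<alpha>) * R ^ mi_size \<alpha>) summable_on UNIV"
    and "infsum (\<lambda>\<alpha>. norm (taylor_coeff F \<alpha>) * R ^ mi_size \<alpha>) UNIV \<le> M"
proof -
  let ?f = "\<lambda>\<alpha>. norm (taylor_coeff F \<alpha>) * R ^ mi_size \<alpha>"
  have nn: "0 \<le> ?f \<alpha>" for \<alpha> using assms by simp
  have fin: "sum ?f X \<le> M" if "finite X" for X
  proof -
    have "ennreal (sum ?f X) = (\<Sum>\<alpha>\<in>X. ennreal (?f \<alpha>))" using nn by (simp add: sum_ennreal)
    also have "\<dots> \<le> taylor_norm R F"
      unfolding taylor_norm_def using that by (subst nonneg_infsum_complete) (auto intro!: SUP_upper)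
    also have "\<dots> \<le> ennreal M" by (rule assms(1))
    finally show ?thesis using assms(2) by (simp add: ennreal_le_iff)
  qed
  show 1: "?f summable_on UNIV"
    by (rule nonneg_bdd_above_summable_on) (use nn fin in \<open>auto intro!: bdd_aboveI2\<close>)
  show "infsum ?f UNIV \<le> M" by (rule infsum_le_finite_sums[OF 1 fin])
qed

lemma mi_size_case_sum: "mi_size (case_sum \<alpha> \<beta>) = mi_size \<alpha> + mi_size \<beta>"
  unfolding mi_size_def UNIV_Plus_UNIV[symmetric] by (subst sum.Plus) auto

lemma mi_power_case_sum:
  fixes x y :: "complex^'n::finite"
  shows "mi_power (\<chi> i. case i of Inl k \<Rightarrow> x $ k | Inr k \<Rightarrow> y $ k) (case_sum \<alpha> \<beta>) = mi_power x \<alpha> * mi_power y \<beta>"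
  unfolding mi_power_def UNIV_Plus_UNIV[symmetric] by (subst prod.Plus) auto

lemma y_dot_axis:
  "y_dot gt (\<chi> i. case i of Inl k \<Rightarrow> x $ k | Inr k \<Rightarrow> axis l c $ k) t = c * gt x t $ l"
proof -
  have "y_dot gt (\<chi> i. case i of Inl k \<Rightarrow> x $ k | Inr k \<Rightarrow> axis l c $ k) t = (\<Sum>k\<in>UNIV. if k = l then c * gt x t $ k else 0)"
    unfolding y_dot_def by (intro sum.cong) (auto simp: axis_def)
  then show ?thesis by simp
qed

text \<open>At y = (R/2) e_l the function y . g equals (R/2) g_l, whence the factor 2 / R. Summing
  the double series over the y-indices first leaves a series in x. The value R/2 keeps y strictly
  inside, where the Taylor series is known to represent the function.\<close>

lemma component_power_series:
  fixes gt :: "complex^'n::finite \<Rightarrow> real \<Rightarrow> complex^'n"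
  assumes R: "0 < R" and an: "(\<lambda>z. y_dot gt z t) \<in> frakC R"
    and M: "taylor_norm R (\<lambda>z. y_dot gt z t) \<le> ennreal M" "0 \<le> M"
  shows "\<exists>G. \<forall>l. (\<lambda>\<alpha>. norm (G l \<alpha>) * R ^ mi_size \<alpha>) summable_on UNIV
    \<and> infsum (\<lambda>\<alpha>. norm (G l \<alpha>) * R ^ mi_size \<alpha>) UNIV \<le> 2 / R * M
    \<and> (\<forall>x. (\<forall>k. norm (x $ k) < R) \<longrightarrow> ((\<lambda>\<alpha>. G l \<alpha> * mi_power x \<alpha>) has_sum gt x t $ l) UNIV)"
proof -
  define F where "F = (\<lambda>z. y_dot gt z t)"
  define c where "c = taylor_coeff F"
  have anF: "mv_analytic_on F (interior (polydisc R))" using an by (simp add: frakC_def F_def)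
  have ps: "has_power_series F c 0" unfolding c_def by (rule taylor_coeff_power_series[OF anF R])
  have s: "(\<lambda>\<alpha>. norm (c \<alpha>) * R ^ mi_size \<alpha>) summable_on UNIV" "infsum (\<lambda>\<alpha>. norm (c \<alpha>) * R ^ mi_size \<alpha>) UNIV \<le> M"
    using taylor_norm_bound[of R F M] M R by (auto simp: c_def F_def)
  \<comment> \<open>A multi-index over the sum type is a pair of multi-indices, one for x and one
    for y.\<close>
  have bij: "bij_betw (\<lambda>(\<alpha>, \<beta>). case_sum \<alpha> \<beta>) (UNIV \<times> UNIV) (UNIV :: ('n + 'n \<Rightarrow> nat) set)"
    by (rule bij_betwI[of _ _ _ "\<lambda>\<alpha>. (\<alpha> \<circ> Inl, \<alpha> \<circ> Inr)"]) (auto simp: fun_eq_iff split: sum.split)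
  define y where "y l = (axis l (of_real (R / 2)) :: complex^'n)" for l
  have y: "y l \<in> polydisc R" "norm (y l $ k) < R" for l k using R by (auto simp: y_def axis_def polydisc_def)
  define G where "G l \<alpha> = 2 / of_real R * infsum (\<lambda>\<beta>. c (case_sum \<alpha> \<beta>) * mi_power (y l) \<beta>) UNIV" for l \<alpha>
  define m where "m = (\<lambda>(\<alpha>, \<beta>). norm (c (case_sum \<alpha> \<beta>)) * R ^ (mi_size \<alpha> + mi_size \<beta>))"
  have m: "(m has_sum infsum (\<lambda>\<alpha>. norm (c \<alpha>) * R ^ mi_size \<alpha>) UNIV) (UNIV \<times> UNIV)"
    using has_sum_reindex_bij_betw[OF bij, of "\<lambda>\<alpha>. norm (c \<alpha>) * R ^ mi_size \<alpha>"] s(1)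
    by (simp add: m_def case_prod_unfold mi_size_case_sum)
  have m1: "(\<lambda>\<beta>. m (\<alpha>, \<beta>)) summable_on UNIV" for \<alpha>
  proof -
    have "(\<lambda>(\<alpha>, \<beta>). m (\<alpha>, \<beta>)) summable_on UNIV \<times> UNIV" using m by (auto intro: has_sum_imp_summable)
    then show ?thesis by (rule summable_on_SigmaD1) auto
  qed
  define H where "H \<alpha> = infsum (\<lambda>\<beta>. m (\<alpha>, \<beta>)) UNIV" for \<alpha>
  have H: "(H has_sum infsum (\<lambda>\<alpha>. norm (c \<alpha>) * R ^ mi_size \<alpha>) UNIV) UNIV"
    by (rule has_sum_SigmaD[OF m]) (use m1 in \<open>simp add: H_def\<close>)
  have tb: "norm (c (case_sum \<alpha> \<beta>) * mi_power (y l) \<beta>) * R ^ mi_size \<alpha> \<le> m (\<alpha>, \<beta>)" for \<alpha> \<beta> l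
  proof -
    have "norm (c (case_sum \<alpha> \<beta>)) * norm (mi_power (y l) \<beta>) * R ^ mi_size \<alpha> \<le> norm (c (case_sum \<alpha> \<beta>)) * R ^ mi_size \<beta> * R ^ mi_size \<alpha>"
      using R by (intro mult_right_mono mult_left_mono norm_mi_power_le y) auto
    then show ?thesis by (simp add: m_def norm_mult power_add mult_ac)
  qed
  have cs: "(\<lambda>\<beta>. c (case_sum \<alpha> \<beta>) * mi_power (y l) \<beta>) summable_on UNIV" for \<alpha> l
  proof -
    have "(\<lambda>\<beta>. norm (c (case_sum \<alpha> \<beta>) * mi_power (y l) \<beta>) * R ^ mi_size \<alpha>) summable_on UNIV"
      by (rule summable_on_comparison_test[OF m1[of \<alpha>] tb]) (use R in auto)
    from summable_on_cmult_left[OF this, of "inverse (R ^ mi_size \<alpha>)"]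
    have "(\<lambda>\<beta>. norm (c (case_sum \<alpha> \<beta>) * mi_power (y l) \<beta>)) summable_on UNIV"
      using R by (simp add: mult.assoc)
    then show ?thesis by (rule abs_summable_summable)
  qed
  have Gb: "norm (G l \<alpha>) * R ^ mi_size \<alpha> \<le> 2 / R * H \<alpha>" for l \<alpha>
  proof -
    have "norm (infsum (\<lambda>\<beta>. c (case_sum \<alpha> \<beta>) * mi_power (y l) \<beta> * of_real R ^ mi_size \<alpha>) UNIV) \<le> H \<alpha>"
      unfolding H_def
    proof (rule norm_infsum_le[OF has_sum_infsum has_sum_infsum[OF m1]])
      show "(\<lambda>\<beta>. c (case_sum \<alpha> \<beta>) * mi_power (y l) \<beta> * of_real R ^ mi_size \<alpha>) summable_on UNIV"
        by (intro summable_on_cmult_left cs)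
      show "norm (c (case_sum \<alpha> \<beta>) * mi_power (y l) \<beta> * of_real R ^ mi_size \<alpha>) \<le> m (\<alpha>, \<beta>)" for \<beta>
        using tb[of \<alpha> \<beta> l] R by (simp add: norm_mult norm_power)
    qed
    moreover have "infsum (\<lambda>\<beta>. c (case_sum \<alpha> \<beta>) * mi_power (y l) \<beta> * of_real R ^ mi_size \<alpha>) UNIV
       = infsum (\<lambda>\<beta>. c (case_sum \<alpha> \<beta>) * mi_power (y l) \<beta>) UNIV * of_real R ^ mi_size \<alpha>"
      by (rule infsum_cmult_left')
    ultimately have "2 / R * (norm (infsum (\<lambda>\<beta>. c (case_sum \<alpha> \<beta>) * mi_power (y l) \<beta>) UNIV) * R ^ mi_size \<alpha>) \<le> 2 / R * H \<alpha>"
      using R by (intro mult_left_mono) (auto simp: norm_mult norm_power)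
    then show ?thesis using R by (simp add: G_def norm_mult norm_divide)
  qed
  have sH: "((\<lambda>\<alpha>. 2 / R * H \<alpha>) has_sum 2 / R * infsum (\<lambda>\<alpha>. norm (c \<alpha>) * R ^ mi_size \<alpha>) UNIV) UNIV"
    by (rule has_sum_cmult_right[OF H])
  have sG: "(\<lambda>\<alpha>. norm (G l \<alpha>) * R ^ mi_size \<alpha>) summable_on UNIV" for l
    by (rule summable_on_comparison_test[OF has_sum_imp_summable[OF sH] Gb]) (use R in auto)
  have iG: "infsum (\<lambda>\<alpha>. norm (G l \<alpha>) * R ^ mi_size \<alpha>) UNIV \<le> 2 / R * M" for l
  proof -
    have "infsum (\<lambda>\<alpha>. norm (G l \<alpha>) * R ^ mi_size \<alpha>) UNIV \<le> 2 / R * infsum (\<lambda>\<alpha>. norm (c \<alpha>) * R ^ mi_size \<alpha>) UNIV"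
      by (rule has_sum_mono[OF has_sum_infsum[OF sG] sH Gb])
    also have "\<dots> \<le> 2 / R * M" using s(2) R by (intro mult_left_mono) auto
    finally show ?thesis .
  qed
  have hs: "((\<lambda>\<alpha>. G l \<alpha> * mi_power x \<alpha>) has_sum gt x t $ l) UNIV" if x: "\<forall>k. norm (x $ k) < R" for l x
  proof -
    let ?z = "\<chi> i. case i of Inl k \<Rightarrow> x $ k | Inr k \<Rightarrow> y l $ k"
    have "((\<lambda>\<alpha>. c \<alpha> * mi_power ?z \<alpha>) has_sum F ?z) UNIV"
    proof (rule power_series_represents[OF anF ps s(1)])
      show "norm (?z $ i) < R" for i using x y(2) by (cases i) auto
    qed
    then have "((\<lambda>(\<alpha>, \<beta>). c (case_sum \<alpha> \<beta>) * (mi_power x \<alpha> * mi_power (y l) \<beta>)) has_sum F ?z) (UNIV \<times> UNIV)"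
      using has_sum_reindex_bij_betw[OF bij, of "\<lambda>\<alpha>. c \<alpha> * mi_power ?z \<alpha>"]
      by (simp add: case_prod_unfold mi_power_case_sum)
    then have "((\<lambda>\<alpha>. of_real (R / 2) * (G l \<alpha> * mi_power x \<alpha>)) has_sum F ?z) UNIV"
    proof (rule has_sum_SigmaD)
      fix \<alpha>
      have "((\<lambda>\<beta>. (c (case_sum \<alpha> \<beta>) * mi_power (y l) \<beta>) * mi_power x \<alpha>) has_sum
         infsum (\<lambda>\<beta>. c (case_sum \<alpha> \<beta>) * mi_power (y l) \<beta>) UNIV * mi_power x \<alpha>) UNIV"
        by (intro has_sum_cmult_left has_sum_infsum cs)
      then show "((\<lambda>\<beta>. case (\<alpha>, \<beta>) of (\<alpha>, \<beta>) \<Rightarrow> c (case_sum \<alpha> \<beta>) * (mi_power x \<alpha> * mi_power (y l) \<beta>)) has_sum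
         of_real (R / 2) * (G l \<alpha> * mi_power x \<alpha>)) UNIV"
        using R by (simp add: G_def mult_ac)
    qed
    moreover have "F ?z = of_real (R / 2) * gt x t $ l" by (simp only: F_def y_def y_dot_axis)
    ultimately have "((\<lambda>\<alpha>. of_real (R / 2) * (G l \<alpha> * mi_power x \<alpha>)) has_sum of_real (R / 2) * gt x t $ l) UNIV"
      by (simp only:)
    then have "((\<lambda>\<alpha>. of_real (2 / R) * (of_real (R / 2) * (G l \<alpha> * mi_power x \<alpha>))) has_sum of_real (2 / R) * (of_real (R / 2) * gt x t $ l)) UNIV"
      by (rule has_sum_cmult_right)
    moreover have "of_real (2 / R) * (of_real (R / 2) * X) = X" for X :: complex
      using R by simp
    ultimately show ?thesis by (simp only:)
  qed
  show ?thesis using sG iG hs by blast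
qed

section \<open>Vanishing of the terms of degree below two\<close>

lemma mi_size_eq_1_iff: "{\<alpha> :: 'n::finite \<Rightarrow> nat. mi_size \<alpha> = 1} = range (\<lambda>m k. if k = m then 1 else 0)"
proof (intro set_eqI iffI)
  fix \<alpha> :: "'n \<Rightarrow> nat"
  assume "\<alpha> \<in> {\<alpha>. mi_size \<alpha> = 1}"
  then have 1: "(\<Sum>k\<in>UNIV. \<alpha> k) = 1" by (simp add: mi_size_def)
  then obtain m where m: "\<alpha> m \<noteq> 0" by (metis sum.neutral zero_neq_one)
  have "(\<Sum>k\<in>UNIV. \<alpha> k) = \<alpha> m + (\<Sum>k\<in>UNIV - {m}. \<alpha> k)" by (rule sum.remove) auto
  then have "\<alpha> m = 1" "(\<Sum>k\<in>UNIV - {m}. \<alpha> k) = 0" using 1 m by linarith+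
  then have "\<alpha> = (\<lambda>k. if k = m then 1 else 0)" by (auto simp: fun_eq_iff)
  then show "\<alpha> \<in> range (\<lambda>m k. if k = m then 1 else 0)" by blast
qed (auto simp: mi_size_def)

lemma mi_size_eq_0_iff: "mi_size \<alpha> = 0 \<longleftrightarrow> \<alpha> = (\<lambda>_. 0)"
  by (auto simp: mi_size_def fun_eq_iff)

lemma inj_unit_index: "inj (\<lambda>m k. if k = m then 1 else 0 :: nat)"
  by (rule injI) (metis zero_neq_one)

lemma mi_power_unit: "mi_power z (\<lambda>k. if k = m then 1 else 0) = z $ m"
proof -
  have "mi_power z (\<lambda>k. if k = m then 1 else 0) = (\<Prod>k\<in>UNIV. if k = m then z $ k else 1)"
    unfolding mi_power_def by (intro prod.cong) auto
  then show ?thesis by simp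
qed

lemma power_series_line_derivative:
  fixes G :: "('n::finite \<Rightarrow> nat) \<Rightarrow> complex"
  assumes R: "0 < R" and s: "(\<lambda>\<alpha>. norm (G \<alpha>) * R ^ mi_size \<alpha>) summable_on UNIV"
    and F: "\<And>x. (\<forall>k. norm (x $ k) < R) \<Longrightarrow> ((\<lambda>\<alpha>. G \<alpha> * mi_power x \<alpha>) has_sum F x) UNIV"
  shows "((\<lambda>s. F (\<chi> k. of_real s * p $ k)) has_vector_derivative (\<Sum>m\<in>UNIV. G (\<lambda>k. if k = m then 1 else 0) * p $ m)) (at 0)"
proof -
  define b where "b = 1 + (\<Sum>k\<in>UNIV. norm (p $ k))"
  have pb: "norm (p $ k) \<le> b" for k
    unfolding b_def using member_le_sum[of k UNIV "\<lambda>k. norm (p $ k)"] by auto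
  have b: "0 < b" unfolding b_def by (intro add_pos_nonneg sum_nonneg) auto
  \<comment> \<open>The 2 pays for the factor \<open>mi_size \<alpha>\<close> from differentiation,
    which is at most 2^\<open>mi_size \<alpha>\<close>.\<close>
  define r where "r = R / (2 * b)"
  have r: "0 < r" "2 * (b * r) = R" using R b by (auto simp: r_def)
  let ?J = "{-r..r}"
  let ?f = "\<lambda>\<alpha> s. G \<alpha> * mi_power p \<alpha> * of_real s ^ mi_size \<alpha>"
  let ?f' = "\<lambda>\<alpha> s. G \<alpha> * mi_power p \<alpha> * (of_nat (mi_size \<alpha>) * of_real s ^ (mi_size \<alpha> - 1))"
  have "((\<lambda>s. F (\<chi> k. of_real s * p $ k)) has_vector_derivative (\<Sum>m\<in>UNIV. G (\<lambda>k. if k = m then 1 else 0) * p $ m)) (at 0 within ?J)"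
  proof (rule has_vector_derivative_infsum)
    show "convex ?J" by (rule convex_real_interval)
    show "0 \<in> ?J" using r by simp
    show "(?f \<alpha> has_vector_derivative ?f' \<alpha> s) (at s within ?J)" for \<alpha> s
    proof -
      have "((\<lambda>z. G \<alpha> * mi_power p \<alpha> * z ^ mi_size \<alpha>) has_field_derivative ?f' \<alpha> s) (at (of_real s))"
        by (auto intro!: derivative_eq_intros)
      then show ?thesis by (rule has_vector_derivative_at_within[OF has_vector_derivative_real_field])
    qed
    show "(\<lambda>\<alpha>. norm (G \<alpha>) * R ^ mi_size \<alpha> * (1 / r)) summable_on UNIV" by (rule summable_on_cmult_left[OF s])
    show "norm (?f' \<alpha> s) \<le> norm (G \<alpha>) * R ^ mi_size \<alpha> * (1 / r)" if s: "s \<in> ?J" for \<alpha> s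
    proof (cases "mi_size \<alpha>")
      case 0
      then show ?thesis using r by simp
    next
      case (Suc j)
      have "norm (mi_power p \<alpha>) \<le> b ^ mi_size \<alpha>" using pb by (intro norm_mi_power_le) (simp add: polydisc_def)
      moreover have "real (mi_size \<alpha>) \<le> 2 ^ mi_size \<alpha>" using of_nat_less_two_power[of "mi_size \<alpha>", where 'a = real] by simp
      moreover have "\<bar>s\<bar> ^ j \<le> r ^ j" using s by (intro power_mono) auto
      ultimately have "norm (mi_power p \<alpha>) * (real (mi_size \<alpha>) * \<bar>s\<bar> ^ j) \<le> b ^ mi_size \<alpha> * (2 ^ mi_size \<alpha> * r ^ j)"
        using b by (intro mult_mono) auto
      also have "\<dots> = (2 * (b * r)) ^ mi_size \<alpha> * (1 / r)" using r(1) by (simp add: Suc power_mult_distrib)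
      finally have "norm (mi_power p \<alpha>) * (real (mi_size \<alpha>) * \<bar>s\<bar> ^ j) \<le> R ^ mi_size \<alpha> * (1 / r)" unfolding r(2) .
      from mult_left_mono[OF this norm_ge_zero[of "G \<alpha>"]] show ?thesis
        by (simp add: Suc norm_mult norm_power mult.assoc del: of_nat_Suc)
    qed
    show "((\<lambda>\<alpha>. ?f \<alpha> s) has_sum F (\<chi> k. of_real s * p $ k)) UNIV" if s: "s \<in> ?J" for s
    proof -
      have "norm (of_real s * p $ k) < R" for k
      proof -
        have "norm (of_real s * p $ k) \<le> r * b" unfolding norm_mult using s pb r by (intro mult_mono) auto
        also have "\<dots> < R" using r R b by (simp add: mult.commute flip: r(2))
        finally show ?thesis .
      qed
      then have "((\<lambda>\<alpha>. G \<alpha> * mi_power (\<chi> k. of_real s * p $ k) \<alpha>) has_sum F (\<chi> k. of_real s * p $ k)) UNIV"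
        by (intro F) simp
      then show ?thesis unfolding mi_power_scale by (simp add: mult_ac)
    qed
    show "((\<lambda>\<alpha>. ?f' \<alpha> 0) has_sum (\<Sum>m\<in>UNIV. G (\<lambda>k. if k = m then 1 else 0) * p $ m)) UNIV"
    proof (rule has_sum_finite_neutralI[of "{\<alpha>. mi_size \<alpha> = 1}"])
      have "(\<Sum>\<alpha> | mi_size \<alpha> = 1. ?f' \<alpha> 0) = (\<Sum>m\<in>UNIV. ?f' (\<lambda>k. if k = m then 1 else 0) 0)"
        unfolding mi_size_eq_1_iff by (subst sum.reindex[OF inj_unit_index]) simp
      also have "\<dots> = (\<Sum>m\<in>UNIV. G (\<lambda>k. if k = m then 1 else 0) * p $ m)"
        by (intro sum.cong) (auto simp: mi_power_unit mi_size_def)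
      finally show "(\<Sum>m\<in>UNIV. G (\<lambda>k. if k = m then 1 else 0) * p $ m) = (\<Sum>\<alpha> | mi_size \<alpha> = 1. ?f' \<alpha> 0)" ..
      show "finite {\<alpha> :: 'n \<Rightarrow> nat. mi_size \<alpha> = 1}" unfolding mi_size_eq_1_iff by simp
      show "?f' \<alpha> 0 = 0" if "\<alpha> \<in> UNIV - {\<alpha>. mi_size \<alpha> = 1}" for \<alpha>
        using that by (cases "mi_size \<alpha>") (auto simp: power_0_left)
    qed auto
  qed
  moreover have "at 0 within ?J = at 0" using r by (intro at_within_interior) (simp add: interior_atLeastAtMost_real)
  ultimately show ?thesis by simp
qed

text \<open>The hypothesis on \<open>g\<close> concerns real directions only. In the coordinates x
  these are the columns of the inverse of \<open>P\<close>, so the row of linear coefficients times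
  that inverse vanishes. The columns span the complex space, hence the row is zero.\<close>

lemma quadratic_coeffs_vanish:
  fixes P :: "complex^'n::finite^'n" and g :: "real^'n \<Rightarrow> real \<Rightarrow> real^'n" and G :: "'n \<Rightarrow> ('n \<Rightarrow> nat) \<Rightarrow> complex"
  assumes P: "invertible P" and g: "at_least_quadratic g" and co: "nonlinearity_in_coords P g R gt"
    and R: "0 < R" and t: "0 \<le> t"
    and s: "\<And>l. (\<lambda>\<alpha>. norm (G l \<alpha>) * R ^ mi_size \<alpha>) summable_on UNIV"
    and F: "\<And>l x. (\<forall>k. norm (x $ k) < R) \<Longrightarrow> ((\<lambda>\<alpha>. G l \<alpha> * mi_power x \<alpha>) has_sum gt x t $ l) UNIV"
    and \<alpha>: "mi_size \<alpha> < 2"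
  shows "G l \<alpha> = 0"
proof -
  let ?Q = "matrix_inv P"
  let ?e = "\<lambda>m k :: 'n. if k = m then 1 else 0 :: nat"
  have c0: "complexify_vec 0 = 0" by (simp add: complexify_vec_def vec_eq_iff)
  have Z: "gt 0 t = 0"
  proof -
    have "?Q *v complexify_vec 0 \<in> polydisc R" using R by (simp add: c0 polydisc_def)
    then have "gt (?Q *v complexify_vec 0) t = ?Q *v complexify_vec (g 0 t)"
      using co t unfolding nonlinearity_in_coords_def by blast
    moreover have "g 0 t = 0" using g t by (simp add: at_least_quadratic_def)
    ultimately show ?thesis by (simp add: c0)
  qed
  have G0: "G l (\<lambda>_. 0) = 0" for l
  proof -
    have "((\<lambda>\<alpha>. G l \<alpha> * mi_power 0 \<alpha>) has_sum 0) UNIV" using F[of 0 l] R Z by simp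
    moreover have "((\<lambda>\<alpha>. G l \<alpha> * mi_power 0 \<alpha>) has_sum G l (\<lambda>_. 0)) UNIV"
    proof (rule has_sum_finite_neutralI[of "{\<lambda>_. 0}"])
      fix \<beta> :: "'n \<Rightarrow> nat" assume "\<beta> \<in> UNIV - {\<lambda>_. 0}"
      then obtain k where "\<beta> k \<noteq> 0" by (auto simp: fun_eq_iff)
      then have "(0::complex) ^ \<beta> k = 0" by simp
      then have "mi_power 0 \<beta> = 0" unfolding mi_power_def by (metis (mono_tags, lifting) UNIV_I finite prod_zero zero_index)
      then show "G l \<beta> * mi_power 0 \<beta> = 0" by simp
    qed (auto simp: mi_power_def)
    ultimately show ?thesis by (rule has_sum_unique[symmetric])
  qed
  have L0: "(\<Sum>m\<in>UNIV. G l (?e m) * ?Q $ m $ j) = 0" for l j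
  proof -
    define p where "p = ?Q *v complexify_vec (axis j 1)"
    have p: "p $ m = ?Q $ m $ j" for m
    proof -
      have "p $ m = (\<Sum>i\<in>UNIV. ?Q $ m $ i * (if i = j then 1 else 0))"
        unfolding p_def matrix_vector_mult_def complexify_vec_def by (auto simp: axis_def intro!: sum.cong)
      then show ?thesis by (simp add: if_distrib cong: if_cong)
    qed
    have line: "?Q *v complexify_vec (s *\<^sub>R axis j 1) = (\<chi> k. of_real s * p $ k)" for s :: real
      unfolding p_def matrix_vector_mult_def complexify_vec_def
      by (simp add: vec_eq_iff sum_distrib_left mult_ac)
    have lin: "bounded_linear (\<lambda>v :: real^'n. (?Q *v complexify_vec v) $ l)"
    proof -
      have "linear (\<lambda>v :: real^'n. (?Q *v complexify_vec v) $ l)"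
        by (rule linearI) (simp_all add: matrix_vector_mult_def complexify_vec_def sum.distrib algebra_simps scaleR_conv_of_real[where 'a = complex] sum_distrib_left)
      then show ?thesis by (simp add: linear_conv_bounded_linear)
    qed
    have "((\<lambda>s. g (s *\<^sub>R axis j 1) t) has_vector_derivative 0) (at 0)"
      using g t by (simp add: at_least_quadratic_def)
    from bounded_linear.has_vector_derivative[OF lin this]
    have 1: "((\<lambda>s. (?Q *v complexify_vec (g (s *\<^sub>R axis j 1) t)) $ l) has_vector_derivative 0) (at 0)"
      by (simp add: c0)
    define U where "U = (\<lambda>s. (\<chi> k. of_real s * p $ k) :: complex^'n) -` {z. \<forall>k. norm (z $ k) < R}"
    have U: "open U" "0 \<in> U"
      unfolding U_def by (intro open_vimage[OF open_polydisc] continuous_intros) (use R in simp)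
    have "((\<lambda>s. gt (\<chi> k. of_real s * p $ k) t $ l) has_vector_derivative 0) (at 0)"
    proof (rule has_vector_derivative_transform_within_open[OF 1 U])
      fix s assume "s \<in> U"
      then have "?Q *v complexify_vec (s *\<^sub>R axis j 1) \<in> polydisc R"
        unfolding line by (auto simp: U_def polydisc_def less_imp_le)
      then have "gt (?Q *v complexify_vec (s *\<^sub>R axis j 1)) t = ?Q *v complexify_vec (g (s *\<^sub>R axis j 1) t)"
        using co t unfolding nonlinearity_in_coords_def by blast
      then show "(?Q *v complexify_vec (g (s *\<^sub>R axis j 1) t)) $ l = gt (\<chi> k. of_real s * p $ k) t $ l"
        by (simp add: line)
    qed
    moreover have "((\<lambda>s. gt (\<chi> k. of_real s * p $ k) t $ l) has_vector_derivative (\<Sum>m\<in>UNIV. G l (?e m) * p $ m)) (at 0)"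
      by (rule power_series_line_derivative[OF R s F])
    ultimately have "(\<Sum>m\<in>UNIV. G l (?e m) * p $ m) = 0"
      using vector_derivative_unique_at by blast
    then show ?thesis by (simp add: p)
  qed
  have G1: "G l (?e m) = 0" for l m
  proof -
    have QP: "?Q ** P = mat 1"
      using P unfolding invertible_def matrix_inv_def by (rule someI2_ex) blast
    \<comment> \<open>Multiplication by \<open>P\<close> from the right recovers the coefficients
      themselves.\<close>
    have "0 = (\<Sum>j\<in>UNIV. (\<Sum>i\<in>UNIV. G l (?e i) * ?Q $ i $ j) * P $ j $ m)" by (simp add: L0)
    also have "\<dots> = (\<Sum>i\<in>UNIV. \<Sum>j\<in>UNIV. G l (?e i) * (?Q $ i $ j * P $ j $ m))"
      unfolding sum_distrib_right by (subst sum.swap) (simp add: mult.assoc)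
    also have "\<dots> = (\<Sum>i\<in>UNIV. G l (?e i) * (?Q ** P) $ i $ m)"
      by (simp add: matrix_matrix_mult_def sum_distrib_left)
    also have "\<dots> = (\<Sum>i\<in>UNIV. if i = m then G l (?e i) else 0)"
      unfolding QP by (intro sum.cong) (auto simp: mat_def)
    also have "\<dots> = G l (?e m)" by simp
    finally show ?thesis by simp
  qed
  consider "mi_size \<alpha> = 0" | "mi_size \<alpha> = 1" using \<alpha> by linarith
  then show ?thesis
  proof cases
    case 1
    then show ?thesis using G0 by (simp add: mi_size_eq_0_iff)
  next
    case 2
    then have "\<alpha> \<in> range ?e" using mi_size_eq_1_iff by blast
    then show ?thesis using G1 by auto
  qed
qed

section \<open>From multi-indices to words\<close>

lemma ex_word: "\<exists>w. count_list w = \<alpha>" for \<alpha> :: "'n::finite \<Rightarrow> nat"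
proof (induction "mi_size \<alpha>" arbitrary: \<alpha>)
  case 0
  then have "count_list [] = \<alpha>" by (simp add: mi_size_eq_0_iff[symmetric] fun_eq_iff mi_size_def)
  then show ?case by blast
next
  case (Suc m)
  then have "mi_size \<alpha> \<noteq> 0" by simp
  then obtain l where l: "\<alpha> l \<noteq> 0" unfolding mi_size_eq_0_iff by (auto simp: fun_eq_iff)
  have "mi_size \<alpha> = \<alpha> l + (\<Sum>k\<in>UNIV - {l}. \<alpha> k)" unfolding mi_size_def by (rule sum.remove) auto
  moreover have "mi_size (\<alpha>(l := \<alpha> l - 1)) = (\<alpha>(l := \<alpha> l - 1)) l + (\<Sum>k\<in>UNIV - {l}. (\<alpha>(l := \<alpha> l - 1)) k)"
    unfolding mi_size_def by (rule sum.remove) auto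
  moreover have "(\<Sum>k\<in>UNIV - {l}. (\<alpha>(l := \<alpha> l - 1)) k) = (\<Sum>k\<in>UNIV - {l}. \<alpha> k)" by (intro sum.cong) auto
  ultimately have "m = mi_size (\<alpha>(l := \<alpha> l - 1))" using l Suc(2) by simp
  then obtain w where "count_list w = \<alpha>(l := \<alpha> l - 1)" using Suc(1) by blast
  then have "count_list (l # w) = \<alpha>" using l by (auto simp: fun_eq_iff)
  then show ?case by blast
qed

text \<open>Each monomial is represented by one of the words spelling it.\<close>

definition word_of :: "('n::finite \<Rightarrow> nat) \<Rightarrow> 'n list" where
  "word_of \<alpha> = (SOME w. count_list w = \<alpha>)"

lemma count_list_word_of [simp]: "count_list (word_of \<alpha>) = \<alpha>"
  unfolding word_of_def using ex_word by (rule someI_ex)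

text \<open>All other spellings of a monomial get coefficient 0, so a sum over words counts each
  monomial once.\<close>

definition word_coeff :: "(('n::finite \<Rightarrow> nat) \<Rightarrow> 'a::zero) \<Rightarrow> 'n list \<Rightarrow> 'a" where
  "word_coeff G w = (if word_of (count_list w) = w then G (count_list w) else 0)"

lemma word_series_word_coeff:
  fixes G :: "('n::finite \<Rightarrow> nat) \<Rightarrow> complex"
  assumes "((\<lambda>\<alpha>. G \<alpha> * mi_power x \<alpha>) has_sum s) UNIV" and "\<And>\<alpha>. mi_size \<alpha> < 2 \<Longrightarrow> G \<alpha> = 0"
  shows "word_series (word_coeff G) x = s"
proof -
  have inj: "inj word_of" by (rule inj_on_inverseI[where g = count_list]) simp
  have "((\<lambda>w. G (count_list w) * word_monomial x w) has_sum s) (range word_of)"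
    using assms(1) by (subst has_sum_reindex[OF inj]) (simp add: o_def word_monomial_eq_mi_power)
  also have "?this \<longleftrightarrow> ((\<lambda>w. word_coeff G w * word_monomial x w) has_sum s) (lists2 UNIV)"
  proof (rule has_sum_cong_neutral)
    fix w :: "'n list" assume w: "w \<in> lists2 UNIV - range word_of"
    have "word_of (count_list w) \<noteq> w"
    proof
      assume "word_of (count_list w) = w"
      from range_eqI[of w word_of, OF this[symmetric]] w show False by blast
    qed
    then show "word_coeff G w * word_monomial x w = 0" by (simp add: word_coeff_def)
  next
    fix w :: "'n list" assume "w \<in> range word_of - lists2 UNIV"
    then have "mi_size (count_list w) < 2" by (auto simp: lists2_def mi_size_count_list)
    then show "G (count_list w) * word_monomial x w = 0" using assms(2) by simp
  next
    fix w :: "'n list" assume "w \<in> range word_of \<inter> lists2 UNIV"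
    then show "G (count_list w) * word_monomial x w = word_coeff G w * word_monomial x w"
      by (auto simp: word_coeff_def)
  qed
  finally show ?thesis by (simp add: word_series_def infsumI)
qed

section \<open>Uniqueness of solutions\<close>

lemma has_vector_derivative_vecI:
  fixes x :: "real \<Rightarrow> complex^'n::finite"
  assumes "\<And>l. ((\<lambda>t. x t $ l) has_vector_derivative v $ l) F"
  shows "(x has_vector_derivative v) F"
proof -
  have lin: "bounded_linear (\<lambda>c. axis l c :: complex^'n)" for l
  proof -
    have "linear (\<lambda>c. axis l c :: complex^'n)"
      by (rule linearI) (auto simp: axis_def vec_eq_iff)
    then show ?thesis by (simp add: linear_conv_bounded_linear)
  qed
  have dec: "(\<Sum>l\<in>UNIV. axis l (y $ l)) = y" for y :: "complex^'n"
    by (simp add: vec_eq_iff axis_def if_distrib cong: if_cong)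
  have "((\<lambda>t. \<Sum>l\<in>UNIV. axis l (x t $ l)) has_vector_derivative (\<Sum>l\<in>UNIV. axis l (v $ l))) F"
    by (intro has_vector_derivative_sum bounded_linear.has_vector_derivative[OF lin] assms)
  then show ?thesis by (simp add: dec)
qed

text \<open>Agreement at one time propagates to nearby times by iterating the mean value inequality, and
  then to all of \<open>J\<close> by connectedness.\<close>

lemma ode_unique:
  fixes x y :: "real \<Rightarrow> complex^'n::finite"
  assumes J: "is_interval J" "t0 \<in> J" "x t0 = y t0"
    and x: "\<And>t l. t \<in> J \<Longrightarrow> ((\<lambda>t. x t $ l) has_vector_derivative f l t (x t)) (at t within J)"
    and y: "\<And>t l. t \<in> J \<Longrightarrow> ((\<lambda>t. y t $ l) has_vector_derivative f l t (y t)) (at t within J)"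
    and yr: "\<And>t. t \<in> J \<Longrightarrow> y t \<in> polydisc r0" "r0 < r"
    and lip: "\<And>t l u v \<delta>. t \<in> J \<Longrightarrow> u \<in> polydisc r \<Longrightarrow> v \<in> polydisc r \<Longrightarrow>
      (\<And>k. norm (u $ k - v $ k) \<le> \<delta>) \<Longrightarrow> norm (f l t u - f l t v) \<le> L * \<delta>"
    and t: "t \<in> J"
  shows "x t = y t"
proof -
  let ?A = "{t \<in> J. x t - y t \<in> {0}}"
  have vx: "(x has_vector_derivative (\<chi> l. f l t (x t))) (at t within J)" if "t \<in> J" for t
    by (rule has_vector_derivative_vecI) (use x[OF that] in simp)
  have vy: "(y has_vector_derivative (\<chi> l. f l t (y t))) (at t within J)" if "t \<in> J" for t
    by (rule has_vector_derivative_vecI) (use y[OF that] in simp)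
  have cx: "continuous_on J x" and cy: "continuous_on J y"
    unfolding continuous_on_eq_continuous_within using has_vector_derivative_continuous vx vy by blast+
  have "closedin (top_of_set J) ?A"
    using continuous_closedin_preimage[OF continuous_on_diff[OF cx cy] closed_singleton, of 0]
    by (simp add: vimage_def Int_def)
  moreover have "openin (top_of_set J) ?A"
    unfolding openin_contains_ball
  proof (intro conjI ballI)
    fix s assume s: "s \<in> ?A"
    then have sJ: "s \<in> J" and eq: "x s = y s" by auto
    have ys: "norm (y s $ k) < r" for k using yr(1)[OF sJ] yr(2) by (auto simp: polydisc_def intro: le_less_trans)
    \<comment> \<open>Only \<open>y\<close> is known to stay in the smaller polydisc. As
      \<open>x\<close> agrees with it at \<open>s\<close>, continuity keeps \<open>x\<close> in the
      larger one, where the Lipschitz bound holds, for nearby times.\<close>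
    have "(x \<longlongrightarrow> x s) (at s within J)" using cx sJ by (simp add: continuous_on_def)
    from topological_tendstoD[OF this open_polydisc[of r]] have "\<forall>\<^sub>F t in at s within J. x t \<in> {z. \<forall>k. norm (z $ k) < r}"
      using ys by (simp add: eq)
    then obtain \<delta> where \<delta>: "\<delta> > 0" "\<And>t. t \<in> J \<Longrightarrow> t \<noteq> s \<Longrightarrow> dist t s < \<delta> \<Longrightarrow> (\<forall>k. norm (x t $ k) < r)"
      unfolding eventually_at by auto
    \<comment> \<open>Short enough for each application of the mean value inequality to halve the
      bound on x - y.\<close>
    define e where "e = min (\<delta> / 2) (1 / (2 * (\<bar>L\<bar> + 1)))"
    have e: "e > 0" "e < \<delta>" using \<delta>(1) by (auto simp: e_def)
    have eL: "\<bar>L\<bar> * e \<le> 1/2"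
    proof -
      have half: "x * (1 / (2 * x)) = 1 / 2" if "x \<noteq> 0" for x :: real using that by simp
      have "\<bar>L\<bar> * e \<le> (\<bar>L\<bar> + 1) * (1 / (2 * (\<bar>L\<bar> + 1)))" using e by (intro mult_mono) (auto simp: e_def)
      also have "\<dots> = 1 / 2" by (rule half) linarith
      finally show ?thesis .
    qed
    let ?K = "J \<inter> cball s e"
    have K: "convex ?K"
      using J(1) by (intro convex_Int convex_cball) (simp add: is_interval_convex_1)
    have sK: "s \<in> ?K" using sJ e by simp
    have xr: "x t \<in> polydisc r" if "t \<in> ?K" for t
    proof -
      have "dist t s < \<delta>" using that e by (auto simp: dist_commute)
      then have "\<forall>k. norm (x t $ k) < r" using \<delta>(2)[of t] that ys eq by (cases "t = s") auto
      then show ?thesis by (simp add: polydisc_def less_imp_le)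
    qed
    have yr': "y t \<in> polydisc r" if "t \<in> ?K" for t
      using yr(1)[of t] yr(2) that by (auto simp: polydisc_def intro: order_trans less_imp_le)
    have r0: "0 \<le> r" using polydisc_nonneg[OF xr[OF sK]] .
    have bd: "\<forall>t\<in>?K. \<forall>k. norm (x t $ k - y t $ k) \<le> 2 * r / 2 ^ n" for n
    proof (induction n)
      case 0
      show ?case
      proof (intro ballI allI)
        fix t k assume "t \<in> ?K"
        then have "norm (x t $ k) \<le> r" "norm (y t $ k) \<le> r" using xr yr' by (auto simp: polydisc_def)
        then show "norm (x t $ k - y t $ k) \<le> 2 * r / 2 ^ 0" using norm_triangle_ineq4[of "x t $ k" "y t $ k"] by simp
      qed
    next
      case (Suc n)
      let ?c = "2 * r / 2 ^ n"
      have c: "0 \<le> ?c" using r0 by simp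
      show ?case
      proof (intro ballI allI)
        fix t k assume tK: "t \<in> ?K"
        have "norm ((x t $ k - y t $ k) - (x s $ k - y s $ k)) \<le> (\<bar>L\<bar> * ?c) * norm (t - s)"
        proof (rule differentiable_bound[OF K])
          fix q assume q: "q \<in> ?K"
          have "((\<lambda>t. x t $ k - y t $ k) has_vector_derivative f k q (x q) - f k q (y q)) (at q within ?K)"
            by (rule has_vector_derivative_within_subset[of _ _ _ J]) (use q in \<open>auto intro!: has_vector_derivative_diff x y\<close>)
          then show "((\<lambda>t. x t $ k - y t $ k) has_derivative (\<lambda>h. h *\<^sub>R (f k q (x q) - f k q (y q)))) (at q within ?K)"
            by (simp add: has_vector_derivative_def)
          have "norm (f k q (x q) - f k q (y q)) \<le> L * ?c"
            by (rule lip[OF _ xr[OF q] yr'[OF q]]) (use Suc q in auto)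
          also have "\<dots> \<le> \<bar>L\<bar> * ?c" using c by (intro mult_right_mono) auto
          finally have "norm (f k q (x q) - f k q (y q)) \<le> \<bar>L\<bar> * ?c" .
          then show "onorm (\<lambda>h. h *\<^sub>R (f k q (x q) - f k q (y q))) \<le> \<bar>L\<bar> * ?c"
            by (rule onorm_scaleR_le)
        qed (use tK sK in auto)
        also have "\<dots> \<le> (\<bar>L\<bar> * ?c) * e"
          using tK by (intro mult_left_mono mult_nonneg_nonneg c) (auto simp: dist_norm norm_minus_commute)
        also have "\<dots> = ?c * (\<bar>L\<bar> * e)" by simp
        also have "\<dots> \<le> ?c * (1/2)" by (rule mult_left_mono[OF eL c])
        finally show "norm (x t $ k - y t $ k) \<le> 2 * r / 2 ^ Suc n" by (simp add: eq)
      qed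
    qed
    have "x t = y t" if tK: "t \<in> ?K" for t
    proof -
      have "norm (x t $ k - y t $ k) \<le> 0" for k
      proof (rule LIMSEQ_le_const)
        show "(\<lambda>n. 2 * r / 2 ^ n) \<longlonglongrightarrow> 0" using LIMSEQ_divide_realpow_zero[of 2 "2 * r"] by simp
        show "\<exists>N. \<forall>n\<ge>N. norm (x t $ k - y t $ k) \<le> 2 * r / 2 ^ n" using bd tK by blast
      qed
      then show ?thesis by (simp add: vec_eq_iff)
    qed
    then have "ball s e \<inter> J \<subseteq> ?A" by auto
    then show "\<exists>e>0. ball s e \<inter> J \<subseteq> ?A" using e(1) by blast
  qed auto
  moreover have "connected J" using J(1) by (simp add: is_interval_connected)
  ultimately have "?A = {} \<or> ?A = J" unfolding connected_clopen by blast
  moreover have "t0 \<in> ?A" using J by simp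
  ultimately have "?A = J" by blast
  then show ?thesis using t by auto
qed

section \<open>Integrability\<close>

lemma divisor_eq_sum:
  fixes lam :: "complex^'n::finite"
  shows "divisor lam l u = (\<Sum>k\<in>UNIV. (of_nat (count_list u k) - (if k = l then 1 else 0)) * lam $ k)"
proof (induction u)
  case Nil
  have "(\<Sum>k\<in>UNIV. (of_nat (count_list [] k) - (if k = l then 1 else 0)) * lam $ k) = (\<Sum>k\<in>UNIV. if k = l then - lam $ k else 0)"
    by (intro sum.cong) auto
  then show ?case by (simp add: divisor_def)
next
  case (Cons j u)
  have "(\<Sum>k\<in>UNIV. (of_nat (count_list (j # u) k) - (if k = l then 1 else 0)) * lam $ k)
    = (\<Sum>k\<in>UNIV. (if k = j then lam $ k else 0) + (of_nat (count_list u k) - (if k = l then 1 else 0)) * lam $ k)"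
    by (intro sum.cong) (auto simp: algebra_simps)
  also have "\<dots> = lam $ j + divisor lam l u" by (simp add: sum.distrib Cons)
  finally show ?case by (simp add: divisor_def)
qed

lemma divisor_subword: "divisor lam l (us @ u @ vs) - divisor lam k u = divisor lam l (us @ [k] @ vs)"
  by (simp add: divisor_def)

text \<open>Everything except the solution of the linear equations is common to the two cases; they
  enter through \<open>\<omega>\<close>, \<open>K\<close> and \<open>C\<close>.\<close>

lemma integrable_of_solver:
  fixes P :: "complex^'n::finite^'n" and lam :: "complex^'n" and g :: "real^'n \<Rightarrow> real \<Rightarrow> real^'n"
    and gt :: "complex^'n \<Rightarrow> real \<Rightarrow> complex^'n" and R :: real
  assumes P: "invertible P" and quad: "at_least_quadratic g" and R: "0 < R" "R \<le> 1"
    and co: "nonlinearity_in_coords P g R gt"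
    and an: "\<And>t. 0 \<le> t \<Longrightarrow> (\<lambda>z. y_dot gt z t) \<in> frakC R"
    and cont: "continuous_on (polydisc R \<times> {0..}) (\<lambda>(z, t). y_dot gt z t)"
    and Mf: "1 \<le> Mf" and tn: "\<And>t. 0 \<le> t \<Longrightarrow> taylor_norm R (\<lambda>z. y_dot gt z t) \<le> ennreal (Mf * \<omega> t)"
    and \<omega>: "\<And>t. 0 \<le> t \<Longrightarrow> 0 \<le> \<omega> t \<and> \<omega> t \<le> 1"
    and K0: "\<And>l u. 0 \<le> K l u"
    and solve: "\<And>l u q Q t. 2 \<le> length u \<Longrightarrow> continuous_on {0..} q \<Longrightarrow>
      (\<And>t. 0 \<le> t \<Longrightarrow> norm (q t) \<le> Q * \<omega> t) \<Longrightarrow> 0 \<le> t \<Longrightarrow>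
      norm (lin_solve (divisor lam l u) q t) \<le> K l u * Q"
    and kprod_le: "\<And>T. proper T \<Longrightarrow> kprod K T \<le> C ^ length (leaves T)" and C: "1 \<le> C"
  shows "integrable_near_origin lam gt R"
proof -
  \<comment> \<open>The condition on t sits under the quantifier so that coefficients can be chosen
    for all real t at once.\<close>
  have "\<exists>G. 0 \<le> t \<longrightarrow> (\<forall>l. (\<lambda>\<alpha>. norm (G l \<alpha>) * R ^ mi_size \<alpha>) summable_on UNIV
    \<and> infsum (\<lambda>\<alpha>. norm (G l \<alpha>) * R ^ mi_size \<alpha>) UNIV \<le> 2 / R * (Mf * \<omega> t)
    \<and> (\<forall>x. (\<forall>k. norm (x $ k) < R) \<longrightarrow> ((\<lambda>\<alpha>. G l \<alpha> * mi_power x \<alpha>) has_sum gt x t $ l) UNIV))" for t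
    using component_power_series[OF R(1) an tn, of t] Mf \<omega>[of t] by (cases "0 \<le> t") auto
  then have "\<exists>G. \<forall>t. 0 \<le> t \<longrightarrow> (\<forall>l. (\<lambda>\<alpha>. norm (G t l \<alpha>) * R ^ mi_size \<alpha>) summable_on UNIV
    \<and> infsum (\<lambda>\<alpha>. norm (G t l \<alpha>) * R ^ mi_size \<alpha>) UNIV \<le> 2 / R * (Mf * \<omega> t)
    \<and> (\<forall>x. (\<forall>k. norm (x $ k) < R) \<longrightarrow> ((\<lambda>\<alpha>. G t l \<alpha> * mi_power x \<alpha>) has_sum gt x t $ l) UNIV))"
    by (intro choice allI)
  then obtain G where G: "\<And>t l. 0 \<le> t \<Longrightarrow> (\<lambda>\<alpha>. norm (G t l \<alpha>) * R ^ mi_size \<alpha>) summable_on UNIV"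
    "\<And>t l. 0 \<le> t \<Longrightarrow> infsum (\<lambda>\<alpha>. norm (G t l \<alpha>) * R ^ mi_size \<alpha>) UNIV \<le> 2 / R * (Mf * \<omega> t)"
    "\<And>t l x. 0 \<le> t \<Longrightarrow> (\<forall>k. norm (x $ k) < R) \<Longrightarrow> ((\<lambda>\<alpha>. G t l \<alpha> * mi_power x \<alpha>) has_sum gt x t $ l) UNIV"
    by blast
  have gt_cont: "continuous_on {0..} (\<lambda>t. gt x t $ l)" if x: "x \<in> polydisc (R / 2)" for x l
  proof -
    let ?z = "\<chi> i. case i of Inl k \<Rightarrow> x $ k | Inr k \<Rightarrow> axis l (of_real (R / 2)) $ k"
    have "norm (?z $ i) \<le> R" for i
    proof (cases i)
      case (Inl k)
      have "norm (x $ k) \<le> R / 2" using x by (simp add: polydisc_def)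
      then show ?thesis using Inl R by simp
    qed (use R in \<open>simp add: axis_def\<close>)
    then have "?z \<in> polydisc R" unfolding polydisc_def mem_Collect_eq by (rule allI)
    then have "continuous_on {0..} (\<lambda>t. case (?z, t) of (z, t) \<Rightarrow> y_dot gt z t)"
      by (intro continuous_on_compose2[OF cont] continuous_intros) blast
    then have "continuous_on {0..} (\<lambda>t. y_dot gt ?z t)" by (simp only: prod.case)
    then have "continuous_on {0..} (\<lambda>t. of_real (2 / R) * (of_real (R / 2) * gt x t $ l))"
      unfolding y_dot_axis by (rule continuous_on_mult_left)
    moreover have "of_real (2 / R) * (of_real (R / 2) * X) = X" for X :: complex using R by simp
    ultimately show ?thesis by (simp only:)
  qed
  have G_cont: "continuous_on {0..} (\<lambda>t. G t l \<alpha>)" for l \<alpha>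
  proof (rule continuous_coeffs[where \<rho> = "R / 2" and c = "\<lambda>\<alpha> t. G t l \<alpha>" and F = "\<lambda>x t. gt x t $ l" and M = "2 / R * Mf"])
    show "((\<lambda>\<alpha>. G t l \<alpha> * mi_power x \<alpha>) has_sum gt x t $ l) UNIV" if "x \<in> polydisc (R / 2)" "t \<in> {0..}" for x t
    proof (rule G(3))
      show "\<forall>k. norm (x $ k) < R" using that(1) R by (auto simp: polydisc_def intro: le_less_trans[of _ "R / 2"])
    qed (use that in simp)
    show "infsum (\<lambda>\<alpha>. norm (G t l \<alpha>) * (2 * (R / 2)) ^ mi_size \<alpha>) UNIV \<le> 2 / R * Mf" if "t \<in> {0..}" for t
    proof -
      have "infsum (\<lambda>\<alpha>. norm (G t l \<alpha>) * R ^ mi_size \<alpha>) UNIV \<le> 2 / R * (Mf * \<omega> t)" using G(2) that by simp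
      also have "\<dots> \<le> 2 / R * (Mf * 1)" using \<omega>[of t] that Mf R by (intro mult_left_mono) auto
      finally show ?thesis by simp
    qed
  qed (use R G(1) gt_cont in auto)
  have G_zero: "G t l \<alpha> = 0" if "0 \<le> t" "mi_size \<alpha> < 2" for t l \<alpha>
    by (rule quadratic_coeffs_vanish[OF P quad co R(1) that(1) G(1)[OF that(1)] G(3)[OF that(1)] that(2)])
  \<comment> \<open>A coefficient of degree k is at most (2 Mf / R) R^(-k). As 2 Mf / R is at least
    1, it may be replaced by its k-th power.\<close>
  define B where "B = 2 * Mf / R\<^sup>2"
  have MR: "1 \<le> 2 * Mf / R" using Mf R by (simp add: field_simps)
  have BR: "B = 2 * Mf / R * (1 / R)" by (simp add: B_def power2_eq_square)
  have "1 * 1 \<le> 2 * Mf / R * (1 / R)" using MR R by (intro mult_mono) auto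
  then have B: "1 \<le> B" by (simp add: BR)
  define \<gamma> where "\<gamma> l w t = word_coeff (G t l) w" for l w t
  have \<gamma>_cont: "continuous_on {0..} (\<gamma> l w)" for l w
    unfolding \<gamma>_def word_coeff_def using G_cont[of l "count_list w"] by (cases "word_of (count_list w) = w") auto
  have \<gamma>_bound: "norm (\<gamma> l w t) \<le> B ^ length w * \<omega> t" if w: "2 \<le> length w" and t: "0 \<le> t" for l w t
  proof -
    let ?\<alpha> = "count_list w"
    have "sum (\<lambda>\<alpha>. norm (G t l \<alpha>) * R ^ mi_size \<alpha>) {?\<alpha>} \<le> infsum (\<lambda>\<alpha>. norm (G t l \<alpha>) * R ^ mi_size \<alpha>) UNIV"
      by (rule finite_sum_le_infsum[OF G(1)[OF t]]) (use R in auto)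
    then have "norm (G t l ?\<alpha>) * R ^ length w \<le> 2 / R * (Mf * \<omega> t)"
      using G(2)[OF t, of l] by (simp add: mi_size_count_list)
    then have "norm (G t l ?\<alpha>) \<le> (2 * Mf / R) * (1 / R) ^ length w * \<omega> t"
      using R by (simp add: power_one_over field_simps)
    also have "\<dots> \<le> (2 * Mf / R) ^ length w * (1 / R) ^ length w * \<omega> t"
      using w \<omega>[OF t] R by (intro mult_right_mono self_le_power[OF MR]) auto
    also have "\<dots> = B ^ length w * \<omega> t" by (simp only: BR power_mult_distrib)
    finally show ?thesis using \<omega>[OF t] B by (auto simp: \<gamma>_def word_coeff_def)
  qed
  interpret linearizable_system lam \<gamma> \<omega> K B C
    by unfold_locales (fact \<gamma>_cont \<gamma>_bound \<omega> K0 solve kprod_le B C)+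
  have \<gamma>_bound': "norm (\<gamma> l w t) \<le> B ^ length w" if "2 \<le> length w" "0 \<le> t" for l w t
  proof -
    have "norm (\<gamma> l w t) \<le> B ^ length w * \<omega> t" by (rule \<gamma>_bound[OF that])
    also have "\<dots> \<le> B ^ length w * 1" using \<omega>[OF that(2)] B by (intro mult_left_mono) auto
    finally show ?thesis by simp
  qed
  have gt_eq: "word_series (\<lambda>w. \<gamma> l w t) x = gt x t $ l" if "0 \<le> t" "\<And>k. norm (x $ k) < R" for l x t
    using word_series_word_coeff[OF G(3)[OF that(1)] G_zero[OF that(1)], of x l] that(2) by (simp add: \<gamma>_def)
  let ?n = "real CARD('n)"
  have n: "1 \<le> ?n" by (simp add: Suc_leI)
  define B' where "B' = 8 * ?n ^ 2 * (C * B\<^sup>2)"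
  have CB: "1 \<le> C * B\<^sup>2" by (rule rate_ge_1)
  have "1 \<le> 8 * ?n ^ 2" using one_le_power[OF n, of 2] by linarith
  then have "1 * 1 \<le> (8 * ?n ^ 2) * (C * B\<^sup>2)" by (rule mult_mono[OF _ CB]) auto
  then have B': "1 \<le> B'" by (simp add: B'_def)
  \<comment> \<open>The polydisc of the uniqueness argument: inside the domain of the Taylor series,
    and small enough for the Lipschitz estimate of \<open>word_series_lipschitz\<close>.\<close>
  define r3 where "r3 = min (R / 2) (1 / (4 * ?n * B))"
  have r3: "0 < r3" "r3 < R" "4 * ?n * B * r3 \<le> 1"
  proof -
    show "0 < r3" "r3 < R" using R n B by (auto simp: r3_def)
    have "4 * ?n * B * r3 \<le> 4 * ?n * B * (1 / (4 * ?n * B))"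
      using n B by (intro mult_left_mono) (auto simp: r3_def)
    also have "\<dots> = 1" using n B by simp
    finally show "4 * ?n * B * r3 \<le> 1" .
  qed
  \<comment> \<open>Adds up the constants of three conditions on Rs: change of coordinates,
    convergence over trees, substitution into the nonlinearity.\<close>
  define c where "c = 64 * ?n ^ 3 * B' ^ 4 + 8 * ?n ^ 2 * (C * B\<^sup>2) + 4 * ?n * B * (C * B\<^sup>2)"
  have cpos: "0 \<le> 64 * ?n ^ 3 * B' ^ 4" "0 \<le> 8 * ?n ^ 2 * (C * B\<^sup>2)" "0 \<le> 4 * ?n * B * (C * B\<^sup>2)" "0 < 8 * ?n ^ 2 * (C * B\<^sup>2)"
    using n B B' C by auto
  then have c: "0 < c" "64 * ?n ^ 3 * B' ^ 4 \<le> c" "8 * ?n ^ 2 * (C * B\<^sup>2) \<le> c" "4 * ?n * B * (C * B\<^sup>2) \<le> c"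
    unfolding c_def by linarith+
  \<comment> \<open>The quarter keeps the image of \<open>M\<close>, of radius 2 Rs, strictly inside
    \<open>polydisc r3\<close>, as \<open>ode_unique\<close> demands.\<close>
  define Rs where "Rs = min (r3 / 4) (1 / c)"
  have Rs0: "0 < Rs" "2 * Rs < r3" "2 * Rs \<le> R" using r3 c by (auto simp: Rs_def)
  have small: "d * Rs \<le> 1" if "d \<le> c" for d
  proof -
    have "d * Rs \<le> c * (1 / c)" using that c Rs0 by (intro mult_mono) (auto simp: Rs_def)
    then show ?thesis using c by simp
  qed
  have Rs: "64 * ?n ^ 3 * B' ^ 4 * Rs \<le> 1" "8 * ?n ^ 2 * (C * B\<^sup>2 * Rs) \<le> 1" "4 * ?n * B * (C * B\<^sup>2 * Rs) \<le> 1"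
    using small[OF c(2)] small[OF c(3)] small[OF c(4)] by (simp_all add: mult.assoc)
  define M where "M z t = near_identity (linearization_coeff lam \<gamma> t) z" for z t
  have coeff: "norm (linearization_coeff lam \<gamma> t l w) \<le> B' ^ length w" if "0 \<le> t" for t l w
    unfolding B'_def by (rule linearization_coeff_bound(2)[OF that])
  have M_im: "(\<lambda>z. M z t) ` polydisc Rs \<subseteq> polydisc (2 * Rs)"
    and M_change: "analytic_coord_change_on (\<lambda>z. M z t) (polydisc Rs)" if "0 \<le> t" for t
    unfolding M_def
    by (rule near_identity_coord_change[of B', OF B' coeff[OF that] Rs0(1) Rs(1)])+
  let ?J = "\<lambda>\<xi>. {t. 0 \<le> t \<and> linear_flow lam t \<xi> \<in> polydisc Rs}"
  have M_mem: "M (linear_flow lam t \<xi>) t \<in> polydisc (2 * Rs)" if "t \<in> ?J \<xi>" for t \<xi>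
    using M_im[of t] that by blast
  have below: "norm (z $ k) < R" if "z \<in> polydisc r3" for z :: "complex^'n" and k
    using that r3(2) by (auto simp: polydisc_def intro: le_less_trans)
  have sub: "polydisc (2 * Rs) \<subseteq> (polydisc r3 :: (complex^'n) set)" "polydisc r3 \<subseteq> (polydisc R :: (complex^'n) set)"
    using Rs0 r3 by (auto simp: polydisc_def intro: order_trans less_imp_le)
  have M_der: "((\<lambda>t. M (linear_flow lam t \<xi>) t $ l) has_vector_derivative
      lam $ l * M (linear_flow lam t \<xi>) t $ l + gt (M (linear_flow lam t \<xi>) t) t $ l) (at t within ?J \<xi>)"
    if "t \<in> ?J \<xi>" for t \<xi> l
  proof -
    have "norm (M (linear_flow lam t \<xi>) t $ k) < R" for k using M_mem[OF that] sub(1) below by blast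
    then have "gt (M (linear_flow lam t \<xi>) t) t $ l = word_series (\<lambda>w. \<gamma> l w t) (M (linear_flow lam t \<xi>) t)"
      using that by (intro gt_eq[symmetric]) auto
    then show ?thesis unfolding M_def using linearization_solves[OF Rs0(1) Rs(2,3) that, of l] by simp
  qed
  have M_solves: "solves_on lam gt R (\<lambda>t. M (linear_flow lam t \<xi>) t) (?J \<xi>)" for \<xi>
    unfolding solves_on_def
  proof (intro ballI conjI)
    fix t assume t: "t \<in> ?J \<xi>"
    show "M (linear_flow lam t \<xi>) t \<in> polydisc R" using M_mem[OF t] sub by blast
    show "((\<lambda>t. M (linear_flow lam t \<xi>) t) has_vector_derivative
      (\<chi> l. lam $ l * M (linear_flow lam t \<xi>) t $ l + gt (M (linear_flow lam t \<xi>) t) t $ l)) (at t within ?J \<xi>)"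
      by (rule has_vector_derivative_vecI) (use M_der[OF t] in simp)
  qed
  have unique: "x t = M (linear_flow lam t \<xi>) t"
    if J: "is_interval J" "0 \<in> J" "J \<subseteq> ?J \<xi>" and x: "solves_on lam gt R x J" "x 0 = M \<xi> 0" and t: "t \<in> J" for \<xi> x J t
  proof (rule ode_unique[OF J(1,2), where f = "\<lambda>l t v. lam $ l * v $ l + gt v t $ l" and r = r3
        and L = "(\<Sum>k\<in>UNIV. norm (lam $ k)) + 8 * (?n * B)\<^sup>2 * r3"])
    have "linear_flow lam 0 \<xi> = \<xi>" by (simp add: linear_flow_def vec_eq_iff)
    then show "x 0 = M (linear_flow lam 0 \<xi>) 0" using x(2) by simp
    show "((\<lambda>t. x t $ l) has_vector_derivative lam $ l * x s $ l + gt (x s) s $ l) (at s within J)" if "s \<in> J" for s l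
    proof -
      have "(x has_vector_derivative (\<chi> l. lam $ l * x s $ l + gt (x s) s $ l)) (at s within J)"
        using x(1) that by (simp add: solves_on_def)
      from bounded_linear.has_vector_derivative[OF bounded_linear_vec_nth this, of l] show ?thesis by simp
    qed
    show "((\<lambda>t. M (linear_flow lam t \<xi>) t $ l) has_vector_derivative
      lam $ l * M (linear_flow lam s \<xi>) s $ l + gt (M (linear_flow lam s \<xi>) s) s $ l) (at s within J)" if "s \<in> J" for s l
      by (rule has_vector_derivative_within_subset[OF M_der J(3)]) (use that J(3) in blast)
    show "M (linear_flow lam s \<xi>) s \<in> polydisc (2 * Rs)" if "s \<in> J" for s
      using M_mem that J(3) by blast
    show "2 * Rs < r3" by (rule Rs0(2))
    show "t \<in> J" by (rule t)
    fix s l and u v :: "complex^'n" and \<delta>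
    assume s: "s \<in> J" and u: "u \<in> polydisc r3" and v: "v \<in> polydisc r3" and d: "\<And>k. norm (u $ k - v $ k) \<le> \<delta>"
    have s0: "0 \<le> s" using s J(3) by auto
    have d0: "0 \<le> \<delta>" using order_trans[OF norm_ge_zero d] .
    have "gt u s $ l = word_series (\<lambda>w. \<gamma> l w s) u" "gt v s $ l = word_series (\<lambda>w. \<gamma> l w s) v"
      using gt_eq[OF s0] below u v by auto
    then have 1: "norm (gt u s $ l - gt v s $ l) \<le> 8 * (?n * B)\<^sup>2 * r3 * \<delta>"
      using word_series_lipschitz[of B "\<lambda>w. \<gamma> l w s", OF _ \<gamma>_bound'[OF _ s0] u v d r3(1,3)] B by simp
    have "norm (lam $ l) \<le> (\<Sum>k\<in>UNIV. norm (lam $ k))"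
      using member_le_sum[of l UNIV "\<lambda>k. norm (lam $ k)"] by auto
    then have 2: "norm (lam $ l * (u $ l - v $ l)) \<le> (\<Sum>k\<in>UNIV. norm (lam $ k)) * \<delta>"
      unfolding norm_mult using d[of l] by (intro mult_mono) (auto intro: sum_nonneg)
    have eq: "lam $ l * u $ l + gt u s $ l - (lam $ l * v $ l + gt v s $ l) = lam $ l * (u $ l - v $ l) + (gt u s $ l - gt v s $ l)"
      by (simp add: algebra_simps)
    show "norm (lam $ l * u $ l + gt u s $ l - (lam $ l * v $ l + gt v s $ l)) \<le> ((\<Sum>k\<in>UNIV. norm (lam $ k)) + 8 * (?n * B)\<^sup>2 * r3) * \<delta>"
      unfolding eq distrib_right by (rule norm_triangle_mono[OF 2 1])
  qed
  show ?thesis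
    unfolding integrable_near_origin_def
    using Rs0 M_im M_change M_solves unique
    by (intro exI[of _ Rs] exI[of _ "2 * Rs"] exI[of _ M] conjI allI impI) auto
qed

theorem corollary1p4:
  fixes A :: "real^'n^'n" and P :: "complex^'n^'n" and lam :: "complex^'n"
    and g :: "real^'n \<Rightarrow> real \<Rightarrow> real^'n"
    and gt :: "complex^'n \<Rightarrow> real \<Rightarrow> complex^'n"
    and R :: real
  assumes "diagonalizes P A lam"
    and "\<forall>l. Re (lam $ l) \<noteq> 0"
    and "at_least_quadratic g"
    and "0 < R" and "R \<le> 1/2"
    and "nonlinearity_in_coords P g R gt"
    and "\<forall>t\<ge>0. (\<lambda>z. y_dot gt z t) \<in> frakC R"
    and "continuous_on (polydisc R \<times> {0..}) (\<lambda>(z, t). y_dot gt z t)"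
  shows "((\<exists>Mf\<ge>1. \<forall>t\<ge>0. taylor_norm R (\<lambda>z. y_dot gt z t) \<le> ennreal Mf) \<and>
          (\<exists>\<gamma> \<tau>. \<gamma> > 0 \<and> \<tau> \<ge> real CARD('n) \<and> nonresonant lam \<gamma> \<tau>)
            \<longrightarrow> integrable_near_origin lam gt R)
       \<and> ((\<exists>Mf a. Mf \<ge> 1 \<and> 0 < a \<and> a < 1 \<and>
            (\<forall>t\<ge>0. taylor_norm R (\<lambda>z. y_dot gt z t) \<le> ennreal (Mf * exp (- a * t))))
            \<longrightarrow> integrable_near_origin lam gt R)"
proof (intro conjI impI; elim conjE exE)
  have P: "invertible P" using assms(1) by (simp add: diagonalizes_def)
  have R: "R \<le> 1" using assms(5) by simp
  have an: "(\<lambda>z. y_dot gt z t) \<in> frakC R" if "0 \<le> t" for t using assms(7) that by blast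
  {
    fix Mf \<gamma> \<tau>
    assume Mf: "1 \<le> Mf" "\<forall>t\<ge>0. taylor_norm R (\<lambda>z. y_dot gt z t) \<le> ennreal Mf"
      and \<gamma>: "0 < \<gamma>" and \<tau>: "real CARD('n) \<le> \<tau>" and nr: "nonresonant lam \<gamma> \<tau>"
    let ?D = "\<lambda>l u. Re (divisor lam l u)"
    have \<tau>0: "0 < \<tau>" using \<tau> zero_less_card_finite[where 'a = 'n] by linarith
    \<comment> \<open>The constant is raised to at least 1, as the counting argument
      assumes.\<close>
    have dioph: "?D l u \<noteq> 0 \<and> inverse \<bar>?D l u\<bar> \<le> max 1 \<gamma> * real (length u) powr \<tau>" if "2 \<le> length u" for l u
    proof -
      have "2 \<le> mi_size (count_list u)" using that by (simp add: mi_size_count_list)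
      then have "?D l u \<noteq> 0 \<and> inverse \<bar>?D l u\<bar> \<le> \<gamma> * real (mi_size (count_list u)) powr \<tau>"
        using nr unfolding nonresonant_def Let_def divisor_eq_sum by blast
      moreover have "\<gamma> * real (length u) powr \<tau> \<le> max 1 \<gamma> * real (length u) powr \<tau>"
        by (intro mult_right_mono) auto
      ultimately show ?thesis by (auto simp: mi_size_count_list)
    qed
    obtain C where C: "1 \<le> C" "\<And>T. proper T \<Longrightarrow> kprod (\<lambda>l u. inverse \<bar>?D l u\<bar>) T \<le> C ^ length (leaves T)"
    proof (rule brjuno_bound[of ?D "max 1 \<gamma>" \<tau>])
      show "?D l (us @ u @ vs) - ?D k u = ?D l (us @ [k] @ vs)" for l k us u vs
        using divisor_subword[of lam l us u vs k] by (metis minus_complex.simps(1))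
    qed (use dioph \<tau>0 in auto)
    show "integrable_near_origin lam gt R"
    proof (rule integrable_of_solver[OF P assms(3,4) R assms(6) an assms(8) Mf(1), where \<omega> = "\<lambda>_. 1" and C = C])
      show "norm (lin_solve (divisor lam l u) q t) \<le> inverse \<bar>?D l u\<bar> * Q"
        if "2 \<le> length u" "continuous_on {0..} q" "\<And>t. 0 \<le> t \<Longrightarrow> norm (q t) \<le> Q * 1" "0 \<le> t" for l u q Q t
        by (rule lin_solve_bounded) (use that dioph[OF that(1)] in auto)
    qed (use Mf C in auto)
  next
    fix Mf a :: real
    assume Mf: "1 \<le> Mf" and a: "0 < a" "a < 1"
      and tn: "\<forall>t\<ge>0. taylor_norm R (\<lambda>z. y_dot gt z t) \<le> ennreal (Mf * exp (- a * t))"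
    have C: "1 \<le> inverse a" using a by (simp add: one_le_inverse)
    show "integrable_near_origin lam gt R"
    proof (rule integrable_of_solver[OF P assms(3,4) R assms(6) an assms(8) Mf, where \<omega> = "\<lambda>t. exp (- a * t)" and C = "inverse a"])
      show "norm (lin_solve (divisor lam l u) q t) \<le> inverse a * Q"
        if "2 \<le> length u" "continuous_on {0..} q" "\<And>t. 0 \<le> t \<Longrightarrow> norm (q t) \<le> Q * exp (- a * t)" "0 \<le> t" for l u q Q t
        by (rule lin_solve_bounded_of_decay[OF that(2) a(1) that(3,4)])
      show "kprod (\<lambda>_ _. inverse a) T \<le> inverse a ^ length (leaves T)" if "proper T" for T :: "'n rtree"
      proof -
        \<comment> \<open>Inserts the spare factor of \<open>kprod_bound_const\<close>; it is at
          least 1 because a < 1.\<close>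
        have "kprod (\<lambda>_ _. inverse a) T * 1 \<le> kprod (\<lambda>_ _. inverse a) T * inverse a"
          using C a by (intro mult_left_mono kprod_nonneg) auto
        also have "\<dots> \<le> inverse a ^ length (leaves T)"
          by (rule kprod_bound_const[OF _ _ C that]) (use a in auto)
        finally show ?thesis by simp
      qed
    qed (use tn a C in auto)
  }
qed

end
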